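(* Let $L,g,\mu,m,H_{\max}>0$ be constants, let $h^*:=m/L$, and assume $h^*<H_{\max}$. For every $r\in[0,R)$ and for every $\sigma,q,k,\gamma,\beta>0$, $\lambda\in[0,1]$ with $$\frac{2g}{\mu L}>\sigma>\frac{8k}{q},\qquad \frac{2\pi^2\mu\,G^{-1}(-cr)}{mL^2\,G^{-1}(cr)}>\beta+4\sigma>8\sigma,$$ (where $R,c,G$ are the constants and the function defined in the context) there exist constants $M,\varphi>0$ with the following property. Every classical solution $(\xi,w,h,v,\zeta,z)$ of the closed-loop system consisting of the tank-liquid model $$\dot\xi=w,\quad \dot w=-f,\qquad h_t+(hv)_x=0\ \ (t>0,\ x\in[0,L]),$$ $$(hv)_t+\left(hv^2+\tfrac12 gh^2\right)_x=\mu(hv_x)_x+hf\ \ (t>0,\ x\in(0,L)),$$ $$v(t,0)=v(t,L)=0\ \ (t\ge0),\qquad \int_0^L h(t,x)\,dx=m\ \ (t\ge 0),$$ the reduced-order observer $$\dot\zeta(t)=-\gamma\zeta(t)-\gamma^2\xi(t)-f(t),$$ the filter $$\dot z(t)=mf(t)-\frac g2\left(h^2(t,L)-h^2(t,0)\right)-\beta\left(z(t)-\mu(h(t,L)-h(t,0))\right),\quad t>0,$$ and the feedback law $$f=-\sigma\left(2\lambda z+(1-2\lambda)\mu(h(t,L)-h(t,0))-q(\zeta+(\gamma+k)\xi)\right),\quad t>0,$$ with $\Psi(\xi(0),w(0),h[0],v[0],\zeta(0),z(0))\le r$, where $\Psi:X\times\mathbb R^2\to[0,+\infty)$ is the functional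 $$\Psi(\xi,w,h,v,\zeta,z):=V(\xi,w,h,v)+\frac{\sigma q^2}{\gamma}(\zeta-w+\gamma\xi)^2+\frac\lambda2\left(z-\int_0^L h(x)v(x)\,dx-\mu(h(L)-h(0))\right)^2,$$ satisfies $(\xi(t),w(t),h[t],v[t])\in X$ and the following estimate for all $t\ge0$: $$\begin{aligned}&\left\|(\xi(t),w(t),h[t]-h^*\chi_{[0,L]},v[t])\right\|_X+|\zeta(t)-w(t)+\gamma\xi(t)|\\&\quad+\sqrt\lambda\left|z(t)-\int_0^L h(t,x)v(t,x)\,dx-\mu(h(t,L)-h(t,0))\right|\\&\le M e^{-\varphi t}\Big(\left\|(\xi(0),w(0),h[0]-h^*\chi_{[0,L]},v[0])\right\|_X+|\zeta(0)-w(0)+\gamma\xi(0)|\\&\quad+\sqrt\lambda\left|z(0)-\int_0^L h(0,x)v(0,x)\,dx-\mu(h(0,L)-h(0,0))\right|\Big).\end{aligned}$$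
   Context: Notation: $u[t]$ denotes the profile $x\mapsto u(t,x)$; subscripts $t,x$ denote partial derivatives; $\chi_{[0,L]}$ is the characteristic function of $[0,L]$; $\|\cdot\|_2$ is the $L^2(0,L)$ norm. Constants and functions: $c:=\frac1{\mu\sqrt g}$ and $R:=\frac{2\mu\sqrt g}{3}\left(2h^*\sqrt{h^*}+\sqrt{H_{\max}}\,\min(H_{\max}-3h^*,0)\right)$. The function $G:(0,+\infty)\to\left(-\frac43h^*\sqrt{h^*},+\infty\right)$, $G(h):=\frac23\,\mathrm{sgn}(h-h^* )\left(h\sqrt h-3h^*\sqrt h+2h^*\sqrt{h^*}\right)$, is an increasing $C^1$ bijection and $G^{-1}$ is its inverse. State space: $S$ is the set of all $(\xi,w,h,v)$ with $(\xi,w)\in\mathbb R^2$, $h\in C^0([0,L];(0,+\infty))\cap H^1(0,L)$, $v\in C^0([0,L])$, $v(0)=v(L)=0$, $\int_0^L h(x)\,dx=m$. The functional $V:S\to[0,+\infty)$ is $$V(\xi,w,h,v):=W(h,v)+E(h,v)+\frac{qk^2}2\xi^2+\frac q2(w+k\xi)^2,$$ $$E(h,v):=\frac12\int_0^L h v^2\,dx+\frac g2\int_0^L(h-h^* )^2dx,\qquad W(h,v):=\frac12\int_0^L h^{-1}\left(hv+\mu h_x\right)^2dx+\frac g2\int_0^L(h-h^* )^2dx.$$ Put $X:=\{(\xi,w,h,v)\in S: V(\xi,w,h,v)<R\}$ and $\|(\xi,w,h,v)\|_X:=\left(\xi^2+w^2+\|h\|_2^2+\|h'\|_2^2+\|v\|_2^2\right)^{1/2}$.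 Classical solution: $\xi\in C^1([0,\infty))\cap C^2((0,\infty))$, $w\in C^0([0,\infty))\cap C^1((0,\infty))$, $v\in C^0([0,\infty)\times[0,L])\cap C^1((0,\infty)\times[0,L])$, $h\in C^1([0,\infty)\times[0,L];(0,\infty))\cap C^2((0,\infty)\times(0,L))$, $v[t]\in C^2((0,L))$ for each $t>0$, $f\in C^0([0,\infty))$, and $\zeta,z\in C^0([0,\infty))\cap C^1((0,\infty))$, satisfying all the equations. The constants $M,\varphi$ may depend on $r,\sigma,q,k,\gamma,\beta,\lambda,L,g,\mu,m,H_{\max}$ but not on the solution. *)

theory Defs
  imports "HOL-Analysis.Analysis"
begin

text \<open>
  Profiles on \<open>[0,L]\<close> are total functions \<open>real \<Rightarrow> real\<close>; only their values on \<open>[0,L]\<close> matter.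
  Throughout, \<open>hs\<close> stands for the equilibrium level \<open>h\<^sup>* = m / L\<close> and \<open>lam\<close> for the parameter
  \<open>\<lambda>\<close> (a reserved symbol).
\<close>

subsection \<open>Regularity classes\<close>

text \<open>
  Derivatives are taken within the given (nondegenerate) intervals, hence they are one-sided at
  endpoints that belong to the interval and ordinary at interior points.
\<close>

fun Ck :: "nat \<Rightarrow> real set \<Rightarrow> (real \<Rightarrow> real) \<Rightarrow> bool" where
  "Ck 0 S u \<longleftrightarrow> continuous_on S u"
| "Ck (Suc n) S u \<longleftrightarrow>
     u differentiable_on S \<and> Ck n S (\<lambda>x. vector_derivative u (at x within S))"

definition Dt :: "real set \<Rightarrow> (real \<Rightarrow> real \<Rightarrow> real) \<Rightarrow> real \<Rightarrow> real \<Rightarrow> real" where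
  "Dt T u t x = vector_derivative (\<lambda>s. u s x) (at t within T)"

definition Dx :: "real set \<Rightarrow> (real \<Rightarrow> real \<Rightarrow> real) \<Rightarrow> real \<Rightarrow> real \<Rightarrow> real" where
  "Dx I u t x = vector_derivative (\<lambda>y. u t y) (at x within I)"

text \<open>\<open>C\<^sup>n(T \<times> I)\<close> for functions \<open>u t x\<close> of two variables.\<close>

fun Ck2 :: "nat \<Rightarrow> real set \<Rightarrow> real set \<Rightarrow> (real \<Rightarrow> real \<Rightarrow> real) \<Rightarrow> bool" where
  "Ck2 0 T I u \<longleftrightarrow> continuous_on (T \<times> I) (\<lambda>(t, x). u t x)"
| "Ck2 (Suc n) T I u \<longleftrightarrow>
     continuous_on (T \<times> I) (\<lambda>(t, x). u t x) \<and>
     (\<forall>x\<in>I. (\<lambda>t. u t x) differentiable_on T) \<and>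
     (\<forall>t\<in>T. (\<lambda>x. u t x) differentiable_on I) \<and>
     Ck2 n T I (Dt T u) \<and> Ck2 n T I (Dx I u)"

subsection \<open>The spaces \<open>L\<^sup>2(0,L)\<close> and \<open>H\<^sup>1(0,L)\<close>\<close>

definition L2 :: "real \<Rightarrow> (real \<Rightarrow> real) \<Rightarrow> bool" where
  "L2 L u \<longleftrightarrow> u \<in> borel_measurable (lebesgue_on {0..L}) \<and>
              integrable (lebesgue_on {0..L}) (\<lambda>x. (u x)\<^sup>2)"

definition norm_L2 :: "real \<Rightarrow> (real \<Rightarrow> real) \<Rightarrow> real" where
  "norm_L2 L u = sqrt (\<integral>x. (u x)\<^sup>2 \<partial>lebesgue_on {0..L})"

text \<open>Test functions \<open>C\<^sub>c\<^sup>1(0,L)\<close>, extended by zero to the real line.\<close>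

definition test_fun :: "real \<Rightarrow> (real \<Rightarrow> real) \<Rightarrow> bool" where
  "test_fun L \<phi> \<longleftrightarrow> Ck 1 UNIV \<phi> \<and>
     (\<exists>K. compact K \<and> K \<subseteq> {0<..<L} \<and> (\<forall>x. x \<notin> K \<longrightarrow> \<phi> x = 0))"

definition is_weak_deriv :: "real \<Rightarrow> (real \<Rightarrow> real) \<Rightarrow> (real \<Rightarrow> real) \<Rightarrow> bool" where
  "is_weak_deriv L u p \<longleftrightarrow> L2 L p \<and>
     (\<forall>\<phi>. test_fun L \<phi> \<longrightarrow>
        (\<integral>x. u x * deriv \<phi> x \<partial>lebesgue_on {0..L}) =
        - (\<integral>x. p x * \<phi> x \<partial>lebesgue_on {0..L}))"

definition H1 :: "real \<Rightarrow> (real \<Rightarrow> real) \<Rightarrow> bool" where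
  "H1 L u \<longleftrightarrow> L2 L u \<and> (\<exists>p. is_weak_deriv L u p)"

text \<open>A representative of the weak derivative, which is unique up to null sets; it is used only
  under integrals.\<close>

definition weak_deriv :: "real \<Rightarrow> (real \<Rightarrow> real) \<Rightarrow> real \<Rightarrow> real" where
  "weak_deriv L u = (SOME p. is_weak_deriv L u p)"

subsection \<open>Constants, state space and functionals\<close>

definition c_const :: "real \<Rightarrow> real \<Rightarrow> real" where
  "c_const g \<mu> = 1 / (\<mu> * sqrt g)"

definition R_const :: "real \<Rightarrow> real \<Rightarrow> real \<Rightarrow> real \<Rightarrow> real" where
  "R_const g \<mu> hs Hmax =
     2 * \<mu> * sqrt g / 3 * (2 * hs * sqrt hs + sqrt Hmax * min (Hmax - 3 * hs) 0)"

definition G_fun :: "real \<Rightarrow> real \<Rightarrow> real" where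
  "G_fun hs h = 2 / 3 * sgn (h - hs) * (h * sqrt h - 3 * hs * sqrt h + 2 * hs * sqrt hs)"

definition G_inv :: "real \<Rightarrow> real \<Rightarrow> real" where
  "G_inv hs = the_inv_into {0<..} (G_fun hs)"

definition state_space ::
  "real \<Rightarrow> real \<Rightarrow> (real \<times> real \<times> (real \<Rightarrow> real) \<times> (real \<Rightarrow> real)) set" where
  "state_space L m = {(\<xi>, w, h, v).
     continuous_on {0..L} h \<and> (\<forall>x\<in>{0..L}. h x > 0) \<and> H1 L h \<and>
     continuous_on {0..L} v \<and> v 0 = 0 \<and> v L = 0 \<and>
     (\<integral>x. h x \<partial>lebesgue_on {0..L}) = m}"

definition E_fun :: "real \<Rightarrow> real \<Rightarrow> real \<Rightarrow> (real \<Rightarrow> real) \<Rightarrow> (real \<Rightarrow> real) \<Rightarrow> real" where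
  "E_fun L g hs h v =
     1 / 2 * (\<integral>x. h x * (v x)\<^sup>2 \<partial>lebesgue_on {0..L}) +
     g / 2 * (\<integral>x. (h x - hs)\<^sup>2 \<partial>lebesgue_on {0..L})"

definition W_fun ::
  "real \<Rightarrow> real \<Rightarrow> real \<Rightarrow> real \<Rightarrow> (real \<Rightarrow> real) \<Rightarrow> (real \<Rightarrow> real) \<Rightarrow> real" where
  "W_fun L g \<mu> hs h v =
     1 / 2 * (\<integral>x. inverse (h x) * (h x * v x + \<mu> * weak_deriv L h x)\<^sup>2 \<partial>lebesgue_on {0..L}) +
     g / 2 * (\<integral>x. (h x - hs)\<^sup>2 \<partial>lebesgue_on {0..L})"

definition V_fun ::
  "real \<Rightarrow> real \<Rightarrow> real \<Rightarrow> real \<Rightarrow> real \<Rightarrow> real \<Rightarrow>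
   real \<Rightarrow> real \<Rightarrow> (real \<Rightarrow> real) \<Rightarrow> (real \<Rightarrow> real) \<Rightarrow> real" where
  "V_fun L g \<mu> hs q k \<xi> w h v =
     W_fun L g \<mu> hs h v + E_fun L g hs h v + q * k\<^sup>2 / 2 * \<xi>\<^sup>2 + q / 2 * (w + k * \<xi>)\<^sup>2"

definition X_set ::
  "real \<Rightarrow> real \<Rightarrow> real \<Rightarrow> real \<Rightarrow> real \<Rightarrow> real \<Rightarrow> real \<Rightarrow> real \<Rightarrow>
   (real \<times> real \<times> (real \<Rightarrow> real) \<times> (real \<Rightarrow> real)) set" where
  "X_set L g \<mu> m hs Hmax q k =
     {(\<xi>, w, h, v). (\<xi>, w, h, v) \<in> state_space L m \<and>
        V_fun L g \<mu> hs q k \<xi> w h v < R_const g \<mu> hs Hmax}"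

definition norm_X ::
  "real \<Rightarrow> real \<Rightarrow> real \<Rightarrow> (real \<Rightarrow> real) \<Rightarrow> (real \<Rightarrow> real) \<Rightarrow> real" where
  "norm_X L \<xi> w h v =
     sqrt (\<xi>\<^sup>2 + w\<^sup>2 + (norm_L2 L h)\<^sup>2 + (norm_L2 L (weak_deriv L h))\<^sup>2 + (norm_L2 L v)\<^sup>2)"

definition filter_err ::
  "real \<Rightarrow> real \<Rightarrow> (real \<Rightarrow> real) \<Rightarrow> (real \<Rightarrow> real) \<Rightarrow> real \<Rightarrow> real" where
  "filter_err L \<mu> h v z = z - (\<integral>x. h x * v x \<partial>lebesgue_on {0..L}) - \<mu> * (h L - h 0)"

definition Psi_fun ::
  "real \<Rightarrow> real \<Rightarrow> real \<Rightarrow> real \<Rightarrow> real \<Rightarrow> real \<Rightarrow> real \<Rightarrow> real \<Rightarrow> real \<Rightarrow>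
   real \<Rightarrow> real \<Rightarrow> (real \<Rightarrow> real) \<Rightarrow> (real \<Rightarrow> real) \<Rightarrow> real \<Rightarrow> real \<Rightarrow> real" where
  "Psi_fun L g \<mu> hs \<sigma> q k \<gamma> lam \<xi> w h v \<zeta> z =
     V_fun L g \<mu> hs q k \<xi> w h v + \<sigma> * q\<^sup>2 / \<gamma> * (\<zeta> - w + \<gamma> * \<xi>)\<^sup>2 +
     lam / 2 * (filter_err L \<mu> h v z)\<^sup>2"

subsection \<open>Classical solutions of the closed-loop system\<close>

definition tank_model ::
  "real \<Rightarrow> real \<Rightarrow> real \<Rightarrow> real \<Rightarrow> (real \<Rightarrow> real) \<Rightarrow> (real \<Rightarrow> real) \<Rightarrow> (real \<Rightarrow> real) \<Rightarrow>
   (real \<Rightarrow> real \<Rightarrow> real) \<Rightarrow> (real \<Rightarrow> real \<Rightarrow> real) \<Rightarrow> bool" where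
  "tank_model L g \<mu> m f \<xi> w h v \<longleftrightarrow>
     (\<forall>t>0. (\<xi> has_real_derivative w t) (at t)) \<and>
     (\<forall>t>0. (w has_real_derivative - f t) (at t)) \<and>
     (\<forall>t>0. \<forall>x\<in>{0..L}. Dt {0..} h t x + Dx {0..L} (\<lambda>t x. h t x * v t x) t x = 0) \<and>
     (\<forall>t>0. \<forall>x\<in>{0<..<L}.
        Dt {0..} (\<lambda>t x. h t x * v t x) t x +
        Dx {0..L} (\<lambda>t x. h t x * (v t x)\<^sup>2 + 1 / 2 * g * (h t x)\<^sup>2) t x =
        \<mu> * Dx {0..L} (\<lambda>t x. h t x * Dx {0..L} v t x) t x + h t x * f t) \<and>
     (\<forall>t\<ge>0. v t 0 = 0 \<and> v t L = 0) \<and>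
     (\<forall>t\<ge>0. (\<integral>x. h t x \<partial>lebesgue_on {0..L}) = m)"

definition observer ::
  "real \<Rightarrow> (real \<Rightarrow> real) \<Rightarrow> (real \<Rightarrow> real) \<Rightarrow> (real \<Rightarrow> real) \<Rightarrow> bool" where
  "observer \<gamma> f \<xi> \<zeta> \<longleftrightarrow>
     (\<forall>t>0. (\<zeta> has_real_derivative (- \<gamma> * \<zeta> t - \<gamma>\<^sup>2 * \<xi> t - f t)) (at t))"

definition momentum_filter ::
  "real \<Rightarrow> real \<Rightarrow> real \<Rightarrow> real \<Rightarrow> real \<Rightarrow> (real \<Rightarrow> real) \<Rightarrow>
   (real \<Rightarrow> real \<Rightarrow> real) \<Rightarrow> (real \<Rightarrow> real) \<Rightarrow> bool" where
  "momentum_filter L g \<mu> m \<beta> f h z \<longleftrightarrow>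
     (\<forall>t>0. (z has_real_derivative
        (m * f t - g / 2 * ((h t L)\<^sup>2 - (h t 0)\<^sup>2) - \<beta> * (z t - \<mu> * (h t L - h t 0)))) (at t))"

definition feedback_law ::
  "real \<Rightarrow> real \<Rightarrow> real \<Rightarrow> real \<Rightarrow> real \<Rightarrow> real \<Rightarrow> real \<Rightarrow> (real \<Rightarrow> real) \<Rightarrow> (real \<Rightarrow> real) \<Rightarrow>
   (real \<Rightarrow> real \<Rightarrow> real) \<Rightarrow> (real \<Rightarrow> real) \<Rightarrow> (real \<Rightarrow> real) \<Rightarrow> bool" where
  "feedback_law L \<mu> \<sigma> q k \<gamma> lam f \<xi> h \<zeta> z \<longleftrightarrow>
     (\<forall>t>0. f t = - \<sigma> * (2 * lam * z t + (1 - 2 * lam) * \<mu> * (h t L - h t 0)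
                         - q * (\<zeta> t + (\<gamma> + k) * \<xi> t)))"

definition classical_regularity ::
  "real \<Rightarrow> (real \<Rightarrow> real) \<Rightarrow> (real \<Rightarrow> real) \<Rightarrow> (real \<Rightarrow> real) \<Rightarrow>
   (real \<Rightarrow> real \<Rightarrow> real) \<Rightarrow> (real \<Rightarrow> real \<Rightarrow> real) \<Rightarrow> (real \<Rightarrow> real) \<Rightarrow> (real \<Rightarrow> real) \<Rightarrow> bool" where
  "classical_regularity L f \<xi> w h v \<zeta> z \<longleftrightarrow>
     Ck 1 {0..} \<xi> \<and> Ck 2 {0<..} \<xi> \<and>
     Ck 0 {0..} w \<and> Ck 1 {0<..} w \<and>
     Ck2 0 {0..} {0..L} v \<and> Ck2 1 {0<..} {0..L} v \<and>
     Ck2 1 {0..} {0..L} h \<and> (\<forall>t\<ge>0. \<forall>x\<in>{0..L}. h t x > 0) \<and> Ck2 2 {0<..} {0<..<L} h \<and>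
     (\<forall>t>0. Ck 2 {0<..<L} (v t)) \<and>
     Ck 0 {0..} f \<and>
     Ck 0 {0..} \<zeta> \<and> Ck 1 {0<..} \<zeta> \<and>
     Ck 0 {0..} z \<and> Ck 1 {0<..} z"

definition classical_solution ::
  "real \<Rightarrow> real \<Rightarrow> real \<Rightarrow> real \<Rightarrow> real \<Rightarrow> real \<Rightarrow> real \<Rightarrow> real \<Rightarrow> real \<Rightarrow> real \<Rightarrow>
   (real \<Rightarrow> real) \<Rightarrow> (real \<Rightarrow> real) \<Rightarrow> (real \<Rightarrow> real) \<Rightarrow>
   (real \<Rightarrow> real \<Rightarrow> real) \<Rightarrow> (real \<Rightarrow> real \<Rightarrow> real) \<Rightarrow> (real \<Rightarrow> real) \<Rightarrow> (real \<Rightarrow> real) \<Rightarrow> bool" where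
  "classical_solution L g \<mu> m \<sigma> q k \<gamma> \<beta> lam f \<xi> w h v \<zeta> z \<longleftrightarrow>
     classical_regularity L f \<xi> w h v \<zeta> z \<and>
     tank_model L g \<mu> m f \<xi> w h v \<and>
     observer \<gamma> f \<xi> \<zeta> \<and>
     momentum_filter L g \<mu> m \<beta> f h z \<and>
     feedback_law L \<mu> \<sigma> q k \<gamma> lam f \<xi> h \<zeta> z"

definition error_size ::
  "real \<Rightarrow> real \<Rightarrow> real \<Rightarrow> real \<Rightarrow> real \<Rightarrow>
   real \<Rightarrow> real \<Rightarrow> (real \<Rightarrow> real) \<Rightarrow> (real \<Rightarrow> real) \<Rightarrow> real \<Rightarrow> real \<Rightarrow> real" where
  "error_size L \<mu> hs \<gamma> lam \<xi> w h v \<zeta> z =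
     norm_X L \<xi> w (\<lambda>x. h x - hs * indicator {0..L} x) v + \<bar>\<zeta> - w + \<gamma> * \<xi>\<bar> +
     sqrt lam * \<bar>filter_err L \<mu> h v z\<bar>"

end

theory Submission
  imports Defs
begin

text \<open>
  The Lyapunov functional is \<open>\<Psi>\<close> itself. Put \<open>u = v + \<mu> h\<^sub>x / h\<close>. Along solutions \<open>h (u\<^sub>t + v u\<^sub>x) = h (f - g h\<^sub>x)\<close>,
  so \<open>E\<close> and \<open>W\<close> obey balance laws and, with \<open>P = \<integral> h v\<close> and \<open>D = \<mu> (h(L) - h(0))\<close>,
  \<open>d/dt (E + W) = - \<mu> \<integral> h v\<^sub>x\<^sup>2 - \<mu> g \<integral> h\<^sub>x\<^sup>2 + f (2 P + D)\<close>. The observer and filter errors satisfy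
  \<open>e' = - \<gamma> e\<close> and \<open>y' = - \<beta> (y + P)\<close>. Wirtinger's inequality and the Cauchy-Schwarz inequality bound \<open>P\<^sup>2\<close> and
  \<open>D\<^sup>2\<close> by the two dissipation integrals as long as \<open>h\<close> stays between two levels \<open>a\<close> and \<open>b\<close>, and the parameter
  conditions make the remaining quadratic form negative definite, hence \<open>\<Psi>' \<le> - \<kappa> \<Psi>\<close>. The levels come from
  \<open>\<bar>G(h(x))\<bar> \<le> c V\<close>. Because the parameter conditions are strict, \<open>a\<close> and \<open>b\<close> can be chosen slightly outside
  \<open>[G\<^sup>-\<^sup>1(- c r), G\<^sup>-\<^sup>1(c r)]\<close>; the decay then holds on a sublevel set \<open>\<Psi> \<le> r'\<close> with \<open>r' > r\<close>, which makes
  \<open>\<Psi> \<le> r\<close> invariant.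
\<close>

section \<open>Weak derivatives\<close>

text \<open>\<open>E\<close> alone dissipates only \<open>v_x\<close>, which gives no decay of the
  level. The velocity \<open>u\<close> repairs this: differentiating the continuity equation gives
  \<open>\<mu> h_xt = - \<mu> (h v)_xx\<close>, which cancels the viscous stress in the momentum
  equation, and the pressure term \<open>- g h_x\<close> then damps \<open>h_x\<close>. The
  cancellation uses second derivatives that are available only inside the domain, which shapes the
  treatment of all integrals. The feedback is built around the factor of \<open>f\<close> in
  \<open>\<Psi>'\<close>, namely \<open>A = 2 P + D - q (w + k \<xi>)\<close>; it equals
  \<open>- \<sigma> A\<close> up to terms in the two errors and \<open>P\<close>. The unmeasured
  momentum is thus not cancelled but dominated, which is why \<open>\<beta> / 2 + 2 \<sigma>\<close>
  must stay below \<open>pi^2 \<mu> a / (m L^2 b)\<close>; the ratio \<open>a / b\<close> is the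
  price of the weight \<open>h\<close> in Wirtinger's inequality. The rate and the norm constants
  come from statements about plain real numbers, so they are fixed before any solution
  appears.\<close>

lemma bump_has_derivative:
  fixes a b n :: real
  assumes "n \<ge> 0"
  defines "\<psi> \<equiv> \<lambda>x::real. max 0 ((x - a) * (b - x))"
  shows "((\<lambda>x. n * (\<psi> x)\<^sup>2 / (1 + n * (\<psi> x)\<^sup>2)) has_real_derivative
           n * (2 * \<psi> x * (a + b - 2 * x)) / (1 + n * (\<psi> x)\<^sup>2)\<^sup>2) (at x)"
proof -
  \<comment> \<open>Squaring removes the kink of the positive part: at \<open>0\<close> the
    difference quotient is bounded by the size of the increment. The bump becomes
    \<open>C^1\<close>, which is all that a test function needs.\<close>
  have pos_part_sq: "((\<lambda>y::real. (max 0 y)\<^sup>2) has_real_derivative 2 * max 0 y) (at y)" for y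
  proof (cases "y = 0")
    case True
    have "((\<lambda>h::real. (max 0 h)\<^sup>2 / h) \<longlongrightarrow> 0) (at 0)"
    proof (rule tendsto_sandwich[where f="\<lambda>h. - \<bar>h\<bar>" and h="\<lambda>h. \<bar>h\<bar>"])
      have "- \<bar>h\<bar> \<le> (max 0 h)\<^sup>2 / h" "(max 0 h)\<^sup>2 / h \<le> \<bar>h\<bar>" for h :: real
        by (cases "h > 0") (auto simp: max_def power2_eq_square)
      then show "\<forall>\<^sub>F h in at 0. - \<bar>h::real\<bar> \<le> (max 0 h)\<^sup>2 / h" 
        "\<forall>\<^sub>F h in at 0. (max 0 h)\<^sup>2 / h \<le> \<bar>h::real\<bar>" by (simp_all only: eventually_True)
    qed (auto intro!: tendsto_eq_intros)
    then show ?thesis using True by (simp add: has_field_derivative_def DERIV_def DERIV_D)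
        (simp add: DERIV_def flip: has_field_derivative_def)
  next
    case False
    show ?thesis
    proof (cases "y > 0")
      case True
      have "((\<lambda>y::real. y\<^sup>2) has_real_derivative 2 * max 0 y) (at y)"
        using True by (auto intro!: derivative_eq_intros)
      then show ?thesis
        by (rule has_field_derivative_transform_within_open[where S="{0<..}"]) (use True in auto)
    next
      case False': False
      have "((\<lambda>y::real. 0) has_real_derivative 2 * max 0 y) (at y)"
        using False' False by (auto intro!: derivative_eq_intros)
      then show ?thesis
        by (rule has_field_derivative_transform_within_open[where S="{..<0}"])
          (use False False' in auto)
    qed
  qed
  have sq: "((\<lambda>x. (\<psi> x)\<^sup>2) has_real_derivative (2 * \<psi> x * (a + b - 2 * x))) (at x)"
    unfolding \<psi>_def
    by (rule DERIV_cong[OF DERIV_chain2[OF pos_part_sq]])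
       (auto intro!: derivative_eq_intros simp: algebra_simps)
  have pos: "1 + n * (\<psi> x)\<^sup>2 \<noteq> 0"
    using assms(1) by (smt (verit) mult_nonneg_nonneg zero_le_power2)
  show ?thesis
    by (rule DERIV_cong[OF DERIV_divide[OF DERIV_cmult[OF sq] DERIV_add[OF DERIV_const DERIV_cmult[OF sq]] pos]])
       (use pos in \<open>simp add: field_simps power2_eq_square\<close>)
qed


text \<open>Applying \<open>y / (1 + y)\<close> to \<open>n\<close> times the squared positive part
  of a parabola keeps the support in \<open>[a, b]\<close> and the range in \<open>[0, 1)\<close>,
  while growing \<open>n\<close> drives the value to \<open>1\<close> at every point of
  \<open>(a, b)\<close>.\<close>

lemma test_fun_bump:
  fixes a b n :: real
  assumes "n \<ge> 0" "0 < a" "a < b" "b < L"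
  defines "\<psi> \<equiv> \<lambda>x::real. max 0 ((x - a) * (b - x))"
  shows "test_fun L (\<lambda>x. n * (\<psi> x)\<^sup>2 / (1 + n * (\<psi> x)\<^sup>2))"
proof -
  have deriv: "((\<lambda>x. n * (\<psi> x)\<^sup>2 / (1 + n * (\<psi> x)\<^sup>2)) has_real_derivative
           n * (2 * \<psi> x * (a + b - 2 * x)) / (1 + n * (\<psi> x)\<^sup>2)\<^sup>2) (at x)" for x
    unfolding \<psi>_def by (rule bump_has_derivative[OF assms(1)])
  have pos: "1 + n * (\<psi> x)\<^sup>2 \<noteq> 0" for x
    using assms(1) by (smt (verit) mult_nonneg_nonneg zero_le_power2)
  have "vector_derivative (\<lambda>x. n * (\<psi> x)\<^sup>2 / (1 + n * (\<psi> x)\<^sup>2)) (at x) =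
          n * (2 * \<psi> x * (a + b - 2 * x)) / (1 + n * (\<psi> x)\<^sup>2)\<^sup>2" for x
    using deriv by (intro vector_derivative_at) (simp add: has_real_derivative_iff_has_vector_derivative)
  moreover have "continuous_on UNIV (\<lambda>x. n * (2 * \<psi> x * (a + b - 2 * x)) / (1 + n * (\<psi> x)\<^sup>2)\<^sup>2)"
    using pos unfolding \<psi>_def by (intro continuous_intros) auto
  moreover have "(\<lambda>x. n * (\<psi> x)\<^sup>2 / (1 + n * (\<psi> x)\<^sup>2)) differentiable_on UNIV"
    using deriv by (auto simp: differentiable_on_def real_differentiable_def)
  ultimately have "Ck 1 UNIV (\<lambda>x. n * (\<psi> x)\<^sup>2 / (1 + n * (\<psi> x)\<^sup>2))"
    by simp
  moreover have "\<psi> x = 0" if "x \<notin> {a..b}" for x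
  proof -
    have "(x - a) * (b - x) \<le> 0"
      using that assms(3) by (auto simp: mult_le_0_iff)
    then show ?thesis by (simp add: \<psi>_def)
  qed
  ultimately show ?thesis
    unfolding test_fun_def using assms by (auto intro!: exI[of _ "{a..b}"])
qed

text \<open>The positive and the negative part of \<open>f\<close> are densities of two measures
  that agree, with finite values, on all half lines, hence agree everywhere; uniqueness of densities
  makes the two parts equal almost everywhere. As \<open>ennreal\<close> cuts negative values off at
  \<open>0\<close>, this leaves only \<open>f x = 0\<close>.\<close>

lemma real_integrable_AE_zeroI:
  fixes f :: "real \<Rightarrow> real"
  assumes f: "integrable lborel f"
    and zero: "\<And>x. (\<integral>y. indicator {x<..} y * f y \<partial>lborel) = 0"
  shows "AE x in lborel. f x = 0"
proof -
  have [measurable]: "f \<in> borel_measurable borel" using f by auto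
  define P where "P = density lborel (\<lambda>x. ennreal (f x))"
  define N where "N = density lborel (\<lambda>x. ennreal (- f x))"
  have int: "integrable lborel (\<lambda>y. indicator {x<..} y * f y)" for x
    using integrable_mult_indicator[of "{x<..}" lborel f] f by simp
  have P: "emeasure P {x<..} = (\<integral>\<^sup>+y. ennreal (indicator {x<..} y * f y) \<partial>lborel)" for x
    unfolding P_def by (subst emeasure_density) (auto intro!: nn_integral_cong simp: indicator_def)
  have N: "emeasure N {x<..} = (\<integral>\<^sup>+y. ennreal (- (indicator {x<..} y * f y)) \<partial>lborel)" for x
    unfolding N_def by (subst emeasure_density) (auto intro!: nn_integral_cong simp: indicator_def)
  have finP: "emeasure P {x<..} < \<infinity>" for x
    using int[of x] unfolding P real_integrable_def by (auto simp: less_top)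
  have finN: "emeasure N {x<..} < \<infinity>" for x
    using int[of x] unfolding N real_integrable_def by (auto simp: less_top)
  have "P = N"
  proof (rule measure_eqI_lessThan)
    fix x
    have "enn2real (emeasure P {x<..}) - enn2real (emeasure N {x<..}) = 0"
      using zero[of x] real_lebesgue_integral_def[OF int[of x]] P N by simp
    then show "emeasure P {x<..} = emeasure N {x<..}"
      using finP[of x] finN[of x] by (simp add: less_top) (metis ennreal_enn2real)
  qed (use finP in \<open>auto simp: P_def N_def\<close>)
  then have "AE x in lborel. ennreal (f x) = ennreal (- f x)"
    unfolding P_def N_def by (intro sigma_finite_measure.density_unique[OF sigma_finite_lborel]) auto
  then show ?thesis
    by eventually_elim (metis add.inverse_inverse ennreal_eq_0_iff ennreal_inj linorder_linear 
        neg_0_le_iff_le neg_equal_zero order_antisym)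
qed

text \<open>The bumps on \<open>(a + 1/n, L - 1/n)\<close> converge to the indicator function of \<open>(a, L)\<close>, so \<open>d\<close> has
  vanishing integrals over all half lines.\<close>

lemma fundamental_lemma_of_variations:
  assumes d: "integrable (lebesgue_on {0..L}) d" and "0 < L"
    and test: "\<And>\<phi>. test_fun L \<phi> \<Longrightarrow> (\<integral>x. d x * \<phi> x \<partial>lebesgue_on {0..L}) = 0"
  shows "AE x in lebesgue_on {0..L}. d x = 0"
proof -
  define D where "D x = indicator {0..L} x * d x" for x
  have D: "integrable lebesgue D"
    using d unfolding D_def by (subst (asm) integrable_restrict_space) auto
  \<comment> \<open>A Borel representative is needed because the half-line argument compares
    measures on \<open>lborel\<close>, whereas \<open>D\<close> is only Lebesgue measurable.\<close>
  obtain D' where D'm: "D' \<in> borel_measurable lborel" and DD': "AE x in lborel. D x = D' x"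
    using completion_ex_borel_measurable_real[of D lborel] D by auto
  have D': "integrable lborel D'"
  proof -
    have "integrable lebesgue D'"
      using D D'm DD' by (subst integrable_cong_AE[where g = D])
        (auto intro: AE_completion measurable_completion elim: AE_mp)
    then show ?thesis using D'm integrable_completion by blast
  qed
  have test': "(\<integral>x. D' x * \<phi> x \<partial>lborel) = 0" if "test_fun L \<phi>" for \<phi>
  proof -
    have "continuous_on UNIV \<phi>"
      using that unfolding test_fun_def by (auto intro: differentiable_imp_continuous_on)
    then have \<phi>m: "\<phi> \<in> borel_measurable borel" by (rule borel_measurable_continuous_onI)
    have "(\<integral>x. D' x * \<phi> x \<partial>lborel) = (\<integral>x. D' x * \<phi> x \<partial>lebesgue)"
      using \<phi>m D'm by (subst integral_completion) auto
    also have "\<dots> = (\<integral>x. D x * \<phi> x \<partial>lebesgue)"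
      using \<phi>m D'm D DD' 
      by (intro integral_cong_AE borel_measurable_times)
        (auto intro: measurable_completion AE_completion elim!: AE_mp intro!: AE_completion)
    also have "\<dots> = (\<integral>x. d x * \<phi> x \<partial>lebesgue_on {0..L})"
      unfolding D_def by (subst integral_restrict_space) (auto simp: mult.assoc)
    finally show ?thesis using test[OF that] by simp
  qed
  have zero: "(\<integral>y. indicator {x<..} y * D' y \<partial>lborel) = 0" for x
  proof -
    \<comment> \<open>Up to null sets the half line meets \<open>{0..L}\<close> in
      \<open>(a, L)\<close>, which is empty once \<open>x\<close> is at or beyond
      \<open>L\<close>.\<close>
    define a where "a = max 0 x"
    have eq: "(\<integral>y. indicator {x<..} y * D' y \<partial>lborel) = (\<integral>y. D' y * indicator {a<..<L} y \<partial>lborel)"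
    proof (rule integral_cong_AE)
      have "AE y in lborel. y \<noteq> 0 \<and> y \<noteq> L"
        using AE_lborel_singleton[of 0] AE_lborel_singleton[of L] by auto
      with DD' show "AE y in lborel. indicator {x<..} y * D' y = D' y * indicator {a<..<L} y"
        by eventually_elim (auto simp: D_def a_def indicator_def split: if_splits)
    qed (use D'm in auto)
    show ?thesis
    proof (cases "a < L")
      case False
      then show ?thesis using eq by simp
    next
      case True
      \<comment> \<open>The shift by \<open>3\<close> gives \<open>2 * \<delta> n < L - a\<close>
        for every \<open>n\<close>, including \<open>n = 0\<close>, so each bump lives on a
        nondegenerate interval compactly inside \<open>(0, L)\<close>.\<close>
      define \<delta> where "\<delta> n = (L - a) / (real n + 3)" for n
      define \<psi> where "\<psi> n y = max 0 ((y - (a + \<delta> n)) * (L - \<delta> n - y))" for n y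
      define \<phi> where "\<phi> n y = real n * (\<psi> n y)\<^sup>2 / (1 + real n * (\<psi> n y)\<^sup>2)" for n y
      have \<delta>: "0 < \<delta> n" "a + \<delta> n < L - \<delta> n" for n
      proof -
        have "2 * \<delta> n < L - a"
          using True mult_strict_left_mono[of 2 "real n + 3" "L - a"]
          by (simp add: \<delta>_def divide_less_eq mult.commute)
        then show "a + \<delta> n < L - \<delta> n" by simp
      qed (use True in \<open>simp add: \<delta>_def\<close>)
      have \<delta>0: "\<delta> \<longlonglongrightarrow> 0" unfolding \<delta>_def
        using LIMSEQ_ignore_initial_segment[OF lim_const_over_n[of "L - a"], of 3] by simp
      have "test_fun L (\<phi> n)" for n
        unfolding \<phi>_def \<psi>_def using \<delta>[of n] by (intro test_fun_bump) (auto simp: a_def)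
      then have int0: "(\<integral>y. D' y * \<phi> n y \<partial>lborel) = 0" for n
        by (rule test')
      have \<phi>01: "0 \<le> \<phi> n y \<and> \<phi> n y \<le> 1" for n y
      proof -
        have "0 \<le> real n * (\<psi> n y)\<^sup>2" by simp
        then have "0 < 1 + real n * (\<psi> n y)\<^sup>2" by linarith
        then show ?thesis by (simp add: \<phi>_def divide_le_eq)
      qed
      have \<phi>m: "\<phi> n \<in> borel_measurable borel" for n
        unfolding \<phi>_def \<psi>_def by measurable
      have conv: "(\<lambda>n. \<phi> n y) \<longlonglongrightarrow> indicator {a<..<L} y" for y
      proof (cases "y \<in> {a<..<L}")
        case True
        define c where "c = (y - a) * (L - y)"
        have "c > 0" using True by (auto simp: c_def)
        have "(\<lambda>n. \<psi> n y) \<longlonglongrightarrow> max 0 ((y - (a + 0)) * (L - 0 - y))"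
          unfolding \<psi>_def by (intro tendsto_intros \<delta>0)
        then have \<psi>: "(\<lambda>n. \<psi> n y) \<longlonglongrightarrow> c" using \<open>c > 0\<close> by (simp add: c_def)
        \<comment> \<open>Dividing numerator and denominator by \<open>n\<close> exposes the limit
          \<open>c^2 / c^2 = 1\<close>. The rewriting is valid only for \<open>n > 0\<close>, hence
          the eventual equality below.\<close>
        have "(\<lambda>n. (\<psi> n y)\<^sup>2 / (inverse (real n) + (\<psi> n y)\<^sup>2)) \<longlonglongrightarrow> c\<^sup>2 / (0 + c\<^sup>2)"
          using \<open>c > 0\<close> by (intro tendsto_intros \<psi> lim_inverse_n) auto
        moreover have "\<forall>\<^sub>F n in sequentially. (\<psi> n y)\<^sup>2 / (inverse (real n) + (\<psi> n y)\<^sup>2) = \<phi> n y"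
          using eventually_gt_at_top[of 0]
        proof eventually_elim
          case (elim n)
          then have "inverse (real n) + (\<psi> n y)\<^sup>2 = (1 + real n * (\<psi> n y)\<^sup>2) / real n"
            by (simp add: field_simps)
          then show ?case by (simp add: \<phi>_def mult.commute)
        qed
        ultimately show ?thesis
          using True \<open>c > 0\<close> by (auto elim: Lim_transform_eventually)
      next
        case False
        have "\<phi> n y = 0" for n
        proof -
          have "(y - (a + \<delta> n)) * (L - \<delta> n - y) \<le> 0"
            using False \<delta>[of n] by (auto simp: mult_le_0_iff)
          then show ?thesis by (simp add: \<phi>_def \<psi>_def)
        qed
        then show ?thesis using False by simp
      qed
      have "(\<lambda>n. \<integral>y. D' y * \<phi> n y \<partial>lborel) \<longlonglongrightarrow> (\<integral>y. D' y * indicator {a<..<L} y \<partial>lborel)"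
      proof (rule integral_dominated_convergence[where w = "\<lambda>y. \<bar>D' y\<bar>"])
        show "AE y in lborel. norm (D' y * \<phi> n y) \<le> \<bar>D' y\<bar>" for n
          using \<phi>01[of n] by (auto simp: abs_mult mult_left_le)
        show "AE y in lborel. (\<lambda>n. D' y * \<phi> n y) \<longlonglongrightarrow> D' y * indicator {a<..<L} y"
          by (intro AE_I2 tendsto_intros conv)
      qed (use D' D'm \<phi>m in auto)
      then show ?thesis by (simp add: int0 eq LIMSEQ_const_iff)
    qed
  qed
  have "AE x in lborel. D' x = 0"
    using D' zero by (rule real_integrable_AE_zeroI)
  with DD' have "AE x in lborel. D x = 0" by eventually_elim simp
  then have "AE x in lebesgue. D x = 0" by (rule AE_completion)
  then show ?thesis
    by (subst AE_restrict_space_iff) (auto simp: D_def elim!: AE_mp)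
qed

lemma lebesgue_on_integral_continuous:
  fixes F :: "real \<Rightarrow> real"
  assumes "continuous_on {a..b} F"
  shows "(\<integral>x. F x \<partial>lebesgue_on {a..b}) = integral {a..b} F"
  using continuous_imp_integrable_real[OF assms] by (intro lebesgue_integral_eq_integral) auto

lemma L2_continuous:
  assumes "continuous_on {0..L} u"
  shows "L2 L u"
proof -
  have "continuous_on {0..L} (\<lambda>x. (u x)\<^sup>2)" using assms by (intro continuous_intros)
  then show ?thesis
    unfolding L2_def using continuous_imp_integrable_real assms by blast
qed

lemma L2_imp_integrable:
  assumes "L2 L u"
  shows "integrable (lebesgue_on {0..L}) u"
proof (rule Bochner_Integration.integrable_bound)
  have "finite_measure (lebesgue_on {0..L})" by (intro finite_measure_lebesgue_on) auto
  then show "integrable (lebesgue_on {0..L}) (\<lambda>x. 1 + (u x)\<^sup>2)"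
    using assms unfolding L2_def
    by (intro Bochner_Integration.integrable_add finite_measure.integrable_const) auto
  have "\<bar>y\<bar> \<le> 1 + y\<^sup>2" for y :: real
  proof -
    have "0 \<le> (\<bar>y\<bar> - 1 / 2)\<^sup>2" by simp
    then show ?thesis by (simp add: power2_diff) (simp add: field_simps)
  qed
  then show "AE x in lebesgue_on {0..L}. norm (u x) \<le> norm (1 + (u x)\<^sup>2)"
    by (intro AE_I2) (auto intro: order_trans[OF _ abs_ge_self])
qed (use assms in \<open>auto simp: L2_def\<close>)

lemma test_fun_props:
  assumes "test_fun L \<phi>" "0 < L"
  shows "\<phi> 0 = 0" "\<phi> L = 0" "(\<phi> has_real_derivative deriv \<phi> x) (at x)"
    "continuous_on UNIV \<phi>" "continuous_on UNIV (deriv \<phi>)"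
proof -
  have d: "\<phi> differentiable_on UNIV" and c: "continuous_on UNIV (\<lambda>x. vector_derivative \<phi> (at x))"
    using assms by (auto simp: test_fun_def)
  show \<phi>: "(\<phi> has_real_derivative deriv \<phi> x) (at x)" for x
    using d by (simp add: DERIV_deriv_iff_real_differentiable differentiable_on_def)
  then have "vector_derivative \<phi> (at x) = deriv \<phi> x" for x
    by (intro vector_derivative_at) (simp add: has_real_derivative_iff_has_vector_derivative)
  with c show "continuous_on UNIV (deriv \<phi>)" by simp
  show "continuous_on UNIV \<phi>" using d by (rule differentiable_imp_continuous_on)
qed (use assms in \<open>auto simp: test_fun_def\<close>)

text \<open>\<open>weak_deriv\<close> is a Hilbert choice, of which only the defining property is
  known. Integration by parts makes \<open>p\<close> a weak derivative too, and the difference of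
  two weak derivatives is orthogonal to all test functions, hence zero almost everywhere.
  Measurability is recorded because exchanging integrands almost everywhere asks for it.\<close>

lemma weak_deriv_classical:
  assumes "0 < L"
    and u: "\<And>x. x \<in> {0..L} \<Longrightarrow> (u has_real_derivative p x) (at x within {0..L})"
    and p: "continuous_on {0..L} p"
  shows "is_weak_deriv L u p" "AE x in lebesgue_on {0..L}. weak_deriv L u x = p x"
    "weak_deriv L u \<in> borel_measurable (lebesgue_on {0..L})"
proof -
  have uc: "continuous_on {0..L} u"
    by (rule DERIV_continuous_on[OF u])
  show wd: "is_weak_deriv L u p"
    unfolding is_weak_deriv_def
  proof (intro conjI allI impI L2_continuous p)
    fix \<phi> assume "test_fun L \<phi>"
    note \<phi> = test_fun_props[OF this \<open>0 < L\<close>]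
    have \<phi>c: "continuous_on {0..L} \<phi>" "continuous_on {0..L} (deriv \<phi>)"
      using \<phi>(4,5) continuous_on_subset by blast+
    have "((\<lambda>x. p x * \<phi> x + u x * deriv \<phi> x) has_integral u L * \<phi> L - u 0 * \<phi> 0) {0..L}"
    proof (rule fundamental_theorem_of_calculus)
      fix x assume "x \<in> {0..L}"
      then have "((\<lambda>x. u x * \<phi> x) has_real_derivative p x * \<phi> x + u x * deriv \<phi> x) (at x within {0..L})"
        using DERIV_mult[OF u DERIV_subset[OF \<phi>(3) subset_UNIV], of x] by (simp add: add.commute mult.commute)
      then show "((\<lambda>x. u x * \<phi> x) has_vector_derivative p x * \<phi> x + u x * deriv \<phi> x) (at x within {0..L})"
        by (simp add: has_real_derivative_iff_has_vector_derivative)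
    qed (use \<open>0 < L\<close> in auto)
    then have "integral {0..L} (\<lambda>x. p x * \<phi> x + u x * deriv \<phi> x) = 0"
      using \<phi>(1,2) by (simp add: integral_unique)
    moreover have "integral {0..L} (\<lambda>x. p x * \<phi> x + u x * deriv \<phi> x) =
        integral {0..L} (\<lambda>x. p x * \<phi> x) + integral {0..L} (\<lambda>x. u x * deriv \<phi> x)"
      using p uc \<phi>c by (intro integral_add integrable_continuous_real continuous_intros)
    ultimately show "(\<integral>x. u x * deriv \<phi> x \<partial>lebesgue_on {0..L}) = - (\<integral>x. p x * \<phi> x \<partial>lebesgue_on {0..L})"
      using p uc \<phi>c by (subst (1 2) lebesgue_on_integral_continuous) (auto intro!: continuous_intros)
  qed
  define q where "q = weak_deriv L u"
  have q: "is_weak_deriv L u q"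
    unfolding q_def weak_deriv_def using someI[of "is_weak_deriv L u" p] wd by blast
  have int: "integrable (lebesgue_on {0..L}) q" "integrable (lebesgue_on {0..L}) p"
    using q wd L2_imp_integrable unfolding is_weak_deriv_def by auto
  show "weak_deriv L u \<in> borel_measurable (lebesgue_on {0..L})"
    using int(1) by (auto simp: q_def)
  have "AE x in lebesgue_on {0..L}. q x - p x = 0"
  proof (rule fundamental_lemma_of_variations)
    fix \<phi> assume tf: "test_fun L \<phi>"
    note \<phi> = test_fun_props[OF this \<open>0 < L\<close>]
    have \<phi>c: "continuous_on {0..L} \<phi>" using \<phi>(4) continuous_on_subset by blast
    then obtain B where "\<forall>y\<in>\<phi> ` {0..L}. norm y \<le> B"
      using compact_imp_bounded[OF compact_continuous_image[OF \<phi>c compact_Icc]]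
      unfolding bounded_iff by blast
    then have B: "\<bar>\<phi> x\<bar> \<le> B" if "x \<in> {0..L}" for x using that by auto
    have i: "integrable (lebesgue_on {0..L}) (\<lambda>x. w x * \<phi> x)"
      if "integrable (lebesgue_on {0..L}) w" for w
    proof (rule Bochner_Integration.integrable_bound)
      show "integrable (lebesgue_on {0..L}) (\<lambda>x. B * w x)" using that by simp
      show "(\<lambda>x. w x * \<phi> x) \<in> borel_measurable (lebesgue_on {0..L})"
        using that continuous_imp_integrable_real[OF \<phi>c] by auto
      show "AE x in lebesgue_on {0..L}. norm (w x * \<phi> x) \<le> norm (B * w x)"
      proof (rule AE_I2)
        fix x assume "x \<in> space (lebesgue_on {0..L})"
        then have "\<bar>\<phi> x\<bar> \<le> \<bar>B\<bar>" using B[of x] by auto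
        then show "norm (w x * \<phi> x) \<le> norm (B * w x)"
          by (simp add: abs_mult mult.commute mult_right_mono)
      qed
    qed
    show "(\<integral>x. (q x - p x) * \<phi> x \<partial>lebesgue_on {0..L}) = 0"
      using q wd tf i[OF int(1)] i[OF int(2)]
      by (simp add: is_weak_deriv_def left_diff_distrib Bochner_Integration.integral_diff)
  qed (use int \<open>0 < L\<close> in auto)
  then show "AE x in lebesgue_on {0..L}. weak_deriv L u x = p x"
    by eventually_elim (simp add: q_def)
qed

section \<open>The Cauchy-Schwarz and Wirtinger inequalities on an interval\<close>

lemma Cauchy_Schwarz_integral:
  fixes f g :: "real \<Rightarrow> real"
  assumes f: "continuous_on {a..b} f" and g: "continuous_on {a..b} g"
  shows "(integral {a..b} (\<lambda>x. f x * g x))\<^sup>2 \<le>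
    integral {a..b} (\<lambda>x. (f x)\<^sup>2) * integral {a..b} (\<lambda>x. (g x)\<^sup>2)"
proof -
  define A where "A = integral {a..b} (\<lambda>x. (f x)\<^sup>2)"
  define B where "B = integral {a..b} (\<lambda>x. f x * g x)"
  define C where "C = integral {a..b} (\<lambda>x. (g x)\<^sup>2)"
  have quad: "0 \<le> s\<^sup>2 * A - 2 * s * t * B + t\<^sup>2 * C" for s t
  proof -
    have "0 \<le> integral {a..b} (\<lambda>x. (s * f x - t * g x)\<^sup>2)"
      using f g by (intro integral_nonneg integrable_continuous_real continuous_intros) auto
    also have "\<dots> = integral {a..b} (\<lambda>x. s\<^sup>2 * (f x)\<^sup>2 - 2 * s * t * (f x * g x) + t\<^sup>2 * (g x)\<^sup>2)"
      by (intro arg_cong[where f = "integral {a..b}"] ext) (simp add: power2_eq_square algebra_simps)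
    also have "\<dots> = s\<^sup>2 * A - 2 * s * t * B + t\<^sup>2 * C"
      using f g unfolding A_def B_def C_def
      by (simp add: integral_add integral_diff integrable_continuous_real continuous_intros)
    finally show ?thesis .
  qed
  have A: "A \<ge> 0" using quad[of 1 0] by simp
  have C: "C \<ge> 0" using quad[of 0 1] by simp
  have "B\<^sup>2 \<le> A * C"
  proof (cases "A = 0")
    case True
    show ?thesis
    proof (rule ccontr)
      assume "\<not> ?thesis"
      then have "B \<noteq> 0" using True by auto
      \<comment> \<open>With \<open>A = 0\<close> the form is linear in \<open>s\<close>; at this
        \<open>s\<close> and \<open>t = 1\<close> its value is
        \<open>- (C + 1) + C = - 1\<close>.\<close>
      then have "2 * ((C + 1) / (2 * B)) * B = C + 1" by simp
      then show False using quad[of "(C + 1) / (2 * B)" 1] True by simp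
    qed
  next
    case False
    have "0 \<le> B\<^sup>2 * A - 2 * B * A * B + A\<^sup>2 * C" by (rule quad)
    also have "\<dots> = A * (A * C - B\<^sup>2)" by (simp add: power2_eq_square algebra_simps)
    finally show ?thesis using False A by (simp add: zero_le_mult_iff)
  qed
  then show ?thesis by (simp add: A_def B_def C_def)
qed

text \<open>For \<open>\<theta> < \<pi> / L\<close> the function \<open>T = \<theta> tan (\<theta> (x - L / 2))\<close> is smooth on \<open>[0, L]\<close> and satisfies
  \<open>T' = \<theta>\<^sup>2 + T\<^sup>2\<close>; expanding \<open>0 \<le> \<integral>(v' + T v)\<^sup>2\<close> gives the inequality with constant \<open>\<theta>\<close>, and the sharp
  constant follows in the limit.\<close>

lemma Wirtinger_inequality:
  fixes v v' :: "real \<Rightarrow> real"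
  assumes "0 < L" "v 0 = 0" "v L = 0"
    and v: "\<And>x. x \<in> {0..L} \<Longrightarrow> (v has_real_derivative v' x) (at x within {0..L})"
    and v': "continuous_on {0..L} v'"
  shows "pi\<^sup>2 / L\<^sup>2 * integral {0..L} (\<lambda>x. (v x)\<^sup>2) \<le> integral {0..L} (\<lambda>x. (v' x)\<^sup>2)"
proof -
  have vc: "continuous_on {0..L} v"
    by (rule DERIV_continuous_on[OF v])
  have ineq: "\<theta>\<^sup>2 * integral {0..L} (\<lambda>x. (v x)\<^sup>2) \<le> integral {0..L} (\<lambda>x. (v' x)\<^sup>2)"
    if "0 < \<theta>" "\<theta> < pi / L" for \<theta>
  proof -
    define T where "T x = \<theta> * tan (\<theta> * (x - L / 2))" for x
    have cos: "cos (\<theta> * (x - L / 2)) \<noteq> 0" if "x \<in> {0..L}" for x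
    proof -
      have "\<theta> * L < pi" using \<open>\<theta> < pi / L\<close> \<open>0 < L\<close> by (simp add: field_simps)
      moreover have "\<bar>\<theta> * (x - L / 2)\<bar> \<le> \<theta> * (L / 2)"
        unfolding abs_mult using that \<open>0 < \<theta>\<close> by (intro mult_mono abs_leI) (auto simp: field_simps)
      ultimately have "\<bar>\<theta> * (x - L / 2)\<bar> < pi / 2" by simp
      then have "cos (\<theta> * (x - L / 2)) > 0" by (intro cos_gt_zero_pi) linarith+
      then show ?thesis by simp
    qed
    have T: "(T has_real_derivative \<theta>\<^sup>2 + (T x)\<^sup>2) (at x within {0..L})" if "x \<in> {0..L}" for x
    proof -
      have "(T has_real_derivative \<theta> * (inverse ((cos (\<theta> * (x - L / 2)))\<^sup>2) * \<theta>)) (at x within {0..L})"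
        unfolding T_def using cos[OF that] by (auto intro!: derivative_eq_intros)
      moreover have "inverse ((cos (\<theta> * (x - L / 2)))\<^sup>2) = 1 + (tan (\<theta> * (x - L / 2)))\<^sup>2"
        using tan_sec[OF cos[OF that]] by (simp add: power_inverse)
      ultimately show ?thesis by (simp add: T_def power2_eq_square algebra_simps)
    qed
    have Tc: "continuous_on {0..L} T"
      by (rule DERIV_continuous_on[OF T])
    \<comment> \<open>The derivative of \<open>v^2 T\<close> has zero integral because
      \<open>v\<close> vanishes at both ends. This trades the terms
      \<open>2 v v' T + T^2 v^2\<close> of the expanded square for
      \<open>- \<theta>^2 v^2\<close>.\<close>
    have "((\<lambda>x. 2 * v x * v' x * T x + (v x)\<^sup>2 * (\<theta>\<^sup>2 + (T x)\<^sup>2)) has_integral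
        (v L)\<^sup>2 * T L - (v 0)\<^sup>2 * T 0) {0..L}"
    proof (rule fundamental_theorem_of_calculus)
      fix x assume x: "x \<in> {0..L}"
      have "((\<lambda>x. (v x)\<^sup>2 * T x) has_real_derivative
          2 * v x * v' x * T x + (v x)\<^sup>2 * (\<theta>\<^sup>2 + (T x)\<^sup>2)) (at x within {0..L})"
        by (auto intro!: derivative_eq_intros v[OF x] T[OF x] simp: algebra_simps)
      then show "((\<lambda>x. (v x)\<^sup>2 * T x) has_vector_derivative
          2 * v x * v' x * T x + (v x)\<^sup>2 * (\<theta>\<^sup>2 + (T x)\<^sup>2)) (at x within {0..L})"
        by (simp add: has_real_derivative_iff_has_vector_derivative)
    qed (use \<open>0 < L\<close> in auto)
    then have zero: "integral {0..L} (\<lambda>x. 2 * v x * v' x * T x + (v x)\<^sup>2 * (\<theta>\<^sup>2 + (T x)\<^sup>2)) = 0"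
      using assms(2,3) by (simp add: integral_unique)
    have "0 \<le> integral {0..L} (\<lambda>x. (v' x + T x * v x)\<^sup>2)"
      using vc v' Tc by (intro integral_nonneg integrable_continuous_real continuous_intros) auto
    also have "\<dots> = integral {0..L} (\<lambda>x. (v' x)\<^sup>2 - \<theta>\<^sup>2 * (v x)\<^sup>2 +
        (2 * v x * v' x * T x + (v x)\<^sup>2 * (\<theta>\<^sup>2 + (T x)\<^sup>2)))"
      by (intro arg_cong[where f = "integral {0..L}"] ext) (simp add: power2_eq_square algebra_simps)
    also have "\<dots> = integral {0..L} (\<lambda>x. (v' x)\<^sup>2) - \<theta>\<^sup>2 * integral {0..L} (\<lambda>x. (v x)\<^sup>2)"
      using vc v' Tc zero
      by (simp add: integral_add integral_diff integrable_continuous_real continuous_intros)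
    finally show ?thesis by simp
  qed
  have "((\<lambda>\<theta>. \<theta>\<^sup>2 * integral {0..L} (\<lambda>x. (v x)\<^sup>2)) \<longlongrightarrow> (pi / L)\<^sup>2 * integral {0..L} (\<lambda>x. (v x)\<^sup>2)) (at_left (pi / L))"
    by (intro tendsto_intros)
  moreover have "\<forall>\<^sub>F \<theta> in at_left (pi / L).
      \<theta>\<^sup>2 * integral {0..L} (\<lambda>x. (v x)\<^sup>2) \<le> integral {0..L} (\<lambda>x. (v' x)\<^sup>2)"
    using eventually_at_left_real[of 0 "pi / L"] \<open>0 < L\<close> ineq by (auto elim: eventually_mono)
  ultimately show ?thesis
    by (simp add: power_divide tendsto_upperbound)
qed

section \<open>Balance laws\<close>

lemma has_integral_deriv:
  fixes u :: "real \<Rightarrow> real"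
  assumes "a \<le> b" "\<And>x. x \<in> {a..b} \<Longrightarrow> (u has_real_derivative u' x) (at x within {a..b})"
  shows "(u' has_integral u b - u a) {a..b}"
  using assms by (intro fundamental_theorem_of_calculus)
    (auto simp: has_real_derivative_iff_has_vector_derivative)

lemma continuous_on_slice:
  assumes "continuous_on (T \<times> I) (\<lambda>(t, x). u t x)" "t \<in> T" "J \<subseteq> I"
  shows "continuous_on J (u t)"
proof -
  have "continuous_on J (\<lambda>x. case (t, x) of (t, x) \<Rightarrow> u t x)"
    by (rule continuous_on_compose2[OF assms(1)]) (use assms(2,3) in \<open>auto intro!: continuous_intros\<close>)
  then show ?thesis by simp
qed

text \<open>Differentiating \<open>u s y - u s c\<close>, the integral of \<open>ux s\<close> over
  \<open>[c, y]\<close>, under the integral sign exhibits \<open>ut t\<close> as a constant plus a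
  primitive of \<open>uxt t\<close>; the fundamental theorem finishes. It serves to differentiate
  the continuity equation in \<open>x\<close>.\<close>

lemma mixed_partials_commute:
  fixes u :: "real \<Rightarrow> real \<Rightarrow> real"
  assumes ux: "\<And>t x. \<lbrakk>0 < t; a < x; x < b\<rbrakk> \<Longrightarrow> (u t has_real_derivative ux t x) (at x)"
    and ut: "\<And>t x. \<lbrakk>0 < t; a < x; x < b\<rbrakk> \<Longrightarrow> ((\<lambda>s. u s x) has_real_derivative ut t x) (at t)"
    and uxt: "\<And>t x. \<lbrakk>0 < t; a < x; x < b\<rbrakk> \<Longrightarrow> ((\<lambda>s. ux s x) has_real_derivative uxt t x) (at t)"
    and ux_cont: "\<And>t. 0 < t \<Longrightarrow> continuous_on {a<..<b} (ux t)"
    and uxt_cont: "continuous_on ({0<..} \<times> {a<..<b}) (\<lambda>(t, x). uxt t x)"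
    and t: "0 < t" and x: "a < x" "x < b"
  shows "(ut t has_real_derivative uxt t x) (at x)"
proof -
  define c d where "c = (a + x) / 2" and "d = (x + b) / 2"
  have cd: "a < c" "c < x" "x < d" "d < b" using x by (auto simp: c_def d_def field_simps)
  have eq: "ut t y = ut t c + integral {c..y} (uxt t)" if y: "y \<in> {c..d}" for y
  proof -
    have FTC: "integral {c..y} (ux s) = u s y - u s c" if "0 < s" for s
      using y cd that by (intro integral_unique has_integral_deriv) (auto intro!: DERIV_subset[OF ux])
    have "((\<lambda>s. integral (cbox c y) (ux s)) has_real_derivative integral (cbox c y) (uxt t)) (at t within {0<..})"
    proof (rule leibniz_rule_field_derivative)
      show "((\<lambda>s. ux s z) has_real_derivative uxt s z) (at s within {0<..})"
        if "s \<in> {0<..}" "z \<in> cbox c y" for s z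
        using that y cd by (intro DERIV_subset[OF uxt]) auto
      show "ux s integrable_on cbox c y" if "s \<in> {0<..}" for s
        using that y cd by (intro integrable_continuous continuous_on_subset[OF ux_cont]) auto
      show "continuous_on ({0<..} \<times> cbox c y) (\<lambda>(s, z). uxt s z)"
        using y cd by (intro continuous_on_subset[OF uxt_cont]) auto
    qed (use t in auto)
    then have "((\<lambda>s. integral {c..y} (ux s)) has_real_derivative integral {c..y} (uxt t)) (at t)"
      using t by (simp add: at_within_open[of t "{0<..}"])
    then have "((\<lambda>s. u s y - u s c) has_real_derivative integral {c..y} (uxt t)) (at t)"
      by (rule has_field_derivative_transform_within_open[where S = "{0<..}"]) (use t FTC in auto)
    moreover have "((\<lambda>s. u s y - u s c) has_real_derivative ut t y - ut t c) (at t)"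
      using t y cd by (intro DERIV_diff ut) auto
    ultimately have "integral {c..y} (uxt t) = ut t y - ut t c"
      by (rule DERIV_unique)
    then show ?thesis by simp
  qed
  have "continuous_on {c..d} (uxt t)"
    using t cd by (intro continuous_on_slice[OF uxt_cont]) auto
  then have "((\<lambda>y. integral {c..y} (uxt t)) has_real_derivative uxt t x) (at x within {c..d})"
    by (rule integral_has_real_derivative) (use cd in auto)
  then have "((\<lambda>y. integral {c..y} (uxt t)) has_real_derivative uxt t x) (at x)"
    using cd by (simp add: at_within_Icc_at)
  then have "((\<lambda>y. ut t c + integral {c..y} (uxt t)) has_real_derivative uxt t x) (at x)"
    by (auto intro!: derivative_eq_intros)
  then show ?thesis
  proof (rule has_field_derivative_transform_within_open[where S = "{c<..<d}"])
    show "ut t c + integral {c..y} (uxt t) = ut t y" if "y \<in> {c<..<d}" for y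
      using that by (intro eq[symmetric]) auto
  qed (use cd in auto)
qed

lemma integral_tails_le:
  fixes f :: "real \<Rightarrow> real"
  assumes f: "continuous_on {0..L} f" and B: "\<And>x. x \<in> {0..L} \<Longrightarrow> \<bar>f x\<bar> \<le> B"
    and e: "0 \<le> e" "e \<le> L - e"
  shows "\<bar>integral {0..L} f - integral {e..L - e} f\<bar> \<le> 2 * B * e"
proof -
  have i: "f integrable_on {a..b}" if "0 \<le> a" "b \<le> L" for a b
    using that by (intro integrable_continuous_real continuous_on_subset[OF f]) auto
  have split: "integral {0..L} f = integral {0..e} f + (integral {e..L - e} f + integral {L - e..L} f)"
    using Henstock_Kurzweil_Integration.integral_combine[of 0 e L f]
      Henstock_Kurzweil_Integration.integral_combine[of e "L - e" L f] e i by simp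
  have "norm (integral {0..e} f) \<le> B * (e - 0)"
    using e B by (intro integral_bound continuous_on_subset[OF f]) auto
  moreover have "norm (integral {L - e..L} f) \<le> B * (L - (L - e))"
    using e B by (intro integral_bound continuous_on_subset[OF f]) auto
  ultimately show ?thesis unfolding split by (simp add: abs_le_iff)
qed

text \<open>The densities used below are differentiable only inside the interval, so Leibniz' rule is
  applied on \<open>[\<epsilon>, L - \<epsilon>]\<close>; the balance equation turns the derivative into fluxes and sources, which
  converge locally uniformly in time as \<open>\<epsilon> \<rightarrow> 0\<close>.\<close>

lemma balance_law:
  fixes \<rho> \<rho>t \<Phi> \<Phi>x S :: "real \<Rightarrow> real \<Rightarrow> real"
  assumes "0 < L"
    and \<rho>: "continuous_on ({0<..} \<times> {0..L}) (\<lambda>(t, x). \<rho> t x)"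
    and \<Phi>: "continuous_on ({0<..} \<times> {0..L}) (\<lambda>(t, x). \<Phi> t x)"
    and S: "continuous_on ({0<..} \<times> {0..L}) (\<lambda>(t, x). S t x)"
    and \<rho>t: "\<And>t x. \<lbrakk>0 < t; 0 < x; x < L\<rbrakk> \<Longrightarrow> ((\<lambda>s. \<rho> s x) has_real_derivative \<rho>t t x) (at t)"
    and \<Phi>x: "\<And>t x. \<lbrakk>0 < t; 0 < x; x < L\<rbrakk> \<Longrightarrow> (\<Phi> t has_real_derivative \<Phi>x t x) (at x)"
    and balance: "\<And>t x. \<lbrakk>0 < t; 0 < x; x < L\<rbrakk> \<Longrightarrow> \<rho>t t x + \<Phi>x t x = S t x"
    and \<rho>t_cont: "continuous_on ({0<..} \<times> {0<..<L}) (\<lambda>(t, x). \<rho>t t x)"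
    and t: "0 < t"
  shows "((\<lambda>s. integral {0..L} (\<rho> s)) has_real_derivative
           integral {0..L} (S t) - (\<Phi> t L - \<Phi> t 0)) (at t)"
proof -
  define e where "e n = L / (real n + 3)" for n
  have e: "0 < e n" "e n < L - e n" for n
  proof -
    have "2 * e n < L"
      using \<open>0 < L\<close> mult_strict_left_mono[of 2 "real n + 3" L]
      by (simp add: e_def divide_less_eq mult.commute)
    then show "e n < L - e n" by simp
  qed (use \<open>0 < L\<close> in \<open>simp add: e_def\<close>)
  have e0: "e \<longlonglongrightarrow> 0"
    unfolding e_def using LIMSEQ_ignore_initial_segment[OF lim_const_over_n[of L], of 3] by simp
  \<comment> \<open>A compact time window around \<open>t\<close>: on it \<open>\<rho>\<close> and
    \<open>S\<close> are bounded and \<open>\<Phi>\<close> is uniformly continuous, so the estimates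
    below are uniform in time.\<close>
  define J where "J = {t / 2..2 * t}"
  have J: "s > 0" if "s \<in> J" for s using that t by (auto simp: J_def)
  have slice: "continuous_on {0..L} (u s)"
    if "continuous_on ({0<..} \<times> {0..L}) (\<lambda>(t, x). u t x)" "s \<in> J" for u :: "real \<Rightarrow> real \<Rightarrow> real" and s
    using J[OF that(2)] by (intro continuous_on_slice[OF that(1)]) auto
  have K: "compact (J \<times> {0..L})" "J \<times> {0..L} \<subseteq> {0<..} \<times> {0..L}"
  proof -
    show "compact (J \<times> {0..L})" by (simp add: J_def compact_Times)
    show "J \<times> {0..L} \<subseteq> {0<..} \<times> {0..L}" using J by (intro Sigma_mono) auto
  qed
  have bound: "\<exists>B. \<forall>s\<in>J. \<forall>x\<in>{0..L}. \<bar>u s x\<bar> \<le> B"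
    if "continuous_on ({0<..} \<times> {0..L}) (\<lambda>(t, x). u t x)" for u :: "real \<Rightarrow> real \<Rightarrow> real"
  proof -
    have "bounded ((\<lambda>(t, x). u t x) ` (J \<times> {0..L}))"
      by (intro compact_imp_bounded compact_continuous_image continuous_on_subset[OF that K(2)] K(1))
    then obtain B where "\<forall>y\<in>(\<lambda>(t, x). u t x) ` (J \<times> {0..L}). norm y \<le> B"
      unfolding bounded_iff by blast
    then show ?thesis by (intro exI[of _ B]) auto
  qed
  obtain B where B: "\<And>s x. \<lbrakk>s \<in> J; x \<in> {0..L}\<rbrakk> \<Longrightarrow> \<bar>S s x\<bar> \<le> B" using bound[OF S] by blast
  obtain C where C: "\<And>s x. \<lbrakk>s \<in> J; x \<in> {0..L}\<rbrakk> \<Longrightarrow> \<bar>\<rho> s x\<bar> \<le> C" using bound[OF \<rho>] by blast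
  define F where "F n s = integral {e n..L - e n} (\<rho> s)" for n s
  define F' where "F' n s = integral {e n..L - e n} (S s) - (\<Phi> s (L - e n) - \<Phi> s (e n))" for n s
  define G' where "G' s = integral {0..L} (S s) - (\<Phi> s L - \<Phi> s 0)" for s
  have F: "(F n has_real_derivative F' n s) (at s within J)" if s: "s \<in> J" for n s
  proof -
    have "((\<lambda>s. integral (cbox (e n) (L - e n)) (\<rho> s)) has_real_derivative
        integral (cbox (e n) (L - e n)) (\<rho>t s)) (at s within J)"
    proof (rule leibniz_rule_field_derivative)
      show "((\<lambda>s. \<rho> s x) has_real_derivative \<rho>t s x) (at s within J)"
        if "s \<in> J" "x \<in> cbox (e n) (L - e n)" for s x
        using that e[of n] J by (intro DERIV_subset[OF \<rho>t]) auto
      show "\<rho> s integrable_on cbox (e n) (L - e n)" if "s \<in> J" for s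
        using that e[of n] by (intro integrable_continuous continuous_on_subset[OF slice[OF \<rho>]]) auto
      show "continuous_on (J \<times> cbox (e n) (L - e n)) (\<lambda>(s, x). \<rho>t s x)"
        using e[of n] J by (intro continuous_on_subset[OF \<rho>t_cont]) auto
    qed (use s in \<open>auto simp: J_def\<close>)
    \<comment> \<open>Second space derivatives of the flow enter only through
      \<open>\<Phi>x\<close>. It is integrated by the fundamental theorem for the gauge integral,
      which asks for no continuity of the derivative.\<close>
    moreover have "(\<rho>t s has_integral F' n s) {e n..L - e n}"
    proof -
      have "(S s has_integral integral {e n..L - e n} (S s)) {e n..L - e n}"
        using s e[of n] by (intro integrable_integral integrable_continuous_real continuous_on_subset[OF slice[OF S]]) auto
      moreover have "(\<Phi>x s has_integral \<Phi> s (L - e n) - \<Phi> s (e n)) {e n..L - e n}"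
        using s e[of n] J by (intro has_integral_deriv) (auto intro!: DERIV_subset[OF \<Phi>x])
      ultimately have "((\<lambda>x. S s x - \<Phi>x s x) has_integral F' n s) {e n..L - e n}"
        unfolding F'_def by (rule has_integral_diff)
      then show ?thesis
        by (rule has_integral_eq[rotated]) (use balance[OF J[OF s]] e[of n] in \<open>auto simp: algebra_simps\<close>)
    qed
    ultimately show ?thesis by (simp add: F_def[abs_def] integral_unique)
  qed
  have lim: "F' n s - G' s = (integral {e n..L - e n} (S s) - integral {0..L} (S s)) 
      + (\<Phi> s L - \<Phi> s (L - e n)) + (\<Phi> s (e n) - \<Phi> s 0)" for n s
    by (simp add: F'_def G'_def)
  have unif: "\<forall>\<^sub>F n in sequentially. \<forall>s\<in>J. \<forall>h. norm (F' n s * h - G' s * h) \<le> \<epsilon> * norm h"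
    if "\<epsilon> > 0" for \<epsilon> :: real
  proof -
    have "uniformly_continuous_on (J \<times> {0..L}) (\<lambda>(s, x). \<Phi> s x)"
      by (intro compact_uniformly_continuous continuous_on_subset[OF \<Phi> K(2)] K(1))
    then have "\<exists>\<delta>>0. \<forall>p\<in>J \<times> {0..L}. \<forall>q\<in>J \<times> {0..L}. dist q p < \<delta> \<longrightarrow>
        dist (case q of (s, x) \<Rightarrow> \<Phi> s x) (case p of (s, x) \<Rightarrow> \<Phi> s x) < \<epsilon> / 3"
      unfolding uniformly_continuous_on_def using \<open>\<epsilon> > 0\<close>
      by (elim allE[of _ "\<epsilon> / 3"]) (auto simp only: zero_less_divide_iff zero_less_numeral)
    then obtain \<delta> where "\<delta> > 0" and \<delta>: "\<And>p q. \<lbrakk>p \<in> J \<times> {0..L}; q \<in> J \<times> {0..L}; dist q p < \<delta>\<rbrakk> \<Longrightarrow>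
        dist (case q of (s, x) \<Rightarrow> \<Phi> s x) (case p of (s, x) \<Rightarrow> \<Phi> s x) < \<epsilon> / 3"
      by blast
    have \<Phi>_close: "\<bar>\<Phi> s x - \<Phi> s y\<bar> < \<epsilon> / 3" if "s \<in> J" "x \<in> {0..L}" "y \<in> {0..L}" "\<bar>x - y\<bar> < \<delta>" for s x y
      using \<delta>[of "(s, y)" "(s, x)"] that by (auto simp: dist_Pair_Pair dist_real_def)
    have "(\<lambda>n. 2 * B * e n) \<longlonglongrightarrow> 2 * B * 0" by (intro tendsto_intros e0)
    then have "\<forall>\<^sub>F n in sequentially. 2 * B * e n < \<epsilon> / 3"
      using \<open>\<epsilon> > 0\<close> by (intro order_tendstoD(2)[of _ "2 * B * 0"]) auto
    moreover have "\<forall>\<^sub>F n in sequentially. e n < \<delta>"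
      using e0 \<open>\<delta> > 0\<close> by (rule order_tendstoD)
    ultimately show ?thesis
    proof eventually_elim
      case (elim n)
      show ?case
      proof (intro ballI allI)
        fix s h assume s: "s \<in> J"
        have "\<bar>integral {e n..L - e n} (S s) - integral {0..L} (S s)\<bar> \<le> \<epsilon> / 3"
          using integral_tails_le[of L "S s" B "e n"] slice[OF S s] B[OF s] e[of n] elim
          by (simp add: abs_minus_commute)
        moreover have "\<bar>\<Phi> s L - \<Phi> s (L - e n)\<bar> < \<epsilon> / 3" "\<bar>\<Phi> s (e n) - \<Phi> s 0\<bar> < \<epsilon> / 3"
          using \<Phi>_close[OF s, of L "L - e n"] \<Phi>_close[OF s, of "e n" 0] e[of n] elim \<open>0 < L\<close> by simp_all
        ultimately have "\<bar>F' n s - G' s\<bar> \<le> \<epsilon>" unfolding lim by linarith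
        then show "norm (F' n s * h - G' s * h) \<le> \<epsilon> * norm h"
          by (simp add: abs_mult mult_right_mono flip: left_diff_distrib)
      qed
    qed
  qed
  have conv: "(\<lambda>n. F n s) \<longlonglongrightarrow> integral {0..L} (\<rho> s)" if s: "s \<in> J" for s
  proof -
    have "(\<lambda>n. F n s - integral {0..L} (\<rho> s)) \<longlonglongrightarrow> 0"
    proof (rule Lim_null_comparison)
      show "\<forall>\<^sub>F n in sequentially. norm (F n s - integral {0..L} (\<rho> s)) \<le> 2 * C * e n"
      proof (intro always_eventually allI)
        show "norm (F n s - integral {0..L} (\<rho> s)) \<le> 2 * C * e n" for n
          using integral_tails_le[OF slice[OF \<rho> s] C[OF s], of "e n"] e[of n]
          by (simp add: F_def abs_minus_commute)
      qed
      have "(\<lambda>n. 2 * C * e n) \<longlonglongrightarrow> 2 * C * 0" by (intro tendsto_intros e0)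
      then show "(\<lambda>n. 2 * C * e n) \<longlonglongrightarrow> 0" by simp
    qed
    then show ?thesis by (simp add: LIM_zero_iff)
  qed
  have tJ: "t \<in> J" using t by (simp add: J_def)
  \<comment> \<open>Uniform convergence of the derivatives on the convex set \<open>J\<close>, with
    convergence at one point, makes the limit differentiable. The limit is identified with the full
    integral afterwards.\<close>
  have "\<exists>G. \<forall>s\<in>J. (\<lambda>n. F n s) \<longlonglongrightarrow> G s \<and> (G has_derivative (*) (G' s)) (at s within J)"
  proof (rule has_derivative_sequence)
    show "(F n has_derivative (*) (F' n s)) (at s within J)" if "s \<in> J" for n s
      using F[OF that] by (simp add: has_field_derivative_def)
    show "\<forall>\<^sub>F n in sequentially. \<forall>s\<in>J. \<forall>h. norm (F' n s * h - G' s * h) \<le> \<epsilon> * norm h"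
      if "\<epsilon> > 0" for \<epsilon> :: real
      using that by (rule unif)
    show "t \<in> J" by (rule tJ)
    show "(\<lambda>n. F n t) \<longlonglongrightarrow> integral {0..L} (\<rho> t)" by (rule conv[OF tJ])
    show "convex J" by (simp add: J_def)
  qed
  then obtain G where G: "\<And>s. s \<in> J \<Longrightarrow> (\<lambda>n. F n s) \<longlonglongrightarrow> G s"
    and dG: "\<And>s. s \<in> J \<Longrightarrow> (G has_derivative (*) (G' s)) (at s within J)"
    by blast
  have "(G has_real_derivative G' t) (at t within J)"
    using dG[OF tJ] by (simp add: has_field_derivative_def)
  then have "(G has_real_derivative G' t) (at t)"
    using t by (simp add: J_def at_within_Icc_at)
  then have "((\<lambda>s. integral {0..L} (\<rho> s)) has_real_derivative G' t) (at t)"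
  proof (rule has_field_derivative_transform_within_open[where S = "{t / 2<..<2 * t}"])
    show "G s = integral {0..L} (\<rho> s)" if "s \<in> {t / 2<..<2 * t}" for s
      using that by (intro LIMSEQ_unique[OF G conv]) (auto simp: J_def)
  qed (use t in auto)
  then show ?thesis by (simp add: G'_def)
qed

section \<open>Levels and the closed-loop quadratic form\<close>

text \<open>This is \<open>G_fun\<close> without its sign factor. It has its minimum
  \<open>0\<close> at \<open>hs\<close> and is differentiable across it, so the chain rule and the
  intermediate value theorem apply without splitting at \<open>hs\<close>.\<close>

definition level :: "real \<Rightarrow> real \<Rightarrow> real" where
  "level hs y = 2 / 3 * (y * sqrt y - 3 * hs * sqrt y + 2 * hs * sqrt hs)"

lemma G_fun_eq: "G_fun hs y = sgn (y - hs) * level hs y"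
  by (simp add: G_fun_def level_def)

lemma level_hs [simp]: "level hs hs = 0"
  by (simp add: level_def)

lemma level_0: "level hs 0 = 4 / 3 * hs * sqrt hs"
  by (simp add: level_def)

lemma continuous_on_level: "continuous_on S (level hs)"
  unfolding level_def by (intro continuous_intros)

lemma has_real_derivative_level:
  assumes "0 < y"
  shows "(level hs has_real_derivative (y - hs) / sqrt y) (at y)"
proof -
  have "(level hs has_real_derivative
      2 / 3 * (sqrt y + y * (inverse (sqrt y) / 2) - 3 * hs * (inverse (sqrt y) / 2))) (at y)"
    unfolding level_def using assms by (auto intro!: derivative_eq_intros)
  moreover have "2 / 3 * (sqrt y + y * (inverse (sqrt y) / 2) - 3 * hs * (inverse (sqrt y) / 2)) =
      (y - hs) / sqrt y"
  proof -
    have "y * i = r \<Longrightarrow> 2 / 3 * (r + y * (i / 2) - 3 * hs * (i / 2)) = (y - hs) * i" for i r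
      by (simp add: algebra_simps)
    moreover have "y * inverse (sqrt y) = sqrt y"
      using assms by (simp add: real_div_sqrt flip: divide_inverse)
    ultimately show ?thesis by (simp only: divide_inverse)
  qed
  ultimately show ?thesis by (simp only:)
qed

text \<open>In terms of square roots \<open>level\<close> is a cubic, and the difference factors as
  \<open>(t - s) (t^2 + t s + s^2 - 3 hs)\<close>. The sign of the second factor on either side of
  \<open>hs\<close> gives both monotonicity statements.\<close>

lemma level_diff:
  assumes "0 \<le> y" "0 \<le> z" "0 \<le> hs"
  shows "level hs z - level hs y =
    2 / 3 * ((sqrt z - sqrt y) * (z + sqrt z * sqrt y + y - 3 * hs))"
proof -
  define s t where "s = sqrt y" and "t = sqrt z"
  have "y = s * s" "z = t * t" using assms by (auto simp: s_def t_def)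
  then show ?thesis
    unfolding level_def s_def[symmetric] t_def[symmetric] by (simp add: algebra_simps)
qed

lemma level_strict_mono:
  assumes "0 \<le> hs" "hs \<le> y" "y < z"
  shows "level hs y < level hs z"
proof -
  have "sqrt y * sqrt y \<le> sqrt z * sqrt y"
    using assms by (intro mult_right_mono) auto
  then have "0 < (sqrt z - sqrt y) * (z + sqrt z * sqrt y + y - 3 * hs)"
    using assms by (intro mult_pos_pos) auto
  then show ?thesis using level_diff[of y z hs] assms by simp
qed

lemma level_strict_antimono:
  assumes "0 \<le> y" "y < z" "z \<le> hs"
  shows "level hs z < level hs y"
proof -
  have "sqrt z * sqrt y \<le> sqrt z * sqrt z"
    using assms by (intro mult_left_mono) auto
  then have "(sqrt z - sqrt y) * (z + sqrt z * sqrt y + y - 3 * hs) < 0"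
    using assms by (intro mult_pos_neg) auto
  then show ?thesis using level_diff[of y z hs] assms by simp
qed

lemma G_fun_strict_mono:
  assumes "0 \<le> hs" "0 < y" "y < z"
  shows "G_fun hs y < G_fun hs z"
proof -
  consider "hs \<le> y" | "z \<le> hs" | "y < hs" "hs < z" by linarith
  then show ?thesis
  proof cases
    case 1
    then show ?thesis
      using level_strict_mono[of hs y z] assms by (cases "y = hs") (auto simp: G_fun_eq)
  next
    case 2
    then show ?thesis
      using level_strict_antimono[of y z hs] assms by (cases "z = hs") (auto simp: G_fun_eq)
  next
    case 3
    then show ?thesis
      using level_strict_antimono[of y hs hs] level_strict_mono[of hs hs z] assms by (simp add: G_fun_eq)
  qed
qed

lemma G_inv_G_fun:
  assumes "0 \<le> hs" "0 < y"
  shows "G_inv hs (G_fun hs y) = y"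
proof -
  have "inj_on (G_fun hs) {0<..}"
    using G_fun_strict_mono[OF \<open>0 \<le> hs\<close>]
    by (auto intro!: inj_onI) (metis less_irrefl linorder_neqE)
  then show ?thesis unfolding G_inv_def using assms by (intro the_inv_into_f_f) auto
qed

text \<open>The bound on \<open>p\<close> is \<open>level hs 0\<close>, so the lower preimage cannot
  be the dry level \<open>0\<close>. Both preimages come from the intermediate value theorem and are
  recognized as values of \<open>G_inv\<close> by injectivity.\<close>

lemma level_inverses:
  assumes "0 < hs" "0 \<le> p" "p < 4 / 3 * hs * sqrt hs"
  obtains "0 < G_inv hs (- p)" "G_inv hs (- p) \<le> hs" "level hs (G_inv hs (- p)) = p"
    "hs \<le> G_inv hs p" "level hs (G_inv hs p) = p"
proof -
  obtain y where y: "0 \<le> y" "y \<le> hs" "level hs y = p"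
    using IVT2'[of "level hs" hs p 0] assms by (auto simp: continuous_on_level level_0)
  have "y \<noteq> 0" using y assms by (auto simp: level_0)
  then have "0 < y" using y by simp
  have "G_fun hs y = - p" using y by (cases "y = hs") (auto simp: G_fun_eq)
  then have Gy: "G_inv hs (- p) = y" using G_inv_G_fun[of hs y] \<open>0 < y\<close> assms by simp
  \<comment> \<open>Any upper end with a large enough level works; at \<open>4 * hs\<close> the
    square root is explicit and the level is twice the bound on \<open>p\<close>.\<close>
  define B where "B = 4 * hs"
  have "level hs B = 8 / 3 * hs * sqrt hs"
    by (simp add: B_def level_def real_sqrt_mult)
  moreover have "0 < hs * sqrt hs" using assms by simp
  ultimately have "p \<le> level hs B" using assms by linarith
  then obtain z where z: "hs \<le> z" "z \<le> B" "level hs z = p"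
    using IVT'[of "level hs" hs p B] assms by (auto simp: continuous_on_level B_def)
  have "G_fun hs z = p" using z by (cases "z = hs") (auto simp: G_fun_eq)
  then have Gz: "G_inv hs p = z" using G_inv_G_fun[of hs z] z assms by simp
  show thesis by (rule that) (use Gy Gz y z \<open>0 < y\<close> in auto)
qed

text \<open>Used to choose one decay rate that meets a finite list of demands.\<close>

lemma ex_small_factor:
  fixes xs :: "(real \<times> real) list"
  assumes "\<forall>(c, d)\<in>set xs. 0 < d"
  shows "\<exists>\<kappa>>0. \<forall>(c, d)\<in>set xs. \<kappa> * c \<le> d"
  using assms
proof (induction xs)
  case Nil
  then show ?case by (auto intro: exI[of _ 1])
next
  case (Cons p xs)
  obtain c d where p: "p = (c, d)" by force
  then have "0 < d" using Cons.prems by auto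
  obtain \<kappa> where \<kappa>: "0 < \<kappa>" "\<forall>(c, d)\<in>set xs. \<kappa> * c \<le> d" using Cons by auto
  define \<kappa>' where "\<kappa>' = min \<kappa> (d / (\<bar>c\<bar> + 1))"
  have "0 < \<kappa>'" using \<kappa> \<open>0 < d\<close> by (simp add: \<kappa>'_def)
  have "\<kappa>' * c' \<le> d'" if "(c', d') \<in> set xs" for c' d'
  proof (cases "c' \<le> 0")
    case True
    then have "\<kappa>' * c' \<le> 0" using \<open>0 < \<kappa>'\<close> by (simp add: mult_nonneg_nonpos)
    then show ?thesis using Cons.prems that by fastforce
  next
    case False
    then have "\<kappa>' * c' \<le> \<kappa> * c'" by (intro mult_right_mono) (auto simp: \<kappa>'_def)
    then show ?thesis using \<kappa> that by fastforce
  qed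
  moreover have "\<kappa>' * c \<le> d"
  proof -
    have "\<kappa>' * c \<le> \<kappa>' * (\<bar>c\<bar> + 1)" using \<open>0 < \<kappa>'\<close> by (intro mult_left_mono) auto
    also have "\<dots> \<le> d / (\<bar>c\<bar> + 1) * (\<bar>c\<bar> + 1)" by (intro mult_right_mono) (auto simp: \<kappa>'_def)
    also have "\<dots> = d" by simp
    finally show ?thesis .
  qed
  ultimately show ?case using \<open>0 < \<kappa>'\<close> p by (intro exI[of _ \<kappa>']) auto
qed

section \<open>Negative definiteness of the closed-loop quadratic form\<close>

text \<open>The case \<open>\<sigma> = 1\<close>, with \<open>A\<close> the factor of the force,
  \<open>E = q e\<close>, and the dissipation already converted into \<open>P^2\<close> and
  \<open>D^2\<close>. The weights \<open>9/20\<close>, \<open>39/20\<close> and \<open>79/20\<close>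
  are the available \<open>1/2\<close>, \<open>2\<close> and \<open>4\<close> minus the margin
  \<open>1/20\<close>; completing squares with them removes \<open>D\<close>, \<open>E\<close> and
  \<open>y\<close> and leaves a form in \<open>A\<close> and \<open>P\<close> that is affine in
  \<open>lam\<close>, checked at its two ends.\<close>

lemma feedback_form_normalized:
  fixes P D A E y \<beta> lam :: real
  assumes "4 \<le> \<beta>" "0 \<le> lam" "lam \<le> 1"
  shows "(2 * P + D - A)\<^sup>2 / 8 - A * (A + 2 * lam * y - 2 * (1 - lam) * P - E)
      - 2 * E\<^sup>2 - \<beta> * lam * y * (y + P) - (\<beta> / 2 + 2) * P\<^sup>2 - D\<^sup>2 / 2
    \<le> - (1 / 20) * (A\<^sup>2 + P\<^sup>2 + D\<^sup>2 + E\<^sup>2 + lam * y\<^sup>2)"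
proof -
  define B where "B = 2 * P - A"
  have sD: "(B + D)\<^sup>2 / 8 \<le> 9 / 20 * D\<^sup>2 + 9 / 52 * B\<^sup>2"
  proof -
    have "0 \<le> (13 * D - 5 * B)\<^sup>2" by simp
    then show ?thesis by (simp add: power2_eq_square algebra_simps)
  qed
  have sE: "A * E \<le> 39 / 20 * E\<^sup>2 + 10 / 78 * A\<^sup>2"
  proof -
    have "0 \<le> (39 / 10 * E - A)\<^sup>2" by simp
    then show ?thesis by (simp add: power2_eq_square algebra_simps)
  qed
  have "- (2 * y * (2 * P + A)) \<le> 79 / 20 * y\<^sup>2 + 20 / 79 * (2 * P + A)\<^sup>2"
  proof -
    have "0 \<le> (79 / 20 * y + (2 * P + A))\<^sup>2" by simp
    then show ?thesis by (simp add: power2_eq_square algebra_simps)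
  qed
  then have sy: "lam * - (2 * y * (2 * P + A)) \<le> lam * (79 / 20 * y\<^sup>2 + 20 / 79 * (2 * P + A)\<^sup>2)"
    using assms by (intro mult_left_mono) auto
  \<comment> \<open>Only \<open>\<beta> = 4\<close> is used up by the other estimates; the excess
    enters through this form, which is nonnegative because \<open>lam^2 \<le> lam\<close>.\<close>
  have s\<beta>: "0 \<le> (\<beta> - 4) / 2 * (P\<^sup>2 + 2 * lam * y * P + 2 * lam * y\<^sup>2)"
  proof -
    have "lam\<^sup>2 \<le> lam" using assms by (simp add: power2_eq_square mult_left_le)
    then have "0 \<le> (P + lam * y)\<^sup>2 + (2 * lam - lam\<^sup>2) * y\<^sup>2" using assms by simp
    also have "\<dots> = P\<^sup>2 + 2 * lam * y * P + 2 * lam * y\<^sup>2" by (simp add: power2_eq_square algebra_simps)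
    finally show ?thesis using assms by simp
  qed
  have "0 \<le> (P - A / 4)\<^sup>2" by simp
  then have hint: "A * P \<le> 2 * P\<^sup>2 + A\<^sup>2 / 8" "0 \<le> P\<^sup>2" "0 \<le> A\<^sup>2"
    by (simp_all add: power2_eq_square algebra_simps)
  \<comment> \<open>\<open>Q0\<close> and \<open>Q1\<close> are the remaining forms in
    \<open>A\<close> and \<open>P\<close> at \<open>lam = 0\<close> and \<open>lam = 1\<close>; the
    actual remainder is their convex combination.\<close>
  have Q0: "0 \<le> 847 / 260 * P\<^sup>2 + 253 / 390 * A\<^sup>2 - 17 / 13 * (A * P)"
    using hint by linarith
  have Q1: "0 \<le> 46113 / 20540 * P\<^sup>2 + 12187 / 30810 * A\<^sup>2 - 329 / 1027 * (A * P)"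
    using hint by linarith
  have Q: "0 \<le> (1 - lam) * (847 / 260 * P\<^sup>2 + 253 / 390 * A\<^sup>2 - 17 / 13 * (A * P))"
      "0 \<le> lam * (46113 / 20540 * P\<^sup>2 + 12187 / 30810 * A\<^sup>2 - 329 / 1027 * (A * P))"
    using mult_nonneg_nonneg[OF _ Q0, of "1 - lam"] mult_nonneg_nonneg[OF _ Q1, of lam] assms by simp_all
  have "- (1 / 20) * (A\<^sup>2 + P\<^sup>2 + D\<^sup>2 + E\<^sup>2 + lam * y\<^sup>2) -
      ((2 * P + D - A)\<^sup>2 / 8 - A * (A + 2 * lam * y - 2 * (1 - lam) * P - E)
      - 2 * E\<^sup>2 - \<beta> * lam * y * (y + P) - (\<beta> / 2 + 2) * P\<^sup>2 - D\<^sup>2 / 2) =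
    (9 / 20 * D\<^sup>2 + 9 / 52 * B\<^sup>2 - (B + D)\<^sup>2 / 8) + (39 / 20 * E\<^sup>2 + 10 / 78 * A\<^sup>2 - A * E)
    + (lam * (79 / 20 * y\<^sup>2 + 20 / 79 * (2 * P + A)\<^sup>2) - lam * - (2 * y * (2 * P + A)))
    + (\<beta> - 4) / 2 * (P\<^sup>2 + 2 * lam * y * P + 2 * lam * y\<^sup>2)
    + ((1 - lam) * (847 / 260 * P\<^sup>2 + 253 / 390 * A\<^sup>2 - 17 / 13 * (A * P))
      + lam * (46113 / 20540 * P\<^sup>2 + 12187 / 30810 * A\<^sup>2 - 329 / 1027 * (A * P)))"
    unfolding B_def by (simp add: power2_eq_square field_simps)
  also have "0 \<le> \<dots>"
    using s\<beta> Q sD sE sy by (intro add_nonneg_nonneg) (simp_all only: diff_ge_0_iff_ge)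
  finally show ?thesis by (simp only: diff_ge_0_iff_ge)
qed

text \<open>The term \<open>q k s^2\<close> has the wrong sign;
  \<open>k / q \<le> \<sigma> / 8\<close> turns it into at most \<open>\<sigma> / 8\<close> times
  the square of \<open>q s = 2 P + D - A\<close>. Dividing by \<open>\<sigma>\<close> and writing
  \<open>\<beta> = \<sigma> b\<close> reduces to the normalized form.\<close>

lemma feedback_form:
  fixes P D A e y \<beta> \<sigma> q k lam :: real
  assumes "0 < \<sigma>" "4 * \<sigma> \<le> \<beta>" "0 \<le> lam" "lam \<le> 1" "0 < q" "k / q \<le> \<sigma> / 8"
    and s: "q * s = 2 * P + D - A"
  shows "q * k * s\<^sup>2 - \<sigma> * (A + 2 * lam * y - 2 * (1 - lam) * P - q * e) * A
      - 2 * \<sigma> * q\<^sup>2 * e\<^sup>2 - \<beta> * lam * y * (y + P) - (\<beta> / 2 + 2 * \<sigma>) * P\<^sup>2 - \<sigma> / 2 * D\<^sup>2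
    \<le> - (\<sigma> / 20) * (A\<^sup>2 + P\<^sup>2 + D\<^sup>2 + q\<^sup>2 * e\<^sup>2 + lam * y\<^sup>2)"
proof -
  have "q * k * s\<^sup>2 = k / q * (2 * P + D - A)\<^sup>2"
    unfolding s[symmetric] using \<open>0 < q\<close> by (simp add: power2_eq_square)
  also have "\<dots> \<le> \<sigma> / 8 * (2 * P + D - A)\<^sup>2"
    using assms by (intro mult_right_mono) auto
  finally have ks: "q * k * s\<^sup>2 \<le> \<sigma> * ((2 * P + D - A)\<^sup>2 / 8)" by simp
  define b where "b = \<beta> / \<sigma>"
  have b: "\<beta> = \<sigma> * b" "4 \<le> b" using assms by (auto simp: b_def field_simps)
  have "\<sigma> * ((2 * P + D - A)\<^sup>2 / 8 - A * (A + 2 * lam * y - 2 * (1 - lam) * P - q * e)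
      - 2 * (q * e)\<^sup>2 - b * lam * y * (y + P) - (b / 2 + 2) * P\<^sup>2 - D\<^sup>2 / 2)
    \<le> \<sigma> * (- (1 / 20) * (A\<^sup>2 + P\<^sup>2 + D\<^sup>2 + (q * e)\<^sup>2 + lam * y\<^sup>2))"
    using assms b by (intro mult_left_mono feedback_form_normalized) auto
  then show ?thesis
    using ks unfolding b(1) by (simp add: power_mult_distrib algebra_simps)
qed

text \<open>The variables stand for integrals of one time slice: \<open>N\<close> for that of
  \<open>h v_x^2\<close>, \<open>K\<close> for that of \<open>h_x^2\<close>. Quantifying over
  numbers makes \<open>\<kappa>\<close> independent of the solution. Strictness of
  \<open>ratio\<close> and \<open>g\<sigma>\<close> leaves part of the dissipation over once the
  quadratic form is served, and this part pays for \<open>\<kappa> \<Psi>\<close>.\<close>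

lemma Lyapunov_dissipation:
  fixes L g \<mu> m a b \<sigma> q k \<gamma> \<beta> lam :: real
  assumes pos: "0 < L" "0 < g" "0 < \<mu>" "0 < m" "0 < a" "0 < b" "0 < \<sigma>" "0 < q" "0 < k" "0 < \<gamma>"
    and lam: "0 \<le> lam" "lam \<le> 1" and \<beta>: "4 * \<sigma> \<le> \<beta>" and kq: "k / q \<le> \<sigma> / 8"
    and ratio: "\<beta> / 2 + 2 * \<sigma> < pi\<^sup>2 * \<mu> * a / (m * L\<^sup>2 * b)" and g\<sigma>: "\<sigma> / 2 < g / (\<mu> * L)"
  shows "\<exists>\<kappa>>0. \<forall>N K P D U2 V2 H2 \<xi> s e y. 0 \<le> N \<and> 0 \<le> K \<and> P\<^sup>2 \<le> m * V2 \<and> pi\<^sup>2 * a * V2 \<le> L\<^sup>2 * b * N \<and>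
      D\<^sup>2 \<le> \<mu>\<^sup>2 * L * K \<and> H2 \<le> L\<^sup>2 * K \<and> U2 \<le> 2 * V2 + 2 * \<mu>\<^sup>2 / a * K \<longrightarrow>
    - \<mu> * N - g * \<mu> * K + q * k * s\<^sup>2 - q * k ^ 3 * \<xi>\<^sup>2
      - \<sigma> * (2 * P + D - q * s + 2 * lam * y - 2 * (1 - lam) * P - q * e) * (2 * P + D - q * s)
      - 2 * \<sigma> * q\<^sup>2 * e\<^sup>2 - \<beta> * lam * y * (y + P)
    \<le> - \<kappa> * (U2 / 2 + V2 / 2 + g * H2 + q * k\<^sup>2 / 2 * \<xi>\<^sup>2 + q / 2 * s\<^sup>2 + \<sigma> * q\<^sup>2 / \<gamma> * e\<^sup>2 + lam / 2 * y\<^sup>2)"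
proof -
  define C1 where "C1 = pi\<^sup>2 * \<mu> * a / (m * L\<^sup>2 * b)"
  define C2 where "C2 = g / (\<mu> * L)"
  have C1: "0 < C1" and C2: "0 < C2" using pos by (simp_all add: C1_def C2_def)
  \<comment> \<open>The largest fraction of both dissipation terms that can be withheld: the other
    \<open>1 - \<theta>\<close> still covers the \<open>P^2\<close> and \<open>D^2\<close> demanded
    by the quadratic form.\<close>
  define \<theta> where "\<theta> = min (1 - (\<beta> / 2 + 2 * \<sigma>) / C1) (1 - (\<sigma> / 2) / C2)"
  have \<theta>0: "0 < \<theta>"
    using ratio g\<sigma> C1 C2 by (simp add: \<theta>_def C1_def[symmetric] C2_def[symmetric] divide_less_eq)
  have "(\<sigma> / 2) / C2 > 0" using pos C2 by simp
  then have \<theta>1: "\<theta> < 1" by (simp add: \<theta>_def min_less_iff_disj)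
  have "(\<beta> / 2 + 2 * \<sigma>) / C1 \<le> 1 - \<theta>" "(\<sigma> / 2) / C2 \<le> 1 - \<theta>" by (auto simp: \<theta>_def)
  then have \<theta>C1: "\<beta> / 2 + 2 * \<sigma> \<le> (1 - \<theta>) * C1" and \<theta>C2: "\<sigma> / 2 \<le> (1 - \<theta>) * C2"
    unfolding pos_divide_le_eq[OF C1] pos_divide_le_eq[OF C2] by auto
  \<comment> \<open>Each pair sets the cost of a part of \<open>\<Psi>\<close> against its reserve:
    the withheld \<open>N\<close> and \<open>K\<close> for the profile terms,
    \<open>q k^3 \<xi>^2\<close> for \<open>\<xi>\<close>, and the margin
    \<open>\<sigma> / 20\<close> of the quadratic form for \<open>e\<close>, \<open>y\<close> and
    \<open>s\<close>.\<close>
  obtain \<kappa> where \<kappa>: "0 < \<kappa>" and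
    \<kappa>1: "\<kappa> * (3 / 2 * L\<^sup>2 * b / (pi\<^sup>2 * a)) \<le> \<theta> * \<mu>" and \<kappa>2: "\<kappa> * (\<mu>\<^sup>2 / a + g * L\<^sup>2) \<le> \<theta> * g * \<mu>" and
    \<kappa>3: "\<kappa> * 1 \<le> 2 * k" and \<kappa>4: "\<kappa> * 1 \<le> \<gamma> / 20" and \<kappa>5: "\<kappa> * 1 \<le> \<sigma> / 10" and \<kappa>6: "\<kappa> * (6 / q) \<le> \<sigma> / 20"
    using ex_small_factor[of "[(3 / 2 * L\<^sup>2 * b / (pi\<^sup>2 * a), \<theta> * \<mu>), (\<mu>\<^sup>2 / a + g * L\<^sup>2, \<theta> * g * \<mu>),
        (1, 2 * k), (1, \<gamma> / 20), (1, \<sigma> / 10), (6 / q, \<sigma> / 20)]"] pos \<theta>0 by auto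
  show ?thesis
  proof (intro exI[of _ \<kappa>] conjI \<kappa> allI impI)
    fix N K P D U2 V2 H2 \<xi> s e y :: real
    assume "0 \<le> N \<and> 0 \<le> K \<and> P\<^sup>2 \<le> m * V2 \<and> pi\<^sup>2 * a * V2 \<le> L\<^sup>2 * b * N \<and>
      D\<^sup>2 \<le> \<mu>\<^sup>2 * L * K \<and> H2 \<le> L\<^sup>2 * K \<and> U2 \<le> 2 * V2 + 2 * \<mu>\<^sup>2 / a * K"
    then have N: "0 \<le> N" and K: "0 \<le> K" and P: "P\<^sup>2 \<le> m * V2" and V2: "pi\<^sup>2 * a * V2 \<le> L\<^sup>2 * b * N" and
      D: "D\<^sup>2 \<le> \<mu>\<^sup>2 * L * K" and H2: "H2 \<le> L\<^sup>2 * K" and U2: "U2 \<le> 2 * V2 + 2 * \<mu>\<^sup>2 / a * K"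
      by auto
    define A where "A = 2 * P + D - q * s"
    have V2': "V2 \<le> L\<^sup>2 * b / (pi\<^sup>2 * a) * N"
      using V2 pos by (simp add: field_simps)
    have "C1 * P\<^sup>2 \<le> C1 * (m * V2)" using P C1 by (intro mult_left_mono) auto
    also have "\<dots> = \<mu> * (pi\<^sup>2 * a * V2) / (L\<^sup>2 * b)" using pos by (simp add: C1_def)
    also have "\<dots> \<le> \<mu> * (L\<^sup>2 * b * N) / (L\<^sup>2 * b)"
      using V2 pos by (intro divide_right_mono mult_left_mono) auto
    also have "\<dots> = \<mu> * N" using pos by simp
    finally have NP: "C1 * P\<^sup>2 \<le> \<mu> * N" .
    have "C2 * D\<^sup>2 \<le> C2 * (\<mu>\<^sup>2 * L * K)" using D C2 by (intro mult_left_mono) auto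
    also have "\<dots> = g * \<mu> * K" using pos by (simp add: C2_def power2_eq_square)
    finally have KD: "C2 * D\<^sup>2 \<le> g * \<mu> * K" .
    have "(\<beta> / 2 + 2 * \<sigma>) * P\<^sup>2 \<le> (1 - \<theta>) * C1 * P\<^sup>2" using \<theta>C1 by (intro mult_right_mono) auto
    also have "\<dots> \<le> (1 - \<theta>) * (\<mu> * N)" unfolding mult.assoc using NP \<theta>1 by (intro mult_left_mono) auto
    finally have NP': "(\<beta> / 2 + 2 * \<sigma>) * P\<^sup>2 \<le> \<mu> * N - \<theta> * \<mu> * N" by (simp add: algebra_simps)
    have "(\<sigma> / 2) * D\<^sup>2 \<le> (1 - \<theta>) * C2 * D\<^sup>2" using \<theta>C2 by (intro mult_right_mono) auto
    also have "\<dots> \<le> (1 - \<theta>) * (g * \<mu> * K)" unfolding mult.assoc using KD \<theta>1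
      by (intro mult_left_mono) (auto simp: mult.assoc)
    finally have KD': "(\<sigma> / 2) * D\<^sup>2 \<le> g * \<mu> * K - \<theta> * g * \<mu> * K" by (simp add: algebra_simps)
    have form: "q * k * s\<^sup>2 - \<sigma> * (A + 2 * lam * y - 2 * (1 - lam) * P - q * e) * A
        - 2 * \<sigma> * q\<^sup>2 * e\<^sup>2 - \<beta> * lam * y * (y + P) - (\<beta> / 2 + 2 * \<sigma>) * P\<^sup>2 - \<sigma> / 2 * D\<^sup>2
      \<le> - (\<sigma> / 20) * (A\<^sup>2 + P\<^sup>2 + D\<^sup>2 + q\<^sup>2 * e\<^sup>2 + lam * y\<^sup>2)"
      using pos lam \<beta> kq by (intro feedback_form) (auto simp: A_def)
    have "\<kappa> * (U2 / 2 + V2 / 2 + g * H2) \<le> \<kappa> * (3 / 2 * (L\<^sup>2 * b / (pi\<^sup>2 * a) * N) + \<mu>\<^sup>2 / a * K + g * (L\<^sup>2 * K))"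
    proof (rule mult_left_mono)
      have "g * H2 \<le> g * (L\<^sup>2 * K)" using H2 pos by (intro mult_left_mono) auto
      moreover have "2 * \<mu>\<^sup>2 / a * K = 2 * (\<mu>\<^sup>2 / a * K)" by simp
      moreover have "U2 / 2 + V2 / 2 + Z \<le> 3 / 2 * X + Y + W"
        if "Z \<le> W" "T = 2 * Y" "U2 \<le> 2 * V2 + T" "V2 \<le> X" for X Y Z W T :: real
        using that by linarith
      ultimately show "U2 / 2 + V2 / 2 + g * H2 \<le> 3 / 2 * (L\<^sup>2 * b / (pi\<^sup>2 * a) * N) + \<mu>\<^sup>2 / a * K + g * (L\<^sup>2 * K)"
        using U2 V2' by blast
    qed (use \<kappa> in simp)
    also have "\<dots> = \<kappa> * (3 / 2 * L\<^sup>2 * b / (pi\<^sup>2 * a)) * N + \<kappa> * (\<mu>\<^sup>2 / a + g * L\<^sup>2) * K"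
      by (simp add: algebra_simps)
    also have "\<dots> \<le> \<theta> * \<mu> * N + \<theta> * g * \<mu> * K"
      using \<kappa>1 \<kappa>2 N K by (intro add_mono mult_right_mono) auto
    finally have e1: "\<kappa> * (U2 / 2 + V2 / 2 + g * H2) \<le> \<theta> * \<mu> * N + \<theta> * g * \<mu> * K" .
    have "\<kappa> * (q * k\<^sup>2 / 2 * \<xi>\<^sup>2) \<le> 2 * k * (q * k\<^sup>2 / 2 * \<xi>\<^sup>2)"
      using \<kappa>3 pos by (intro mult_right_mono) auto
    then have e2: "\<kappa> * (q * k\<^sup>2 / 2 * \<xi>\<^sup>2) \<le> q * k ^ 3 * \<xi>\<^sup>2"
      by (simp add: power2_eq_square power3_eq_cube mult_ac)
    have "\<kappa> * (\<sigma> * q\<^sup>2 / \<gamma> * e\<^sup>2) \<le> \<gamma> / 20 * (\<sigma> * q\<^sup>2 / \<gamma> * e\<^sup>2)"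
      using \<kappa>4 pos by (intro mult_right_mono) auto
    then have e3: "\<kappa> * (\<sigma> * q\<^sup>2 / \<gamma> * e\<^sup>2) \<le> \<sigma> / 20 * (q\<^sup>2 * e\<^sup>2)" using pos by simp
    have "\<kappa> * (lam / 2 * y\<^sup>2) \<le> \<sigma> / 10 * (lam / 2 * y\<^sup>2)"
      using \<kappa>5 lam by (intro mult_right_mono) auto
    then have e4: "\<kappa> * (lam / 2 * y\<^sup>2) \<le> \<sigma> / 20 * (lam * y\<^sup>2)" by simp
    have "(q * s)\<^sup>2 \<le> 12 * (A\<^sup>2 + P\<^sup>2 + D\<^sup>2)"
    proof -
      have "12 * (A\<^sup>2 + P\<^sup>2 + D\<^sup>2) - (2 * P + D - A)\<^sup>2 =
          (2 * P - D)\<^sup>2 + (2 * P + A)\<^sup>2 + (D + A)\<^sup>2 + 9 * D\<^sup>2 + 9 * A\<^sup>2"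
        by (simp add: power2_eq_square algebra_simps)
      also have "0 \<le> \<dots>" by simp
      finally have "(2 * P + D - A)\<^sup>2 \<le> 12 * (A\<^sup>2 + P\<^sup>2 + D\<^sup>2)" by (simp only: diff_ge_0_iff_ge)
      then show ?thesis by (simp add: A_def)
    qed
    then have "1 / (2 * q) * (q * s)\<^sup>2 \<le> 1 / (2 * q) * (12 * (A\<^sup>2 + P\<^sup>2 + D\<^sup>2))"
      using pos by (intro mult_left_mono) auto
    moreover have "1 / (2 * q) * (q * s)\<^sup>2 = q / 2 * s\<^sup>2"
      using pos by (simp add: power2_eq_square)
    moreover have "1 / (2 * q) * (12 * T) = 6 / q * T" for T :: real by simp
    ultimately have "q / 2 * s\<^sup>2 \<le> 6 / q * (A\<^sup>2 + P\<^sup>2 + D\<^sup>2)" by (simp only:)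
    then have "\<kappa> * (q / 2 * s\<^sup>2) \<le> \<kappa> * (6 / q * (A\<^sup>2 + P\<^sup>2 + D\<^sup>2))"
      using \<kappa> by (intro mult_left_mono) auto
    also have "\<dots> = \<kappa> * (6 / q) * (A\<^sup>2 + P\<^sup>2 + D\<^sup>2)" by simp
    also have "\<dots> \<le> \<sigma> / 20 * (A\<^sup>2 + P\<^sup>2 + D\<^sup>2)" using \<kappa>6 by (intro mult_right_mono) auto
    finally have e5: "\<kappa> * (q / 2 * s\<^sup>2) \<le> \<sigma> / 20 * (A\<^sup>2 + P\<^sup>2 + D\<^sup>2)" .
    have sum: "- \<kappa> * (W + W2 + W3 + W4 + W5) =
        - (\<kappa> * W) - \<kappa> * W2 - \<kappa> * W3 - \<kappa> * W4 - \<kappa> * W5" for W W2 W3 W4 W5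
      by (simp add: algebra_simps)
    have c: "- (\<sigma> / 20) * (A\<^sup>2 + P\<^sup>2 + D\<^sup>2 + q\<^sup>2 * e\<^sup>2 + lam * y\<^sup>2) =
        - (\<sigma> / 20 * (A\<^sup>2 + P\<^sup>2 + D\<^sup>2)) - \<sigma> / 20 * (q\<^sup>2 * e\<^sup>2) - \<sigma> / 20 * (lam * y\<^sup>2)"
      by (simp add: algebra_simps)
    \<comment> \<open>Every product is replaced by a variable, so that the final combination is
      linear arithmetic.\<close>
    have lin: "- n - n2 + w - x - F - w2 - w3 \<le> - k1 - k2 - k5 - k3 - k4"
      if "k1 \<le> n' + n2'" "k2 \<le> x" "k3 \<le> c1" "k4 \<le> c2" "k5 \<le> c3"
        "w - F - w2 - w3 - p - d \<le> - c3 - c1 - c2" "p \<le> n - n'" "d \<le> n2 - n2'"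
      for n n2 w x F w2 w3 k1 k2 k3 k4 k5 n' n2' c1 c2 c3 p d :: real
      using that by linarith
    have "- (\<mu> * N) - g * \<mu> * K + q * k * s\<^sup>2 - q * k ^ 3 * \<xi>\<^sup>2
      - \<sigma> * (A + 2 * lam * y - 2 * (1 - lam) * P - q * e) * A
      - 2 * \<sigma> * q\<^sup>2 * e\<^sup>2 - \<beta> * lam * y * (y + P)
    \<le> - \<kappa> * ((U2 / 2 + V2 / 2 + g * H2) + q * k\<^sup>2 / 2 * \<xi>\<^sup>2 + q / 2 * s\<^sup>2 + \<sigma> * q\<^sup>2 / \<gamma> * e\<^sup>2 + lam / 2 * y\<^sup>2)"
      unfolding sum by (rule lin[OF e1 e2 e3 e4 e5 form[unfolded c] NP' KD'])
    then show "- \<mu> * N - g * \<mu> * K + q * k * s\<^sup>2 - q * k ^ 3 * \<xi>\<^sup>2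
      - \<sigma> * (2 * P + D - q * s + 2 * lam * y - 2 * (1 - lam) * P - q * e) * (2 * P + D - q * s)
      - 2 * \<sigma> * q\<^sup>2 * e\<^sup>2 - \<beta> * lam * y * (y + P)
    \<le> - \<kappa> * (U2 / 2 + V2 / 2 + g * H2 + q * k\<^sup>2 / 2 * \<xi>\<^sup>2 + q / 2 * s\<^sup>2 + \<sigma> * q\<^sup>2 / \<gamma> * e\<^sup>2 + lam / 2 * y\<^sup>2)"
      by (simp only: A_def mult_minus_left)
  qed
qed

section \<open>Estimates for a single profile\<close>

lemma abs_diff_le_integral:
  fixes u :: "real \<Rightarrow> real"
  assumes u: "\<And>z. z \<in> {0..L} \<Longrightarrow> (u has_real_derivative u' z) (at z within {0..L})"
    and u': "continuous_on {0..L} u'" and r: "continuous_on {0..L} r"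
    and le: "\<And>z. z \<in> {0..L} \<Longrightarrow> \<bar>u' z\<bar> \<le> r z"
    and xy: "x \<in> {0..L}" "y \<in> {0..L}"
  shows "\<bar>u x - u y\<bar> \<le> integral {0..L} r"
proof -
  have aux: "\<bar>u y - u x\<bar> \<le> integral {0..L} r" if xy: "x \<le> y" "x \<in> {0..L}" "y \<in> {0..L}" for x y
  proof -
    have "(u' has_integral u y - u x) {x..y}"
      using xy by (intro has_integral_deriv DERIV_subset[OF u]) auto
    then have "\<bar>u y - u x\<bar> = norm (integral {x..y} u')" by (simp add: integral_unique)
    also have "\<dots> \<le> integral {x..y} r"
      using xy le
      by (intro integral_norm_bound_integral integrable_continuous_real continuous_on_subset[OF u']
          continuous_on_subset[OF r]) auto
    also have "\<dots> \<le> integral {0..L} r"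
    proof (rule integral_subset_le)
      show "\<forall>z\<in>{0..L}. 0 \<le> r z" using le abs_ge_zero order_trans by blast
    qed (use xy in \<open>auto intro!: integrable_continuous_real continuous_on_subset[OF r]\<close>)
    finally show ?thesis .
  qed
  show ?thesis
  proof (cases "x \<le> y")
    case True
    then show ?thesis using aux[OF True xy] by (simp add: abs_minus_commute)
  next
    case False
    then show ?thesis using aux[of y x] xy by simp
  qed
qed

text \<open>The density of \<open>W + E\<close>, whose two potential terms add up to the coefficient
  \<open>g\<close>. The derivative \<open>hx\<close> is an argument so that classical calculus can
  replace the chosen weak derivative.\<close>

definition energy_density ::
  "real \<Rightarrow> real \<Rightarrow> real \<Rightarrow> (real \<Rightarrow> real) \<Rightarrow> (real \<Rightarrow> real) \<Rightarrow> (real \<Rightarrow> real) \<Rightarrow> real \<Rightarrow> real" where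
  "energy_density g \<mu> hs h hx v x =
     1 / 2 * ((h x * v x + \<mu> * hx x)\<^sup>2 / h x) + 1 / 2 * (h x * (v x)\<^sup>2) + g * (h x - hs)\<^sup>2"

locale profile =
  fixes L g \<mu> m hs :: real and h hx v :: "real \<Rightarrow> real"
  assumes L: "0 < L" and g: "0 < g" and \<mu>: "0 < \<mu>" and hs: "hs = m / L"
    and h_deriv: "\<And>x. x \<in> {0..L} \<Longrightarrow> (h has_real_derivative hx x) (at x within {0..L})"
    and hx_cont: "continuous_on {0..L} hx"
    and h_pos: "\<And>x. x \<in> {0..L} \<Longrightarrow> 0 < h x"
    and v_cont: "continuous_on {0..L} v"
    and mass: "integral {0..L} h = m"
begin

lemma h_cont: "continuous_on {0..L} h"
  by (rule DERIV_continuous_on[OF h_deriv])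

lemma h_nz: "x \<in> {0..L} \<Longrightarrow> h x \<noteq> 0"
  using h_pos by fastforce

lemmas cont = h_cont hx_cont v_cont

abbreviation "U2 \<equiv> integral {0..L} (\<lambda>x. (h x * v x + \<mu> * hx x)\<^sup>2 / h x)"
abbreviation "V2 \<equiv> integral {0..L} (\<lambda>x. h x * (v x)\<^sup>2)"
abbreviation "H2 \<equiv> integral {0..L} (\<lambda>x. (h x - hs)\<^sup>2)"
abbreviation "K \<equiv> integral {0..L} (\<lambda>x. (hx x)\<^sup>2)"
abbreviation "W2 \<equiv> integral {0..L} (\<lambda>x. (v x)\<^sup>2)"
abbreviation "P \<equiv> integral {0..L} (\<lambda>x. h x * v x)"

lemma U2_cont: "continuous_on {0..L} (\<lambda>x. (h x * v x + \<mu> * hx x)\<^sup>2 / h x)"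
  using cont h_nz by (intro continuous_intros) auto

lemma energy_density_cont: "continuous_on {0..L} (energy_density g \<mu> hs h hx v)"
  unfolding energy_density_def[abs_def] using cont h_nz by (intro continuous_intros) auto

lemma integral_energy_density:
  "integral {0..L} (energy_density g \<mu> hs h hx v) = U2 / 2 + V2 / 2 + g * H2"
proof -
  have lin: "integral {0..L} (\<lambda>x. 1 / 2 * A x + 1 / 2 * B x + g * C x) =
      integral {0..L} A / 2 + integral {0..L} B / 2 + g * integral {0..L} C"
    if "continuous_on {0..L} A" "continuous_on {0..L} B" "continuous_on {0..L} C" for A B C :: "real \<Rightarrow> real"
    using that by (simp add: integral_add integrable_continuous_real continuous_intros)
  show ?thesis
    unfolding energy_density_def[abs_def]
    by (rule lin) (use cont U2_cont in \<open>auto intro!: continuous_intros\<close>)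
qed

text \<open>The mean of \<open>h\<close> is \<open>m / L\<close>, so the mean value theorem for its
  primitive applies. This supplies a base point where \<open>level\<close> vanishes.\<close>

lemma hs_attained: "\<exists>y\<in>{0..L}. h y = hs"
proof -
  have "((\<lambda>x. integral {0..x} h) has_derivative (*) (h x)) (at x within {0..L})" if "0 \<le> x" "x \<le> L" for x
    using integral_has_real_derivative[OF h_cont, of x] that by (simp add: has_field_derivative_def)
  then obtain y where "y \<in> {0<..<L}" "integral {0..L} h - integral {0..0} h = h y * (L - 0)"
    using mvt_simple[OF L, of "\<lambda>x. integral {0..x} h" "\<lambda>x. (*) (h x)"] by auto
  then show ?thesis using L by (intro bexI[of _ y]) (auto simp: mass hs)
qed

text \<open>The derivative of \<open>level hs (h z)\<close> is \<open>(h - hs) hx / sqrt h\<close>,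
  which the energy density dominates after multiplication by \<open>c\<close>; integration starts
  where \<open>h = hs\<close>. The constant \<open>1 / (\<mu> sqrt g)\<close> undoes the scaling of
  \<open>h - hs\<close> by \<open>sqrt g\<close> and of \<open>hx\<close> by
  \<open>\<mu>\<close>.\<close>

lemma level_le:
  assumes x: "x \<in> {0..L}"
  shows "level hs (h x) \<le> c_const g \<mu> * integral {0..L} (energy_density g \<mu> hs h hx v)"
proof -
  obtain y where y: "y \<in> {0..L}" "h y = hs" using hs_attained by blast
  define d where "d z = (h z - hs) / sqrt (h z) * hx z" for z
  have "\<bar>level hs (h x) - level hs (h y)\<bar> \<le>
      integral {0..L} (\<lambda>z. c_const g \<mu> * energy_density g \<mu> hs h hx v z)"
  proof (rule abs_diff_le_integral[where u = "\<lambda>z. level hs (h z)" and u' = d])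
    show "((\<lambda>z. level hs (h z)) has_real_derivative d z) (at z within {0..L})" if "z \<in> {0..L}" for z
      unfolding d_def by (rule DERIV_chain2[OF has_real_derivative_level[OF h_pos[OF that]] h_deriv[OF that]])
    show "continuous_on {0..L} d"
      unfolding d_def using cont h_nz by (intro continuous_intros) auto
    show "continuous_on {0..L} (\<lambda>z. c_const g \<mu> * energy_density g \<mu> hs h hx v z)"
      using energy_density_cont by (intro continuous_intros)
    show "\<bar>d z\<bar> \<le> c_const g \<mu> * energy_density g \<mu> hs h hx v z" if z: "z \<in> {0..L}" for z
    proof -
      define r where "r = sqrt (h z)"
      have r: "0 < r" "h z = r\<^sup>2" using h_pos[OF z] by (simp_all add: r_def)
      define p where "p = v z * r"
      define b where "b = \<mu> * hx z / r"
      define A where "A = sqrt g * (h z - hs)"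
      have "(h z * v z + \<mu> * hx z)\<^sup>2 / h z = (p + b)\<^sup>2"
        using r by (simp add: p_def b_def power2_eq_square field_simps)
      moreover have "h z * (v z)\<^sup>2 = p\<^sup>2" using r by (simp add: p_def power_mult_distrib)
      moreover have "g * (h z - hs)\<^sup>2 = A\<^sup>2" using g by (simp add: A_def power_mult_distrib)
      ultimately have "energy_density g \<mu> hs h hx v z = 1 / 2 * (p + b)\<^sup>2 + 1 / 2 * p\<^sup>2 + A\<^sup>2"
        by (simp add: energy_density_def)
      \<comment> \<open>Completing the square in \<open>p\<close> removes the velocity and leaves
        \<open>b^2 / 4\<close>; together with \<open>A^2\<close> this dominates the product. Neither
        \<open>E\<close> nor \<open>W\<close> alone would control \<open>hx\<close> without the
        velocity.\<close>
      also have "\<dots> = \<bar>A * b\<bar> + (p + b / 2)\<^sup>2 + (\<bar>A\<bar> - \<bar>b\<bar> / 2)\<^sup>2"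
        by (simp add: power2_eq_square abs_mult algebra_simps)
      finally have "\<bar>A * b\<bar> \<le> energy_density g \<mu> hs h hx v z" by simp
      then have "c_const g \<mu> * \<bar>A * b\<bar> \<le> c_const g \<mu> * energy_density g \<mu> hs h hx v z"
        using g \<mu> by (intro mult_left_mono) (auto simp: c_const_def)
      moreover have "c_const g \<mu> * \<bar>A * b\<bar> = \<bar>d z\<bar>"
      proof -
        have "d z = (h z - hs) / r * hx z" by (simp add: d_def r_def)
        then show ?thesis using g \<mu> r(1) by (simp add: c_const_def A_def b_def abs_mult)
      qed
      ultimately show ?thesis by simp
    qed
  qed (use x y in auto)
  then show ?thesis using y by simp
qed

lemma height_diff_sq_le:
  assumes "x \<in> {0..L}" "y \<in> {0..L}"
  shows "(h x - h y)\<^sup>2 \<le> L * K"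
proof -
  have "\<bar>h x - h y\<bar> \<le> integral {0..L} (\<lambda>z. \<bar>hx z\<bar>)"
    using assms hx_cont by (intro abs_diff_le_integral[OF h_deriv]) (auto intro!: continuous_intros)
  then have "(h x - h y)\<^sup>2 \<le> (integral {0..L} (\<lambda>z. 1 * \<bar>hx z\<bar>))\<^sup>2"
    by (subst power2_abs[symmetric], intro power_mono) auto
  also have "\<dots> \<le> integral {0..L} (\<lambda>z. 1\<^sup>2) * integral {0..L} (\<lambda>z. \<bar>hx z\<bar>\<^sup>2)"
    using hx_cont by (intro Cauchy_Schwarz_integral continuous_intros)
  also have "\<dots> = L * K" using L by simp
  finally show ?thesis .
qed

lemma H2_le: "H2 \<le> L\<^sup>2 * K"
proof -
  obtain y where y: "y \<in> {0..L}" "h y = hs" using hs_attained by blast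
  have "H2 \<le> integral {0..L} (\<lambda>x. L * K)"
    using height_diff_sq_le[OF _ y(1)] y h_cont
    by (intro integral_le integrable_continuous_real continuous_intros) auto
  also have "\<dots> = L\<^sup>2 * K" using L by (simp add: power2_eq_square)
  finally show ?thesis .
qed

lemma momentum_sq_le: "P\<^sup>2 \<le> m * V2"
proof -
  have c: "continuous_on {0..L} (\<lambda>x. sqrt (h x))" using h_cont by (intro continuous_intros)
  have "(integral {0..L} (\<lambda>x. sqrt (h x) * (sqrt (h x) * v x)))\<^sup>2 \<le>
      integral {0..L} (\<lambda>x. (sqrt (h x))\<^sup>2) * integral {0..L} (\<lambda>x. (sqrt (h x) * v x)\<^sup>2)"
    using c v_cont h_cont by (intro Cauchy_Schwarz_integral continuous_intros)
  moreover have "integral {0..L} (\<lambda>x. sqrt (h x) * (sqrt (h x) * v x)) = P"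
    using h_pos by (intro integral_cong) (simp add: less_imp_le flip: mult.assoc)
  moreover have "integral {0..L} (\<lambda>x. (sqrt (h x))\<^sup>2) = integral {0..L} h"
    using h_pos by (intro integral_cong) (simp add: less_imp_le)
  moreover have "integral {0..L} (\<lambda>x. (sqrt (h x) * v x)\<^sup>2) = V2"
    using h_pos by (intro integral_cong) (simp add: less_imp_le power_mult_distrib)
  ultimately show ?thesis by (simp add: mass)
qed

context
  fixes a b :: real
  assumes a: "0 < a" and bounds: "\<And>x. x \<in> {0..L} \<Longrightarrow> a \<le> h x \<and> h x \<le> b"
begin

lemma V2_bounds: "a * W2 \<le> V2" "V2 \<le> b * W2"
proof -
  have i: "(\<lambda>x. c * (v x)\<^sup>2) integrable_on {0..L}" "(\<lambda>x. h x * (v x)\<^sup>2) integrable_on {0..L}" for c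
    using cont by (auto intro!: integrable_continuous_real continuous_intros)
  have "integral {0..L} (\<lambda>x. a * (v x)\<^sup>2) \<le> V2"
    by (intro integral_le i mult_right_mono) (use bounds in auto)
  moreover have "V2 \<le> integral {0..L} (\<lambda>x. b * (v x)\<^sup>2)"
    by (intro integral_le i mult_right_mono) (use bounds in auto)
  ultimately show "a * W2 \<le> V2" "V2 \<le> b * W2" by simp_all
qed

lemma U2_le: "U2 \<le> 2 * V2 + 2 * \<mu>\<^sup>2 / a * K"
proof -
  have "U2 \<le> integral {0..L} (\<lambda>x. 2 * (h x * (v x)\<^sup>2) + 2 * \<mu>\<^sup>2 / a * (hx x)\<^sup>2)"
  proof (intro integral_le integrable_continuous_real U2_cont)
    fix x assume x: "x \<in> {0..L}"
    define H where "H = h x"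
    have H: "0 < H" "a \<le> H" using bounds[OF x] h_pos[OF x] by (auto simp: H_def)
    have "0 \<le> (H * v x - \<mu> * hx x)\<^sup>2" by simp
    then have "(H * v x + \<mu> * hx x)\<^sup>2 \<le> 2 * (H * v x)\<^sup>2 + 2 * (\<mu> * hx x)\<^sup>2"
      by (simp add: power2_eq_square algebra_simps)
    then have "(H * v x + \<mu> * hx x)\<^sup>2 / H \<le> (2 * (H * v x)\<^sup>2 + 2 * (\<mu> * hx x)\<^sup>2) / H"
      using H by (intro divide_right_mono) auto
    also have "\<dots> = 2 * (H * (v x)\<^sup>2) + 2 * (\<mu> * hx x)\<^sup>2 / H"
      using H by (simp add: power2_eq_square field_simps)
    also have "2 * (\<mu> * hx x)\<^sup>2 / H \<le> 2 * (\<mu> * hx x)\<^sup>2 / a"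
      using H a by (intro divide_left_mono) auto
    finally show "(h x * v x + \<mu> * hx x)\<^sup>2 / h x \<le> 2 * (h x * (v x)\<^sup>2) + 2 * \<mu>\<^sup>2 / a * (hx x)\<^sup>2"
      by (simp add: H_def power_mult_distrib)
  qed (use cont a in \<open>intro continuous_intros; simp\<close>)
  also have "\<dots> = 2 * V2 + 2 * \<mu>\<^sup>2 / a * K"
  proof -
    have "integral {0..L} (\<lambda>x. c * A x + d * B x) = c * integral {0..L} A + d * integral {0..L} B"
      if "continuous_on {0..L} A" "continuous_on {0..L} B" for A B :: "real \<Rightarrow> real" and c d
      using that by (simp add: integral_add integrable_continuous_real continuous_intros)
    from this show ?thesis by (rule) (use cont in \<open>auto intro!: continuous_intros\<close>)
  qed
  finally show ?thesis .
qed

text \<open>\<open>\<mu> hx\<close> is the difference of \<open>h v + \<mu> hx\<close> and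
  \<open>h v\<close>, whose weighted squares are \<open>U2\<close> and \<open>V2\<close>; the
  parallelogram law bounds it and removing the weight \<open>1 / h\<close> costs the factor
  \<open>b\<close>.\<close>

lemma K_le: "\<mu>\<^sup>2 * K \<le> 2 * b * (U2 + V2)"
proof -
  have "integral {0..L} (\<lambda>x. \<mu>\<^sup>2 * (hx x)\<^sup>2) \<le>
      integral {0..L} (\<lambda>x. 2 * b * ((h x * v x + \<mu> * hx x)\<^sup>2 / h x + h x * (v x)\<^sup>2))"
  proof (intro integral_le integrable_continuous_real)
    fix x assume x: "x \<in> {0..L}"
    define H where "H = h x"
    define u where "u = H * v x + \<mu> * hx x"
    have H: "0 < H" "H \<le> b" using bounds[OF x] h_pos[OF x] by (auto simp: H_def)
    have "(\<mu> * hx x)\<^sup>2 + (u + H * v x)\<^sup>2 = 2 * u\<^sup>2 + 2 * (H * v x)\<^sup>2"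
      by (simp add: u_def power2_eq_square algebra_simps)
    then have "(\<mu> * hx x)\<^sup>2 \<le> 2 * u\<^sup>2 + 2 * (H * v x)\<^sup>2"
      using zero_le_power2[of "u + H * v x"] by linarith
    also have "\<dots> = 2 * H * (u\<^sup>2 / H + H * (v x)\<^sup>2)"
      using H by (simp add: power2_eq_square field_simps)
    also have "\<dots> \<le> 2 * b * (u\<^sup>2 / H + H * (v x)\<^sup>2)"
      using H by (intro mult_right_mono) auto
    finally show "\<mu>\<^sup>2 * (hx x)\<^sup>2 \<le> 2 * b * ((h x * v x + \<mu> * hx x)\<^sup>2 / h x + h x * (v x)\<^sup>2)"
      by (simp add: H_def u_def power_mult_distrib)
  qed (use cont h_nz in \<open>auto intro!: continuous_intros\<close>)
  also have "\<dots> = 2 * b * integral {0..L} (\<lambda>x. (h x * v x + \<mu> * hx x)\<^sup>2 / h x + h x * (v x)\<^sup>2)"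
    by (rule integral_mult_right)
  also have "integral {0..L} (\<lambda>x. (h x * v x + \<mu> * hx x)\<^sup>2 / h x + h x * (v x)\<^sup>2) = U2 + V2"
    using cont by (intro integral_add integrable_continuous_real U2_cont) (intro continuous_intros)
  finally show ?thesis by (simp only: integral_mult_right)
qed

text \<open>Wirtinger's inequality is unweighted, so the weight \<open>h\<close> is replaced by
  \<open>b\<close> on one side and by \<open>a\<close> on the other. The quotient of the two values
  of \<open>G_inv\<close> in the parameter condition originates here.\<close>

lemma dissipation_ge:
  assumes v: "\<And>x. x \<in> {0..L} \<Longrightarrow> (v has_real_derivative vx x) (at x within {0..L})"
    and vx: "continuous_on {0..L} vx" and v0: "v 0 = 0" "v L = 0"
  shows "pi\<^sup>2 * a * V2 \<le> L\<^sup>2 * b * integral {0..L} (\<lambda>x. h x * (vx x)\<^sup>2)"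
proof -
  define X where "X = integral {0..L} (\<lambda>x. (vx x)\<^sup>2)"
  have b: "0 < b" using bounds[of 0] a L by auto
  have "pi\<^sup>2 * a * V2 \<le> pi\<^sup>2 * a * (b * W2)" using V2_bounds a by (intro mult_left_mono) auto
  also have "\<dots> = a * b * L\<^sup>2 * (pi\<^sup>2 / L\<^sup>2 * W2)" using L by simp
  also have "\<dots> \<le> a * b * L\<^sup>2 * X"
    unfolding X_def using a b by (intro mult_left_mono Wirtinger_inequality L v0 v vx) auto
  also have "\<dots> = L\<^sup>2 * b * integral {0..L} (\<lambda>x. a * (vx x)\<^sup>2)" by (simp add: X_def)
  also have "\<dots> \<le> L\<^sup>2 * b * integral {0..L} (\<lambda>x. h x * (vx x)\<^sup>2)"
    using b bounds cont vx
    by (intro mult_left_mono integral_le) (auto intro!: integrable_continuous_real continuous_intros mult_right_mono)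
  finally show ?thesis .
qed

end

lemma V_fun_eq:
  "V_fun L g \<mu> hs q k \<xi> w h v =
    integral {0..L} (energy_density g \<mu> hs h hx v) + q * k\<^sup>2 / 2 * \<xi>\<^sup>2 + q / 2 * (w + k * \<xi>)\<^sup>2"
proof -
  have wd: "AE x in lebesgue_on {0..L}. weak_deriv L h x = hx x"
      "weak_deriv L h \<in> borel_measurable (lebesgue_on {0..L})"
    by (rule weak_deriv_classical(2,3)[OF L h_deriv hx_cont]; simp)+
  have m: "h \<in> borel_measurable (lebesgue_on {0..L})" "v \<in> borel_measurable (lebesgue_on {0..L})"
    "hx \<in> borel_measurable (lebesgue_on {0..L})"
    using continuous_imp_integrable_real[OF h_cont] continuous_imp_integrable_real[OF v_cont]
      continuous_imp_integrable_real[OF hx_cont] by auto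
  have "(\<integral>x. inverse (h x) * (h x * v x + \<mu> * weak_deriv L h x)\<^sup>2 \<partial>lebesgue_on {0..L}) =
      (\<integral>x. (h x * v x + \<mu> * hx x)\<^sup>2 / h x \<partial>lebesgue_on {0..L})"
  proof (rule integral_cong_AE)
    show "AE x in lebesgue_on {0..L}. inverse (h x) * (h x * v x + \<mu> * weak_deriv L h x)\<^sup>2 =
        (h x * v x + \<mu> * hx x)\<^sup>2 / h x"
      using wd(1) by eventually_elim (simp add: field_simps)
  qed (use m wd(2) in measurable)
  also have "\<dots> = U2" by (rule lebesgue_on_integral_continuous[OF U2_cont])
  finally show ?thesis
    unfolding V_fun_def W_fun_def E_fun_def integral_energy_density
    using cont by (simp add: lebesgue_on_integral_continuous continuous_intros)
qed

lemma norm_X_eq: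
  "norm_X L \<xi> w (\<lambda>x. h x - hs * indicator {0..L} x) v = sqrt (\<xi>\<^sup>2 + w\<^sup>2 + H2 + K + W2)"
proof -
  define u where "u x = h x - hs * indicator {0..L} x" for x
  \<comment> \<open>The indicator is constant on \<open>[0, L]\<close>, so derivatives within that
    interval do not see its jumps.\<close>
  have u: "(u has_real_derivative hx x) (at x within {0..L})" if "x \<in> {0..L}" for x
  proof (rule has_field_derivative_transform_within[OF _ zero_less_one that])
    show "((\<lambda>x. h x - hs) has_real_derivative hx x) (at x within {0..L})"
      by (auto intro!: derivative_eq_intros h_deriv that)
  qed (simp add: u_def)
  have wd: "AE x in lebesgue_on {0..L}. weak_deriv L u x = hx x"
      "weak_deriv L u \<in> borel_measurable (lebesgue_on {0..L})"
    by (rule weak_deriv_classical(2,3)[OF L u hx_cont]; simp)+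
  have m: "hx \<in> borel_measurable (lebesgue_on {0..L})"
    using continuous_imp_integrable_real[OF hx_cont] by auto
  have nonneg: "0 \<le> integral {0..L} (\<lambda>x. (f x)\<^sup>2)" if "continuous_on {0..L} f" for f :: "real \<Rightarrow> real"
    using that by (intro integral_nonneg integrable_continuous_real continuous_intros) auto
  have "(\<integral>x. (weak_deriv L u x)\<^sup>2 \<partial>lebesgue_on {0..L}) = (\<integral>x. (hx x)\<^sup>2 \<partial>lebesgue_on {0..L})"
  proof (rule integral_cong_AE)
    show "AE x in lebesgue_on {0..L}. (weak_deriv L u x)\<^sup>2 = (hx x)\<^sup>2"
      using wd(1) by eventually_elim simp
  qed (use m wd(2) in measurable)
  also have "\<dots> = K" using hx_cont by (intro lebesgue_on_integral_continuous continuous_intros)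
  finally have "(norm_L2 L (weak_deriv L u))\<^sup>2 = K"
    unfolding norm_L2_def using nonneg[OF hx_cont] by simp
  moreover have "(norm_L2 L v)\<^sup>2 = W2"
    unfolding norm_L2_def using nonneg[OF v_cont] v_cont
    by (simp add: lebesgue_on_integral_continuous continuous_intros)
  moreover have "(norm_L2 L u)\<^sup>2 = H2"
  proof -
    have "(\<integral>x. (u x)\<^sup>2 \<partial>lebesgue_on {0..L}) = (\<integral>x. (h x - hs)\<^sup>2 \<partial>lebesgue_on {0..L})"
      by (intro Bochner_Integration.integral_cong) (auto simp: u_def)
    also have "\<dots> = H2" using h_cont by (intro lebesgue_on_integral_continuous continuous_intros)
    finally show ?thesis
      unfolding norm_L2_def using nonneg[of "\<lambda>x. h x - hs"] h_cont by (simp add: continuous_intros)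
  qed
  ultimately show ?thesis unfolding norm_X_def u_def[abs_def] by simp
qed

lemma filter_err_eq: "filter_err L \<mu> h v z = z - P - \<mu> * (h L - h 0)"
  unfolding filter_err_def using cont by (simp add: lebesgue_on_integral_continuous continuous_intros)

lemma in_state_space:
  assumes "v 0 = 0" "v L = 0"
  shows "(\<xi>, w, h, v) \<in> state_space L m"
proof -
  have "H1 L h" unfolding H1_def
    using L2_continuous[OF h_cont] weak_deriv_classical(1)[OF L h_deriv hx_cont] by blast
  then show ?thesis
    unfolding state_space_def using assms cont h_pos mass by (simp add: lebesgue_on_integral_continuous)
qed

end

text \<open>The functional and the squared norm are comparable only while \<open>h\<close> stays
  between \<open>a\<close> and \<open>b\<close>. Stating this for numbers makes \<open>C\<close> and
  \<open>D\<close> depend on the parameters and these two levels alone.\<close>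

lemma Lyapunov_norm_equivalence:
  fixes L g \<mu> a b \<sigma> q k \<gamma> lam :: real
  assumes pos: "0 < g" "0 < \<mu>" "0 < a" "0 < b" "0 < \<sigma>" "0 < q" "0 < k" "0 < \<gamma>" and lam: "0 \<le> lam"
  shows "\<exists>C D. 0 < C \<and> 0 < D \<and> (\<forall>U2 V2 H2 K W2 \<xi> w e y.
    0 \<le> U2 \<and> 0 \<le> V2 \<and> 0 \<le> H2 \<and> 0 \<le> K \<and> 0 \<le> W2 \<and>
    U2 \<le> 2 * V2 + 2 * \<mu>\<^sup>2 / a * K \<and> V2 \<le> b * W2 \<and> a * W2 \<le> V2 \<and> \<mu>\<^sup>2 * K \<le> 2 * b * (U2 + V2) \<longrightarrow>
    (let \<Psi> = U2 / 2 + V2 / 2 + g * H2 + q * k\<^sup>2 / 2 * \<xi>\<^sup>2 + q / 2 * (w + k * \<xi>)\<^sup>2 +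
        \<sigma> * q\<^sup>2 / \<gamma> * e\<^sup>2 + lam / 2 * y\<^sup>2;
      T = \<xi>\<^sup>2 + w\<^sup>2 + H2 + K + W2 + e\<^sup>2 + lam * y\<^sup>2
     in \<Psi> \<le> C * T \<and> T \<le> D * \<Psi>))"
proof -
  define C where "C = 3 / 2 * b + \<mu>\<^sup>2 / a + g + 2 * (q * k\<^sup>2) + q + \<sigma> * q\<^sup>2 / \<gamma> + 1"
  define D where "D = 2 / (q * k\<^sup>2) + 8 / q + 1 / g + 2 / a + 4 * b / \<mu>\<^sup>2 + \<gamma> / (\<sigma> * q\<^sup>2) + 2"
  have terms: "0 < b" "0 < \<mu>\<^sup>2 / a" "0 < g" "0 < q * k\<^sup>2" "0 < q" "0 < \<sigma> * q\<^sup>2 / \<gamma>"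
    "0 < 2 / (q * k\<^sup>2)" "0 < 8 / q" "0 < 1 / g" "0 < 2 / a" "0 < 4 * b / \<mu>\<^sup>2" "0 < \<gamma> / (\<sigma> * q\<^sup>2)"
    using pos by simp_all
  have CD: "0 < C" "0 < D" unfolding C_def D_def using terms by linarith+
  have coeff: "3 / 2 * b \<le> C" "\<mu>\<^sup>2 / a \<le> C" "g \<le> C" "3 / 2 * (q * k\<^sup>2) \<le> C" "q \<le> C" "\<sigma> * q\<^sup>2 / \<gamma> \<le> C" "1 / 2 \<le> C"
    unfolding C_def using terms by linarith+
  show ?thesis
  proof (rule exI[of _ C], rule exI[of _ D], intro conjI CD allI impI)
    fix U2 V2 H2 K W2 \<xi> w e y :: real
    assume "0 \<le> U2 \<and> 0 \<le> V2 \<and> 0 \<le> H2 \<and> 0 \<le> K \<and> 0 \<le> W2 \<and>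
      U2 \<le> 2 * V2 + 2 * \<mu>\<^sup>2 / a * K \<and> V2 \<le> b * W2 \<and> a * W2 \<le> V2 \<and> \<mu>\<^sup>2 * K \<le> 2 * b * (U2 + V2)"
    then have nn: "0 \<le> U2" "0 \<le> V2" "0 \<le> H2" "0 \<le> K" "0 \<le> W2"
      and U2: "U2 \<le> 2 * V2 + 2 * \<mu>\<^sup>2 / a * K" and V2: "V2 \<le> b * W2" "a * W2 \<le> V2"
      and K: "\<mu>\<^sup>2 * K \<le> 2 * b * (U2 + V2)" by auto
    define s where "s = w + k * \<xi>"
    define \<Psi> where "\<Psi> = U2 / 2 + V2 / 2 + g * H2 + q * k\<^sup>2 / 2 * \<xi>\<^sup>2 + q / 2 * s\<^sup>2 +
        \<sigma> * q\<^sup>2 / \<gamma> * e\<^sup>2 + lam / 2 * y\<^sup>2"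
    define T where "T = \<xi>\<^sup>2 + w\<^sup>2 + H2 + K + W2 + e\<^sup>2 + lam * y\<^sup>2"
    have parts: "0 \<le> U2 / 2" "0 \<le> V2 / 2" "0 \<le> g * H2" "0 \<le> q * k\<^sup>2 / 2 * \<xi>\<^sup>2" "0 \<le> q / 2 * s\<^sup>2"
      "0 \<le> \<sigma> * q\<^sup>2 / \<gamma> * e\<^sup>2" "0 \<le> lam / 2 * y\<^sup>2"
      using nn pos lam by simp_all
    have "\<Psi> \<le> C * T"
    proof -
      have "s\<^sup>2 \<le> 2 * w\<^sup>2 + 2 * (k\<^sup>2 * \<xi>\<^sup>2)"
        using zero_le_power2[of "w - k * \<xi>"] by (simp add: s_def power2_eq_square algebra_simps)
      then have "q / 2 * s\<^sup>2 \<le> q / 2 * (2 * w\<^sup>2 + 2 * (k\<^sup>2 * \<xi>\<^sup>2))" using pos by (intro mult_left_mono) auto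
      also have "\<dots> = q * w\<^sup>2 + q * k\<^sup>2 * \<xi>\<^sup>2" by (simp add: algebra_simps)
      finally have qs: "q / 2 * s\<^sup>2 \<le> q * w\<^sup>2 + q * k\<^sup>2 * \<xi>\<^sup>2" .
      have c: "3 / 2 * b * W2 \<le> C * W2" "\<mu>\<^sup>2 / a * K \<le> C * K" "g * H2 \<le> C * H2"
        "3 / 2 * (q * k\<^sup>2) * \<xi>\<^sup>2 \<le> C * \<xi>\<^sup>2" "q * w\<^sup>2 \<le> C * w\<^sup>2" "\<sigma> * q\<^sup>2 / \<gamma> * e\<^sup>2 \<le> C * e\<^sup>2"
        "1 / 2 * (lam * y\<^sup>2) \<le> C * (lam * y\<^sup>2)"
        using coeff nn lam by (intro mult_right_mono; simp)+
      have "\<Psi> \<le> 3 / 2 * b * W2 + \<mu>\<^sup>2 / a * K + g * H2 + 3 / 2 * (q * k\<^sup>2) * \<xi>\<^sup>2 + q * w\<^sup>2 +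
          \<sigma> * q\<^sup>2 / \<gamma> * e\<^sup>2 + 1 / 2 * (lam * y\<^sup>2)"
      proof -
        have "U2 / 2 + V2 / 2 \<le> 3 / 2 * b * W2 + \<mu>\<^sup>2 / a * K"
        proof -
          have "u / 2 + v / 2 \<le> 3 / 2 * x + z" if "u \<le> 2 * v + 2 * z" "v \<le> x" for u v x z :: real
            using that by linarith
          from this[of U2 V2 "\<mu>\<^sup>2 / a * K" "b * W2"] show ?thesis using U2 V2 by (simp add: mult.assoc)
        qed
        moreover have "q * k\<^sup>2 / 2 * \<xi>\<^sup>2 + q * k\<^sup>2 * \<xi>\<^sup>2 = 3 / 2 * (q * k\<^sup>2) * \<xi>\<^sup>2" by simp
        moreover have "lam / 2 * y\<^sup>2 = 1 / 2 * (lam * y\<^sup>2)" by simp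
        ultimately show ?thesis using qs unfolding \<Psi>_def by linarith
      qed
      also have "\<dots> \<le> C * W2 + C * K + C * H2 + C * \<xi>\<^sup>2 + C * w\<^sup>2 + C * e\<^sup>2 + C * (lam * y\<^sup>2)"
        using c by (intro add_mono) 
      also have "\<dots> = C * T" by (simp add: T_def algebra_simps)
      finally show ?thesis .
    qed
    moreover have "T \<le> D * \<Psi>"
    proof -
      have le\<Psi>: "U2 / 2 + V2 / 2 \<le> \<Psi>" "V2 / 2 \<le> \<Psi>" "g * H2 \<le> \<Psi>" "q * k\<^sup>2 / 2 * \<xi>\<^sup>2 \<le> \<Psi>" "q / 2 * s\<^sup>2 \<le> \<Psi>"
        "\<sigma> * q\<^sup>2 / \<gamma> * e\<^sup>2 \<le> \<Psi>" "lam / 2 * y\<^sup>2 \<le> \<Psi>"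
        unfolding \<Psi>_def using parts by linarith+
      have t1: "\<xi>\<^sup>2 \<le> 2 / (q * k\<^sup>2) * \<Psi>" using le\<Psi>(4) pos by (simp add: field_simps)
      have t2: "w\<^sup>2 \<le> 8 / q * \<Psi>"
      proof -
        have "w\<^sup>2 \<le> 2 * s\<^sup>2 + 2 * (k\<^sup>2 * \<xi>\<^sup>2)"
          using zero_le_power2[of "w + 2 * k * \<xi>"] by (simp add: s_def power2_eq_square algebra_simps)
        moreover have "s\<^sup>2 \<le> 2 / q * \<Psi>" "k\<^sup>2 * \<xi>\<^sup>2 \<le> 2 / q * \<Psi>"
          using le\<Psi>(4,5) pos by (simp_all add: field_simps)
        moreover have "8 / q * \<Psi> = 4 * (2 / q * \<Psi>)" by simp
        ultimately show ?thesis by linarith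
      qed
      have t3: "H2 \<le> 1 / g * \<Psi>" using le\<Psi>(3) pos by (simp add: field_simps)
      have t4: "W2 \<le> 2 / a * \<Psi>"
      proof -
        have "a * W2 \<le> 2 * \<Psi>" using V2 le\<Psi>(2) by linarith
        then show ?thesis using pos by (simp add: field_simps)
      qed
      have t5: "K \<le> 4 * b / \<mu>\<^sup>2 * \<Psi>"
      proof -
        note K
        also have "2 * b * (U2 + V2) \<le> 2 * b * (2 * \<Psi>)"
          using le\<Psi>(1) pos by (intro mult_left_mono) auto
        also have "\<dots> = 4 * b * \<Psi>" by simp
        finally have "\<mu>\<^sup>2 * K \<le> 4 * b * \<Psi>" .
        then show ?thesis using pos by (simp add: field_simps)
      qed
      have t6: "e\<^sup>2 \<le> \<gamma> / (\<sigma> * q\<^sup>2) * \<Psi>" using le\<Psi>(6) pos by (simp add: field_simps)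
      have t7: "lam * y\<^sup>2 \<le> 2 * \<Psi>" using le\<Psi>(7) by simp
      have "T \<le> 2 / (q * k\<^sup>2) * \<Psi> + 8 / q * \<Psi> + 1 / g * \<Psi> + 4 * b / \<mu>\<^sup>2 * \<Psi> + 2 / a * \<Psi> +
          \<gamma> / (\<sigma> * q\<^sup>2) * \<Psi> + 2 * \<Psi>"
        unfolding T_def by (intro add_mono t1 t2 t3 t4 t5 t6 t7)
      also have "\<dots> = D * \<Psi>" by (simp add: D_def algebra_simps)
      finally show ?thesis .
    qed
    ultimately show "let \<Psi> = U2 / 2 + V2 / 2 + g * H2 + q * k\<^sup>2 / 2 * \<xi>\<^sup>2 + q / 2 * (w + k * \<xi>)\<^sup>2 +
        \<sigma> * q\<^sup>2 / \<gamma> * e\<^sup>2 + lam / 2 * y\<^sup>2;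
      T = \<xi>\<^sup>2 + w\<^sup>2 + H2 + K + W2 + e\<^sup>2 + lam * y\<^sup>2
     in \<Psi> \<le> C * T \<and> T \<le> D * \<Psi>"
      by (simp add: Let_def \<Psi>_def T_def s_def)
  qed
qed

section \<open>Classical solutions\<close>

text \<open>The differential inequality is known only below \<open>r'\<close>, so invariance of the
  smaller sublevel set must be proved before the exponential bound; the gap between \<open>r\<close>
  and \<open>r'\<close> makes this possible. Times start at \<open>0\<close> by continuity, as the
  derivative is given only for positive times.\<close>

lemma decay_from_sublevel:
  fixes \<Psi> :: "real \<Rightarrow> real"
  assumes cont: "continuous_on {0..} \<Psi>" and "r < r'" and init: "\<Psi> 0 \<le> r" and "0 < \<kappa>"
    and nonneg: "\<And>t. 0 \<le> t \<Longrightarrow> 0 \<le> \<Psi> t"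
    and deriv: "\<And>t. \<lbrakk>0 < t; \<Psi> t \<le> r'\<rbrakk> \<Longrightarrow> \<exists>d. (\<Psi> has_real_derivative d) (at t) \<and> d \<le> - \<kappa> * \<Psi> t"
    and t: "0 \<le> t"
  shows "\<Psi> t \<le> r" "\<Psi> t \<le> \<Psi> 0 * exp (- \<kappa> * t)"
proof -
  have le: "\<Psi> t \<le> r" if "0 \<le> t" for t
  proof (rule ccontr)
    assume "\<not> \<Psi> t \<le> r"
    then have "r < \<Psi> t" by simp
    define S where "S = {s \<in> {0..t}. \<Psi> s \<le> r}"
    have ct: "continuous_on {0..t} \<Psi>" using cont by (rule continuous_on_subset) auto
    have "closed S" unfolding S_def by (intro continuous_on_closed_Collect_le ct continuous_intros)
    have S: "0 \<in> S" "bdd_above S" using init \<open>0 \<le> t\<close> by (auto simp: S_def intro: bdd_aboveI[of _ t])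
    \<comment> \<open>The last time up to \<open>t\<close> with \<open>\<Psi> \<le> r\<close>.
      Shortly afterwards \<open>\<Psi>\<close> is above \<open>r\<close> but still below
      \<open>r'\<close>, where it cannot increase, so it cannot have left.\<close>
    define t0 where "t0 = Sup S"
    have "t0 \<in> S" unfolding t0_def using S \<open>closed S\<close> by (intro closed_contains_Sup) auto
    then have t0: "0 \<le> t0" "t0 \<le> t" "\<Psi> t0 \<le> r" by (auto simp: S_def)
    have after: "r < \<Psi> s" if "t0 < s" "s \<le> t" for s
    proof (rule ccontr)
      assume "\<not> r < \<Psi> s"
      then have "s \<in> S" using that t0 by (auto simp: S_def)
      then have "s \<le> t0" unfolding t0_def using S by (intro cSup_upper)
      then show False using that by simp
    qed
    have "t0 < t" using t0 \<open>r < \<Psi> t\<close> by (cases "t0 = t") auto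
    have "0 < r' - \<Psi> t0" using t0 \<open>r < r'\<close> by simp
    then obtain \<delta> where "0 < \<delta>" and \<delta>: "\<And>s. \<lbrakk>s \<in> {0..t}; dist s t0 < \<delta>\<rbrakk> \<Longrightarrow> dist (\<Psi> s) (\<Psi> t0) < r' - \<Psi> t0"
      using ct t0 unfolding continuous_on_iff by (metis atLeastAtMost_iff)
    define t2 where "t2 = min t (t0 + \<delta> / 2)"
    have t2: "t0 < t2" "t2 \<le> t" "t2 < t0 + \<delta>" using \<open>t0 < t\<close> \<open>0 < \<delta>\<close> by (auto simp: t2_def)
    have "\<Psi> t2 \<le> \<Psi> t0"
    proof (rule DERIV_nonpos_imp_decreasing_open[where f = \<Psi>])
      fix s assume s: "t0 < s" "s < t2"
      have "dist (\<Psi> s) (\<Psi> t0) < r' - \<Psi> t0"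
        using s t0 t2 by (intro \<delta>) (auto simp: dist_real_def)
      then have "\<Psi> s \<le> r'" by (simp add: dist_real_def)
      then obtain d where "(\<Psi> has_real_derivative d) (at s)" "d \<le> - \<kappa> * \<Psi> s"
        using deriv[of s] s t0 by auto
      moreover have "- \<kappa> * \<Psi> s \<le> 0" using \<open>0 < \<kappa>\<close> nonneg[of s] s t0 by simp
      ultimately show "\<exists>y. (\<Psi> has_real_derivative y) (at s) \<and> y \<le> 0" by force
    qed (use t2 t0 in \<open>auto intro: continuous_on_subset[OF ct]\<close>)
    then show False using after[of t2] t2 t0 by simp
  qed
  show "\<Psi> t \<le> r" using t by (rule le)
  have "exp (\<kappa> * t) * \<Psi> t \<le> exp (\<kappa> * 0) * \<Psi> 0"
  proof (cases "t = 0")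
    case False
    show ?thesis
    proof (rule DERIV_nonpos_imp_decreasing_open[where f = "\<lambda>t. exp (\<kappa> * t) * \<Psi> t"])
      fix s assume s: "0 < s" "s < t"
      obtain d where d: "(\<Psi> has_real_derivative d) (at s)" "d \<le> - \<kappa> * \<Psi> s"
        using deriv[of s] le[of s] s \<open>r < r'\<close> by auto
      have "((\<lambda>t. exp (\<kappa> * t) * \<Psi> t) has_real_derivative exp (\<kappa> * s) * (d + \<kappa> * \<Psi> s)) (at s)"
        by (auto intro!: derivative_eq_intros d(1) simp: algebra_simps)
      moreover have "exp (\<kappa> * s) * (d + \<kappa> * \<Psi> s) \<le> 0"
        using d(2) by (simp add: mult_le_0_iff)
      ultimately show "\<exists>y. ((\<lambda>t. exp (\<kappa> * t) * \<Psi> t) has_real_derivative y) (at s) \<and> y \<le> 0" by blast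
    next
      have "continuous_on {0..t} \<Psi>" using cont by (rule continuous_on_subset) auto
      then show "continuous_on {0..t} (\<lambda>t. exp (\<kappa> * t) * \<Psi> t)" by (intro continuous_intros)
    qed (use False t in auto)
  qed simp
  then show "\<Psi> t \<le> \<Psi> 0 * exp (- \<kappa> * t)"
    by (simp add: exp_minus field_simps)
qed

section \<open>Energy and momentum balance of the flow\<close>

text \<open>The first bracket is the time derivative of the energy density, the second the space
  derivative of its flux, and the right side the source. Writing \<open>q = u h\<close> turns the
  quotients into polynomials.\<close>

lemma energy_balance_identity:
  fixes h ht hx hxt hxx v vt vx vxx f g \<mu> hs :: real
  assumes h: "h \<noteq> 0"
    and ht: "ht = - (hx * v + h * vx)" and hxt: "hxt = - (hxx * v + 2 * hx * vx + h * vxx)"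
    and mom: "h * vt + h * v * vx + g * h * hx = \<mu> * (hx * vx + h * vxx) + h * f"
  defines "q \<equiv> h * v + \<mu> * hx"
  shows "(q * (ht * v + h * vt + \<mu> * hxt) / h - 1 / 2 * q\<^sup>2 * ht / h\<^sup>2 + 1 / 2 * ht * v\<^sup>2 + h * v * vt
      + 2 * g * (h - hs) * ht)
    + (q * (hx * v + h * vx + \<mu> * hxx) * v / h + 1 / 2 * q\<^sup>2 * vx / h - 1 / 2 * q\<^sup>2 * v * hx / h\<^sup>2
      + 1 / 2 * (hx * v ^ 3 + 3 * h * v\<^sup>2 * vx) + 2 * g * (hx * (h - hs) * v + h * hx * v + h * (h - hs) * vx)
      - \<mu> * (hx * v * vx + h * vx\<^sup>2 + h * v * vxx))
    = - \<mu> * (h * vx\<^sup>2) - g * \<mu> * hx\<^sup>2 + f * (2 * (h * v) + \<mu> * hx)"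
proof -
  define u where "u = q / h"
  have q: "q = u * h" using h by (simp add: u_def)
  \<comment> \<open>The equation of \<open>h u\<close> in material form; inserting
    \<open>hxt\<close> cancels all viscous terms.\<close>
  have "ht * v + h * vt + \<mu> * hxt + v * (hx * v + h * vx + \<mu> * hxx) = h * f - g * h * hx - vx * q"
    using mom unfolding ht hxt q_def by (simp add: algebra_simps power2_eq_square)
  then have e1: "u * (ht * v + h * vt + \<mu> * hxt) + u * (hx * v + h * vx + \<mu> * hxx) * v =
      u * (h * f - g * h * hx - vx * q)"
    by (metis distrib_left mult.assoc mult.commute)
  have e2: "v * (h * vt) = v * (\<mu> * (hx * vx + h * vxx) + h * f - h * v * vx - g * h * hx)"
  proof -
    have "h * vt = \<mu> * (hx * vx + h * vxx) + h * f - h * v * vx - g * h * hx" using mom by linarith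
    then show ?thesis by (simp only:)
  qed
  have "q * X / h = u * X" "q * X * Y / h = u * X * Y" "1 / 2 * q\<^sup>2 * X / h\<^sup>2 = 1 / 2 * u\<^sup>2 * X"
    "1 / 2 * q\<^sup>2 * X * Y / h\<^sup>2 = 1 / 2 * u\<^sup>2 * X * Y" "1 / 2 * q\<^sup>2 * X / h = 1 / 2 * u * q * X" for X Y
    using h by (simp_all add: u_def power2_eq_square)
  note subst = this
  have uq: "1 / 2 * u\<^sup>2 * ht + 1 / 2 * u\<^sup>2 * v * hx = - (1 / 2 * u * q * vx)"
    unfolding ht q by (simp add: power2_eq_square algebra_simps)
  have e3: "u * (h * f - g * h * hx - vx * q) = q * (f - g * hx) - u * q * vx"
    unfolding q by (simp add: algebra_simps)
  have rest: "1 / 2 * ht * v\<^sup>2 + v * (\<mu> * (hx * vx + h * vxx) + h * f - h * v * vx - g * h * hx) + 2 * g * (h - hs) * ht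
      + q * (f - g * hx)
      + 1 / 2 * (hx * v ^ 3 + 3 * h * v\<^sup>2 * vx) + 2 * g * (hx * (h - hs) * v + h * hx * v + h * (h - hs) * vx)
      - \<mu> * (hx * v * vx + h * vx\<^sup>2 + h * v * vxx)
    = - \<mu> * (h * vx\<^sup>2) - g * \<mu> * hx\<^sup>2 + f * (2 * (h * v) + \<mu> * hx)"
    unfolding ht q_def by (simp add: power2_eq_square power3_eq_cube algebra_simps)
  have "h * v * vt = v * (h * vt)" by simp
  with e1 e2 e3 uq rest show ?thesis unfolding subst by linarith
qed

text \<open>The uneven regularity is deliberate: \<open>h\<close>, \<open>hx\<close> and
  \<open>v\<close> are continuous up to \<open>t = 0\<close>, the derivatives \<open>ht\<close>,
  \<open>vt\<close> and \<open>vx\<close> up to the walls for positive times, \<open>hxt\<close> in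
  the open domain, while \<open>hxx\<close> and \<open>vxx\<close> merely exist there.\<close>

locale tank_flow =
  fixes L g \<mu> m hs :: real and f :: "real \<Rightarrow> real"
    and h ht hx hxt hxx v vt vx vxx :: "real \<Rightarrow> real \<Rightarrow> real"
  assumes params: "0 < L" "0 < g" "0 < \<mu>" "hs = m / L"
    and h_x: "\<And>t x. \<lbrakk>0 \<le> t; x \<in> {0..L}\<rbrakk> \<Longrightarrow> (h t has_real_derivative hx t x) (at x within {0..L})"
    and h_t: "\<And>t x. \<lbrakk>0 < t; x \<in> {0..L}\<rbrakk> \<Longrightarrow> ((\<lambda>s. h s x) has_real_derivative ht t x) (at t)"
    and v_x: "\<And>t x. \<lbrakk>0 < t; x \<in> {0..L}\<rbrakk> \<Longrightarrow> (v t has_real_derivative vx t x) (at x within {0..L})"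
    and v_t: "\<And>t x. \<lbrakk>0 < t; x \<in> {0..L}\<rbrakk> \<Longrightarrow> ((\<lambda>s. v s x) has_real_derivative vt t x) (at t)"
    and h_xt: "\<And>t x. \<lbrakk>0 < t; 0 < x; x < L\<rbrakk> \<Longrightarrow> ((\<lambda>s. hx s x) has_real_derivative hxt t x) (at t)"
    and h_xx: "\<And>t x. \<lbrakk>0 < t; 0 < x; x < L\<rbrakk> \<Longrightarrow> (hx t has_real_derivative hxx t x) (at x)"
    and v_xx: "\<And>t x. \<lbrakk>0 < t; 0 < x; x < L\<rbrakk> \<Longrightarrow> (vx t has_real_derivative vxx t x) (at x)"
    and h_cont: "continuous_on ({0..} \<times> {0..L}) (\<lambda>(t, x). h t x)"
    and hx_cont: "continuous_on ({0..} \<times> {0..L}) (\<lambda>(t, x). hx t x)"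
    and v_cont: "continuous_on ({0..} \<times> {0..L}) (\<lambda>(t, x). v t x)"
    and ht_cont: "continuous_on ({0<..} \<times> {0..L}) (\<lambda>(t, x). ht t x)"
    and vt_cont: "continuous_on ({0<..} \<times> {0..L}) (\<lambda>(t, x). vt t x)"
    and vx_cont: "continuous_on ({0<..} \<times> {0..L}) (\<lambda>(t, x). vx t x)"
    and hxt_cont: "continuous_on ({0<..} \<times> {0<..<L}) (\<lambda>(t, x). hxt t x)"
    and f_cont: "continuous_on {0..} f"
    and h_pos: "\<And>t x. \<lbrakk>0 \<le> t; x \<in> {0..L}\<rbrakk> \<Longrightarrow> 0 < h t x"
    and continuity_eq: "\<And>t x. \<lbrakk>0 < t; x \<in> {0..L}\<rbrakk> \<Longrightarrow> ht t x = - (hx t x * v t x + h t x * vx t x)"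
    and momentum_eq: "\<And>t x. \<lbrakk>0 < t; 0 < x; x < L\<rbrakk> \<Longrightarrow>
      h t x * vt t x + h t x * v t x * vx t x + g * h t x * hx t x =
      \<mu> * (hx t x * vx t x + h t x * vxx t x) + h t x * f t"
    and v_0: "\<And>t. 0 \<le> t \<Longrightarrow> v t 0 = 0" and v_L: "\<And>t. 0 \<le> t \<Longrightarrow> v t L = 0"
    and mass: "\<And>t. 0 \<le> t \<Longrightarrow> integral {0..L} (h t) = m"
begin

lemma profile: "0 \<le> t \<Longrightarrow> profile L g \<mu> m hs (h t) (hx t) (v t)"
  using params h_x h_pos mass
  by unfold_locales (auto intro: continuous_on_slice[OF hx_cont] continuous_on_slice[OF v_cont])

lemma hxt_eq:
  assumes "0 < t" "0 < x" "x < L"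
  shows "hxt t x = - (hxx t x * v t x + 2 * hx t x * vx t x + h t x * vxx t x)"
proof -
  have at: "at y within {0..L} = at y" if "0 < y" "y < L" for y
    using that by (simp add: at_within_Icc_at)
  have "(ht t has_real_derivative hxt t x) (at x)"
  proof (rule mixed_partials_commute[where u = h and ux = hx and uxt = hxt and a = 0 and b = L])
    show "(h s has_real_derivative hx s y) (at y)" if "0 < s" "0 < y" "y < L" for s y
      using h_x[of s y] at[of y] that by simp
    show "continuous_on {0<..<L} (hx s)" if "0 < s" for s
      using that by (intro continuous_on_slice[OF hx_cont]) auto
  qed (use assms h_t h_xt hxt_cont in auto)
  moreover have "((\<lambda>y. - (hx t y * v t y + h t y * vx t y)) has_real_derivative
      - (hxx t x * v t x + 2 * hx t x * vx t x + h t x * vxx t x)) (at x)"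
    using h_x[of t x] v_x[of t x] h_xx[of t x] v_xx[of t x] at[of x] assms
    by (auto intro!: derivative_eq_intros)
  then have "(ht t has_real_derivative
      - (hxx t x * v t x + 2 * hx t x * vx t x + h t x * vxx t x)) (at x)"
    by (rule has_field_derivative_transform_within_open[where S = "{0<..<L}"])
      (use assms in \<open>auto simp: continuity_eq\<close>)
  ultimately show ?thesis by (rule DERIV_unique)
qed

lemma cont_pos:
  "continuous_on ({0<..} \<times> {0..L}) (\<lambda>(t, x). h t x)" "continuous_on ({0<..} \<times> {0..L}) (\<lambda>(t, x). hx t x)"
  "continuous_on ({0<..} \<times> {0..L}) (\<lambda>(t, x). v t x)"
  by (rule continuous_on_subset[OF h_cont] continuous_on_subset[OF hx_cont] continuous_on_subset[OF v_cont];
      force)+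

lemma f_cont': "continuous_on ({0<..} \<times> I) (\<lambda>(t, x). f t)"
proof -
  have "continuous_on ({0<..} \<times> I) (\<lambda>p. f (fst p))"
    by (rule continuous_on_compose2[OF f_cont]) (auto intro!: continuous_intros)
  then show ?thesis by (simp add: case_prod_beta')
qed

lemma interior_derivs:
  assumes "0 < t" "0 < x" "x < L"
  shows "(h t has_real_derivative hx t x) (at x)" "(v t has_real_derivative vx t x) (at x)"
    "((\<lambda>s. h s x) has_real_derivative ht t x) (at t)" "((\<lambda>s. v s x) has_real_derivative vt t x) (at t)"
    "h t x \<noteq> 0"
  using h_x[of t x] v_x[of t x] h_t[of t x] v_t[of t x] h_pos[of t x] assms
  by (auto simp: at_within_Icc_at)

definition energy :: "real \<Rightarrow> real" where
  "energy t = integral {0..L} (energy_density g \<mu> hs (h t) (hx t) (v t))"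

definition momentum :: "real \<Rightarrow> real" where
  "momentum t = integral {0..L} (\<lambda>x. h t x * v t x)"

definition level_drop :: "real \<Rightarrow> real" where
  "level_drop t = \<mu> * (h t L - h t 0)"

text \<open>Every term of the flux \<open>\<Phi>\<close> carries a factor \<open>v\<close>, so
  nothing crosses the walls and only the sources remain.\<close>

lemma energy_derivative:
  assumes t: "0 < t"
  shows "(energy has_real_derivative
    - \<mu> * integral {0..L} (\<lambda>x. h t x * (vx t x)\<^sup>2) - g * \<mu> * integral {0..L} (\<lambda>x. (hx t x)\<^sup>2)
    + f t * (2 * momentum t + level_drop t)) (at t)"
proof -
  define q where "q t x = h t x * v t x + \<mu> * hx t x" for t x
  define \<rho>t where "\<rho>t t x = q t x * (ht t x * v t x + h t x * vt t x + \<mu> * hxt t x) / h t x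
      - 1 / 2 * (q t x)\<^sup>2 * ht t x / (h t x)\<^sup>2 + 1 / 2 * ht t x * (v t x)\<^sup>2 + h t x * v t x * vt t x
      + 2 * g * (h t x - hs) * ht t x" for t x
  define \<Phi> where "\<Phi> t x = 1 / 2 * ((q t x)\<^sup>2 * v t x / h t x) + 1 / 2 * (h t x * (v t x) ^ 3)
      + 2 * g * (h t x * (h t x - hs) * v t x) - \<mu> * (h t x * v t x * vx t x)" for t x
  define \<Phi>x where "\<Phi>x t x = q t x * (hx t x * v t x + h t x * vx t x + \<mu> * hxx t x) * v t x / h t x
      + 1 / 2 * (q t x)\<^sup>2 * vx t x / h t x - 1 / 2 * (q t x)\<^sup>2 * v t x * hx t x / (h t x)\<^sup>2
      + 1 / 2 * (hx t x * (v t x) ^ 3 + 3 * h t x * (v t x)\<^sup>2 * vx t x)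
      + 2 * g * (hx t x * (h t x - hs) * v t x + h t x * hx t x * v t x + h t x * (h t x - hs) * vx t x)
      - \<mu> * (hx t x * v t x * vx t x + h t x * (vx t x)\<^sup>2 + h t x * v t x * vxx t x)" for t x
  define S where "S t x = - \<mu> * (h t x * (vx t x)\<^sup>2) - g * \<mu> * (hx t x)\<^sup>2
      + f t * (2 * (h t x * v t x) + \<mu> * hx t x)" for t x
  note cp = cont_pos[unfolded case_prod_beta'] ht_cont[unfolded case_prod_beta'] vt_cont[unfolded case_prod_beta']
    vx_cont[unfolded case_prod_beta']
  have nz: "h (fst p) (snd p) \<noteq> 0" if "p \<in> {0<..} \<times> {0..L}" for p
    using h_pos[of "fst p" "snd p"] that by fastforce
  have "((\<lambda>s. integral {0..L} (energy_density g \<mu> hs (h s) (hx s) (v s))) has_real_derivative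
      integral {0..L} (S t) - (\<Phi> t L - \<Phi> t 0)) (at t)"
  proof (rule balance_law[OF params(1), where \<rho>t = \<rho>t and \<Phi>x = \<Phi>x])
    show "continuous_on ({0<..} \<times> {0..L}) (\<lambda>(t, x). energy_density g \<mu> hs (h t) (hx t) (v t) x)"
      unfolding energy_density_def case_prod_beta' using cp nz by (intro continuous_intros) auto
    show "continuous_on ({0<..} \<times> {0..L}) (\<lambda>(t, x). \<Phi> t x)"
      unfolding \<Phi>_def q_def case_prod_beta' using cp nz by (intro continuous_intros) auto
    show "continuous_on ({0<..} \<times> {0..L}) (\<lambda>(t, x). S t x)"
      unfolding S_def case_prod_beta' using cp f_cont'[of "{0..L}", unfolded case_prod_beta']
      by (intro continuous_intros) auto
    have sub: "continuous_on ({0<..} \<times> {0<..<L}) u" if "continuous_on ({0<..} \<times> {0..L}) u"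
      for u :: "real \<times> real \<Rightarrow> real"
      using that by (rule continuous_on_subset) auto
    have nz': "h (fst p) (snd p) \<noteq> 0" if "p \<in> {0<..} \<times> {0<..<L}" for p
      using nz[of p] that by auto
    show "continuous_on ({0<..} \<times> {0<..<L}) (\<lambda>(t, x). \<rho>t t x)"
      unfolding \<rho>t_def q_def case_prod_beta'
      using sub[OF cp(1)] sub[OF cp(2)] sub[OF cp(3)] sub[OF cp(4)] sub[OF cp(5)] hxt_cont[unfolded case_prod_beta'] nz'
      by (intro continuous_intros) auto
  next
    fix t x :: real assume tx: "0 < t" "0 < x" "x < L"
    note d = interior_derivs[OF tx] h_xt[OF tx] h_xx[OF tx] v_xx[OF tx]
    show "((\<lambda>s. energy_density g \<mu> hs (h s) (hx s) (v s) x) has_real_derivative \<rho>t t x) (at t)"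
      unfolding energy_density_def \<rho>t_def q_def
      by (rule derivative_eq_intros d refl | simp)+ (use d(5) in \<open>simp add: field_simps power2_eq_square\<close>)
    show "(\<Phi> t has_real_derivative \<Phi>x t x) (at x)"
      unfolding \<Phi>_def \<Phi>x_def q_def
      by (rule derivative_eq_intros d refl | simp)+ (use d(5) in \<open>simp add: field_simps power2_eq_square power3_eq_cube\<close>)
    show "\<rho>t t x + \<Phi>x t x = S t x"
      unfolding \<rho>t_def \<Phi>x_def S_def q_def
      by (rule energy_balance_identity[OF d(5) continuity_eq hxt_eq momentum_eq]) (use tx in auto)
  qed (use t in auto)
  moreover have "\<Phi> t L = 0" "\<Phi> t 0 = 0" using t v_0[of t] v_L[of t] by (simp_all add: \<Phi>_def)
  moreover have "integral {0..L} (S t) = - \<mu> * integral {0..L} (\<lambda>x. h t x * (vx t x)\<^sup>2)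
      - g * \<mu> * integral {0..L} (\<lambda>x. (hx t x)\<^sup>2) + f t * (2 * momentum t + level_drop t)"
  proof -
    have c: "continuous_on {0..L} (h t)" "continuous_on {0..L} (hx t)" "continuous_on {0..L} (v t)"
      "continuous_on {0..L} (vx t)"
      using t by (auto intro: continuous_on_slice[OF h_cont] continuous_on_slice[OF hx_cont]
          continuous_on_slice[OF v_cont] continuous_on_slice[OF vx_cont])
    have lin: "integral {0..L} (\<lambda>x. - \<mu> * A x - g * \<mu> * B x + f t * (2 * C x + \<mu> * D x)) =
        - \<mu> * integral {0..L} A - g * \<mu> * integral {0..L} B +
        f t * (2 * integral {0..L} C + \<mu> * integral {0..L} D)"
      if "continuous_on {0..L} A" "continuous_on {0..L} B" "continuous_on {0..L} C" "continuous_on {0..L} D"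
      for A B C D :: "real \<Rightarrow> real"
      using that by (simp add: integral_add integral_diff integrable_continuous_real continuous_intros)
    have "integral {0..L} (hx t) = h t L - h t 0"
      using t params(1) by (intro integral_unique has_integral_deriv h_x) auto
    then show ?thesis
      unfolding S_def momentum_def level_drop_def
      by (subst lin) (use c in \<open>auto intro!: continuous_intros\<close>)
  qed
  ultimately show ?thesis by (simp add: energy_def[abs_def])
qed

text \<open>The momentum alone would leave the wall stresses \<open>\<mu> h v_x\<close>, which are
  not measured. At a wall \<open>v = 0\<close>, so the continuity equation gives
  \<open>h_t = - h v_x\<close>, and adding the level difference cancels them. This is why the filter
  tracks the sum.\<close>

lemma momentum_derivative:
  assumes t: "0 < t"
  shows "((\<lambda>t. momentum t + level_drop t) has_real_derivative
    m * f t - g / 2 * ((h t L)\<^sup>2 - (h t 0)\<^sup>2)) (at t)"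
proof -
  define \<Phi> where "\<Phi> t x = h t x * (v t x)\<^sup>2 + g / 2 * (h t x)\<^sup>2 - \<mu> * (h t x * vx t x)" for t x
  note cp = cont_pos[unfolded case_prod_beta'] ht_cont[unfolded case_prod_beta'] vt_cont[unfolded case_prod_beta']
    vx_cont[unfolded case_prod_beta']
  have sub: "continuous_on ({0<..} \<times> {0<..<L}) u" if "continuous_on ({0<..} \<times> {0..L}) u"
    for u :: "real \<times> real \<Rightarrow> real"
    using that by (rule continuous_on_subset) auto
  have "((\<lambda>s. integral {0..L} (\<lambda>x. h s x * v s x)) has_real_derivative
      integral {0..L} (\<lambda>x. h t x * f t) - (\<Phi> t L - \<Phi> t 0)) (at t)"
  proof (rule balance_law[OF params(1), where \<rho>t = "\<lambda>t x. ht t x * v t x + h t x * vt t x"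
      and \<Phi>x = "\<lambda>t x. hx t x * (v t x)\<^sup>2 + 2 * h t x * v t x * vx t x + g * h t x * hx t x
        - \<mu> * (hx t x * vx t x + h t x * vxx t x)" and S = "\<lambda>t x. h t x * f t"])
    show "continuous_on ({0<..} \<times> {0..L}) (\<lambda>(t, x). h t x * v t x)"
      unfolding case_prod_beta' using cp by (intro continuous_intros) auto
    show "continuous_on ({0<..} \<times> {0..L}) (\<lambda>(t, x). \<Phi> t x)"
      unfolding \<Phi>_def case_prod_beta' using cp by (intro continuous_intros) auto
    show "continuous_on ({0<..} \<times> {0..L}) (\<lambda>(t, x). h t x * f t)"
      using cp f_cont'[of "{0..L}"] unfolding case_prod_beta' by (intro continuous_intros) auto
    show "continuous_on ({0<..} \<times> {0<..<L}) (\<lambda>(t, x). ht t x * v t x + h t x * vt t x)"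
      unfolding case_prod_beta' using sub[OF cp(1)] sub[OF cp(3)] sub[OF cp(4)] sub[OF cp(5)]
      by (intro continuous_intros) auto
  next
    fix t x :: real assume tx: "0 < t" "0 < x" "x < L"
    note d = interior_derivs[OF tx] v_xx[OF tx]
    show "((\<lambda>s. h s x * v s x) has_real_derivative ht t x * v t x + h t x * vt t x) (at t)"
      by (rule derivative_eq_intros d refl)+ simp
    show "(\<Phi> t has_real_derivative hx t x * (v t x)\<^sup>2 + 2 * h t x * v t x * vx t x + g * h t x * hx t x
        - \<mu> * (hx t x * vx t x + h t x * vxx t x)) (at x)"
      unfolding \<Phi>_def by (rule derivative_eq_intros d refl)+ (simp add: algebra_simps)
    show "ht t x * v t x + h t x * vt t x + (hx t x * (v t x)\<^sup>2 + 2 * h t x * v t x * vx t x + g * h t x * hx t x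
        - \<mu> * (hx t x * vx t x + h t x * vxx t x)) = h t x * f t"
      using momentum_eq[OF tx] tx by (simp add: continuity_eq power2_eq_square algebra_simps)
  qed (use t in auto)
  then have 1: "(momentum has_real_derivative m * f t - (\<Phi> t L - \<Phi> t 0)) (at t)"
    using mass[of t] t by (simp add: momentum_def[abs_def])
  have 2: "(level_drop has_real_derivative \<mu> * (ht t L - ht t 0)) (at t)"
    unfolding level_drop_def[abs_def] using t params(1) by (intro DERIV_cmult DERIV_diff h_t) auto
  have "m * f t - (\<Phi> t L - \<Phi> t 0) + \<mu> * (ht t L - ht t 0) = m * f t - g / 2 * ((h t L)\<^sup>2 - (h t 0)\<^sup>2)"
    using continuity_eq[of t L] continuity_eq[of t 0] v_0[of t] v_L[of t] t params(1)
    by (simp add: \<Phi>_def algebra_simps)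
  with DERIV_add[OF 1 2] show ?thesis by simp
qed

lemma energy_cont: "continuous_on {0..} energy"
proof -
  note c = h_cont[unfolded case_prod_beta'] hx_cont[unfolded case_prod_beta'] v_cont[unfolded case_prod_beta']
  have nz: "h (fst p) (snd p) \<noteq> 0" if "p \<in> {0..} \<times> {0..L}" for p
    using h_pos[of "fst p" "snd p"] that by fastforce
  have "continuous_on ({0..} \<times> cbox 0 L) (\<lambda>(t, x). energy_density g \<mu> hs (h t) (hx t) (v t) x)"
    unfolding energy_density_def case_prod_beta' cbox_interval using c nz by (intro continuous_intros) auto
  from integral_continuous_on_param[OF this] show ?thesis
    unfolding energy_def[abs_def] cbox_interval .
qed

lemma momentum_cont: "continuous_on {0..} momentum"
proof -
  note c = h_cont[unfolded case_prod_beta'] v_cont[unfolded case_prod_beta']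
  have "continuous_on ({0..} \<times> cbox 0 L) (\<lambda>(t, x). h t x * v t x)"
    unfolding case_prod_beta' cbox_interval using c by (intro continuous_intros) auto
  from integral_continuous_on_param[OF this] show ?thesis
    unfolding momentum_def[abs_def] cbox_interval .
qed

lemma level_drop_cont: "continuous_on {0..} level_drop"
proof -
  have "continuous_on {0..} (\<lambda>t. h t x)" if "x \<in> {0..L}" for x
  proof -
    have "continuous_on {0..} (\<lambda>t. case (t, x) of (t, x) \<Rightarrow> h t x)"
      by (rule continuous_on_compose2[OF h_cont]) (use that in \<open>auto intro!: continuous_intros\<close>)
    then show ?thesis by simp
  qed
  then show ?thesis
    unfolding level_drop_def[abs_def] using params(1) by (intro continuous_intros) auto
qed

end

section \<open>From the regularity classes to pointwise equations\<close>

lemma has_real_derivative_vector_derivative: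
  assumes "u differentiable (at x within S)"
  shows "(u has_real_derivative vector_derivative u (at x within S)) (at x within S)"
  using assms by (simp add: vector_derivative_works has_real_derivative_iff_has_vector_derivative)

lemma vector_derivative_within_Icc:
  fixes u :: "real \<Rightarrow> real"
  assumes "(u has_real_derivative d) (at x within {a..b})" "a < b" "x \<in> {a..b}"
  shows "vector_derivative u (at x within {a..b}) = d"
  using assms vector_derivative_within_cbox[of a b x u d]
  by (simp add: has_real_derivative_iff_has_vector_derivative)

lemma vector_derivative_at_real:
  fixes u :: "real \<Rightarrow> real"
  assumes "(u has_real_derivative d) (at x)"
  shows "vector_derivative u (at x) = d"
  using assms by (intro vector_derivative_at) (simp add: has_real_derivative_iff_has_vector_derivative)

text \<open>The regularity classes and the equations use derivatives within closed and open
  intervals; these agree with ordinary derivatives at interior points. Expanding the products then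
  turns the conservative equations into those of the locale.\<close>

lemma tank_flow_classical_solution:
  assumes pos: "0 < L" "0 < g" "0 < \<mu>" and hs: "hs = m / L"
    and reg: "classical_regularity L f \<xi> w h v \<zeta> z" and model: "tank_model L g \<mu> m f \<xi> w h v"
  shows "tank_flow L g \<mu> m hs f h (Dt {0..} h) (Dx {0..L} h) (Dt {0<..} (Dx {0<..<L} h))
    (Dx {0<..<L} (Dx {0<..<L} h)) v (Dt {0<..} v) (Dx {0..L} v)
    (\<lambda>t x. vector_derivative (\<lambda>y. vector_derivative (v t) (at y within {0<..<L})) (at x within {0<..<L}))"
proof -
  let ?ht = "Dt {0..} h" and ?hx = "Dx {0..L} h" and ?vt = "Dt {0<..} v" and ?vx = "Dx {0..L} v"
  let ?hxt = "Dt {0<..} (Dx {0<..<L} h)" and ?hxx = "Dx {0<..<L} (Dx {0<..<L} h)"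
  let ?vxx = "\<lambda>t x. vector_derivative (\<lambda>y. vector_derivative (v t) (at y within {0<..<L})) (at x within {0<..<L})"
  have h1: "Ck2 1 {0..} {0..L} h" and h2: "Ck2 2 {0<..} {0<..<L} h"
    and v0: "Ck2 0 {0..} {0..L} v" and v1: "Ck2 1 {0<..} {0..L} v"
    and v2: "\<And>t. 0 < t \<Longrightarrow> Ck 2 {0<..<L} (v t)" and f: "continuous_on {0..} f"
    and h_pos: "\<And>t x. \<lbrakk>0 \<le> t; x \<in> {0..L}\<rbrakk> \<Longrightarrow> 0 < h t x"
    using reg by (auto simp: classical_regularity_def)
  have at_t: "at t within {0..} = at t" if "0 < t" for t :: real
    using that by (intro at_within_interior) (simp add: interior_real_atLeast)
  have at_t': "at t within {0<..} = at t" if "0 < t" for t :: real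
    using that by (intro at_within_open) auto
  have at_x: "at x within {0..L} = at x" if "0 < x" "x < L" for x
    using that by (simp add: at_within_Icc_at)
  have at_x': "at x within {0<..<L} = at x" if "0 < x" "x < L" for x
    using that by (intro at_within_open) auto
  have h_x: "(h t has_real_derivative ?hx t x) (at x within {0..L})" if "0 \<le> t" "x \<in> {0..L}" for t x
    using h1 that unfolding Dx_def
    by (intro has_real_derivative_vector_derivative) (simp add: differentiable_on_def)
  have h_t: "((\<lambda>s. h s x) has_real_derivative ?ht t x) (at t)" if "0 < t" "x \<in> {0..L}" for t x
  proof -
    have "((\<lambda>s. h s x) has_real_derivative ?ht t x) (at t within {0..})"
      using h1 that unfolding Dt_def
      by (intro has_real_derivative_vector_derivative) (simp add: differentiable_on_def)
    then show ?thesis using at_t[OF that(1)] by simp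
  qed
  have v_x: "(v t has_real_derivative ?vx t x) (at x within {0..L})" if "0 < t" "x \<in> {0..L}" for t x
    using v1 that unfolding Dx_def
    by (intro has_real_derivative_vector_derivative) (simp add: differentiable_on_def)
  have v_t: "((\<lambda>s. v s x) has_real_derivative ?vt t x) (at t)" if "0 < t" "x \<in> {0..L}" for t x
  proof -
    have "((\<lambda>s. v s x) has_real_derivative ?vt t x) (at t within {0<..})"
      using v1 that unfolding Dt_def
      by (intro has_real_derivative_vector_derivative) (simp add: differentiable_on_def)
    then show ?thesis using at_t'[OF that(1)] by simp
  qed
  have hx_int: "Dx {0<..<L} h t x = ?hx t x" if "0 < x" "x < L" for t x
    unfolding Dx_def using at_x[OF that] at_x'[OF that] by simp
  have h2': "Ck2 1 {0<..} {0<..<L} (Dx {0<..<L} h)"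
    using h2 by (simp add: numeral_2_eq_2)
  have h_xt: "((\<lambda>s. ?hx s x) has_real_derivative ?hxt t x) (at t)" if "0 < t" "0 < x" "x < L" for t x
  proof -
    have "((\<lambda>s. Dx {0<..<L} h s x) has_real_derivative ?hxt t x) (at t within {0<..})"
      unfolding Dt_def using h2' that
      by (intro has_real_derivative_vector_derivative) (simp add: differentiable_on_def)
    then show ?thesis using at_t'[OF that(1)] hx_int[OF that(2,3)] by simp
  qed
  have h_xx: "(?hx t has_real_derivative ?hxx t x) (at x)" if "0 < t" "0 < x" "x < L" for t x
  proof -
    have "(Dx {0<..<L} h t has_real_derivative ?hxx t x) (at x within {0<..<L})"
      unfolding Dx_def[of _ "Dx {0<..<L} h"] using h2' that
      by (intro has_real_derivative_vector_derivative) (simp add: differentiable_on_def)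
    then have "(Dx {0<..<L} h t has_real_derivative ?hxx t x) (at x)"
      using at_x'[OF that(2,3)] by simp
    then show ?thesis
      by (rule has_field_derivative_transform_within_open[where S = "{0<..<L}"])
        (use that hx_int in auto)
  qed
  have v_xx: "(?vx t has_real_derivative ?vxx t x) (at x)" if "0 < t" "0 < x" "x < L" for t x
  proof -
    have "((\<lambda>y. vector_derivative (v t) (at y within {0<..<L})) has_real_derivative ?vxx t x) (at x within {0<..<L})"
      using v2[OF that(1)] that
      by (intro has_real_derivative_vector_derivative) (simp add: differentiable_on_def numeral_2_eq_2)
    then have "((\<lambda>y. vector_derivative (v t) (at y within {0<..<L})) has_real_derivative ?vxx t x) (at x)"
      using at_x'[OF that(2,3)] by simp
    then show ?thesis
    proof (rule has_field_derivative_transform_within_open[where S = "{0<..<L}"])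
      show "vector_derivative (v t) (at y within {0<..<L}) = ?vx t y" if "y \<in> {0<..<L}" for y
        using at_x[of y] at_x'[of y] that by (simp add: Dx_def)
    qed (use that in auto)
  qed
  have continuity: "?ht t x = - (?hx t x * v t x + h t x * ?vx t x)" if tx: "0 < t" "x \<in> {0..L}" for t x
  proof -
    have "((\<lambda>y. h t y * v t y) has_real_derivative ?hx t x * v t x + h t x * ?vx t x) (at x within {0..L})"
      using DERIV_mult[OF h_x v_x, of t x t] tx by (simp add: algebra_simps)
    then have "Dx {0..L} (\<lambda>t x. h t x * v t x) t x = ?hx t x * v t x + h t x * ?vx t x"
      unfolding Dx_def[of _ "\<lambda>t x. h t x * v t x"] using pos tx by (intro vector_derivative_within_Icc) auto
    moreover have "?ht t x + Dx {0..L} (\<lambda>t x. h t x * v t x) t x = 0"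
      using model tx by (auto simp: tank_model_def)
    ultimately show ?thesis by simp
  qed
  have momentum: "h t x * ?vt t x + h t x * v t x * ?vx t x + g * h t x * ?hx t x =
      \<mu> * (?hx t x * ?vx t x + h t x * ?vxx t x) + h t x * f t" if tx: "0 < t" "0 < x" "x < L" for t x
  proof -
    have hx: "(h t has_real_derivative ?hx t x) (at x)" and vx: "(v t has_real_derivative ?vx t x) (at x)"
      using h_x[of t x] v_x[of t x] at_x[of x] tx by auto
    have ht: "((\<lambda>s. h s x) has_real_derivative ?ht t x) (at t)" and vt: "((\<lambda>s. v s x) has_real_derivative ?vt t x) (at t)"
      using h_t[of t x] v_t[of t x] tx by auto
    have "((\<lambda>s. h s x * v s x) has_real_derivative ?ht t x * v t x + h t x * ?vt t x) (at t)"
      using DERIV_mult[OF ht vt] by (simp add: algebra_simps)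
    then have 1: "Dt {0..} (\<lambda>t x. h t x * v t x) t x = ?ht t x * v t x + h t x * ?vt t x"
      unfolding Dt_def[of _ "\<lambda>t x. h t x * v t x"] at_t[OF tx(1)] by (rule vector_derivative_at_real)
    have "((\<lambda>y. h t y * (v t y)\<^sup>2 + 1 / 2 * g * (h t y)\<^sup>2) has_real_derivative
        ?hx t x * (v t x)\<^sup>2 + 2 * h t x * v t x * ?vx t x + g * h t x * ?hx t x) (at x)"
      by (rule derivative_eq_intros hx vx refl)+ (simp add: algebra_simps)
    then have 2: "Dx {0..L} (\<lambda>t x. h t x * (v t x)\<^sup>2 + 1 / 2 * g * (h t x)\<^sup>2) t x =
        ?hx t x * (v t x)\<^sup>2 + 2 * h t x * v t x * ?vx t x + g * h t x * ?hx t x"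
      unfolding Dx_def[of _ "\<lambda>t x. h t x * (v t x)\<^sup>2 + 1 / 2 * g * (h t x)\<^sup>2"] at_x[OF tx(2,3)]
      by (rule vector_derivative_at_real)
    have "((\<lambda>y. h t y * ?vx t y) has_real_derivative ?hx t x * ?vx t x + h t x * ?vxx t x) (at x)"
      using DERIV_mult[OF hx v_xx[OF tx]] by (simp add: algebra_simps)
    then have 3: "Dx {0..L} (\<lambda>t x. h t x * ?vx t x) t x = ?hx t x * ?vx t x + h t x * ?vxx t x"
      unfolding Dx_def[of _ "\<lambda>t x. h t x * ?vx t x"] at_x[OF tx(2,3)] by (rule vector_derivative_at_real)
    have "Dt {0..} (\<lambda>t x. h t x * v t x) t x + Dx {0..L} (\<lambda>t x. h t x * (v t x)\<^sup>2 + 1 / 2 * g * (h t x)\<^sup>2) t x =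
        \<mu> * Dx {0..L} (\<lambda>t x. h t x * ?vx t x) t x + h t x * f t"
      using model tx by (auto simp: tank_model_def)
    then show ?thesis
      unfolding 1 2 3 using continuity[of t x] tx by (simp add: power2_eq_square algebra_simps)
  qed
  show ?thesis
  proof
    fix t :: real assume t: "0 \<le> t"
    have "continuous_on {0..L} (h t)"
      using h_x[OF t] by (rule DERIV_continuous_on)
    then show "integral {0..L} (h t) = m"
      using model t by (simp add: tank_model_def flip: lebesgue_on_integral_continuous)
    show "v t 0 = 0" "v t L = 0" using model t by (auto simp: tank_model_def)
  next
    show "continuous_on ({0..} \<times> {0..L}) (\<lambda>(t, x). h t x)" "continuous_on ({0..} \<times> {0..L}) (\<lambda>(t, x). ?hx t x)"
      using h1 by simp_all
    show "continuous_on ({0<..} \<times> {0..L}) (\<lambda>(t, x). ?ht t x)"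
    proof (rule continuous_on_subset)
      show "continuous_on ({0..} \<times> {0..L}) (\<lambda>(t, x). ?ht t x)" using h1 by simp
    qed force
    show "continuous_on ({0..} \<times> {0..L}) (\<lambda>(t, x). v t x)" using v0 by simp
    show "continuous_on ({0<..} \<times> {0..L}) (\<lambda>(t, x). ?vt t x)" "continuous_on ({0<..} \<times> {0..L}) (\<lambda>(t, x). ?vx t x)"
      using v1 by simp_all
    show "continuous_on ({0<..} \<times> {0<..<L}) (\<lambda>(t, x). ?hxt t x)" using h2' by simp
  qed (fact pos hs h_x h_t v_x v_t h_xt h_xx v_xx f h_pos continuity momentum)+
qed

text \<open>The energy contributes \<open>f (2 P + D)\<close> and the term in \<open>s\<close>
  contributes \<open>- q s f\<close>, so the force enters as \<open>f A\<close>; the feedback makes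
  this \<open>- \<sigma> A^2\<close> plus couplings with \<open>y\<close>, \<open>P\<close> and
  \<open>e\<close>.\<close>

lemma (in tank_flow) Lyapunov_derivative:
  fixes \<xi> w \<zeta> z :: "real \<Rightarrow> real" and q k \<sigma> \<gamma> \<beta> lam :: real
  assumes t: "0 < t" and "0 < \<gamma>"
    and \<xi>: "(\<xi> has_real_derivative w t) (at t)" and w: "(w has_real_derivative - f t) (at t)"
    and \<zeta>: "(\<zeta> has_real_derivative (- \<gamma> * \<zeta> t - \<gamma>\<^sup>2 * \<xi> t - f t)) (at t)"
    and z: "(z has_real_derivative
      (m * f t - g / 2 * ((h t L)\<^sup>2 - (h t 0)\<^sup>2) - \<beta> * (z t - level_drop t))) (at t)"
    and f: "f t = - \<sigma> * (2 * lam * z t + (1 - 2 * lam) * level_drop t - q * (\<zeta> t + (\<gamma> + k) * \<xi> t))"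
  defines "e \<equiv> \<lambda>t. \<zeta> t - w t + \<gamma> * \<xi> t" and "y \<equiv> \<lambda>t. z t - momentum t - level_drop t"
    and "s \<equiv> \<lambda>t. w t + k * \<xi> t"
  shows "((\<lambda>t. energy t + q * k\<^sup>2 / 2 * (\<xi> t)\<^sup>2 + q / 2 * (s t)\<^sup>2 + \<sigma> * q\<^sup>2 / \<gamma> * (e t)\<^sup>2 + lam / 2 * (y t)\<^sup>2)
    has_real_derivative
    - \<mu> * integral {0..L} (\<lambda>x. h t x * (vx t x)\<^sup>2) - g * \<mu> * integral {0..L} (\<lambda>x. (hx t x)\<^sup>2)
    + q * k * (s t)\<^sup>2 - q * k ^ 3 * (\<xi> t)\<^sup>2
    - \<sigma> * (2 * momentum t + level_drop t - q * s t + 2 * lam * y t - 2 * (1 - lam) * momentum t - q * e t)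
      * (2 * momentum t + level_drop t - q * s t)
    - 2 * \<sigma> * q\<^sup>2 * (e t)\<^sup>2 - \<beta> * lam * y t * (y t + momentum t)) (at t)"
proof -
  have e': "(e has_real_derivative - \<gamma> * e t) (at t)"
    unfolding e_def by (rule derivative_eq_intros \<zeta> w \<xi> refl)+ (simp add: power2_eq_square algebra_simps)
  have s': "(s has_real_derivative - f t + k * w t) (at t)"
    unfolding s_def by (rule derivative_eq_intros w \<xi> refl)+ simp
  have "((\<lambda>t. z t - (momentum t + level_drop t)) has_real_derivative
      (m * f t - g / 2 * ((h t L)\<^sup>2 - (h t 0)\<^sup>2) - \<beta> * (z t - level_drop t))
      - (m * f t - g / 2 * ((h t L)\<^sup>2 - (h t 0)\<^sup>2))) (at t)"
    by (rule DERIV_diff[OF z momentum_derivative[OF t]])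
  then have y': "(y has_real_derivative - \<beta> * (y t + momentum t)) (at t)"
    by (simp add: y_def diff_diff_eq)
  define A where "A = 2 * momentum t + level_drop t - q * s t"
  \<comment> \<open>Here \<open>z = y + P + D\<close> and
    \<open>\<zeta> + (\<gamma> + k) \<xi> = e + s\<close>, so the measured signals become
    \<open>A\<close> plus the errors and the part of \<open>P\<close> that the filter leaves
    uncompensated.\<close>
  have f': "f t = - \<sigma> * (A + 2 * lam * y t - 2 * (1 - lam) * momentum t - q * e t)"
    unfolding f A_def y_def e_def s_def by (simp add: algebra_simps)
  have w': "w t = s t - k * \<xi> t" by (simp add: s_def)
  have ge: "\<sigma> * q\<^sup>2 / \<gamma> * (2 * e t * (- \<gamma> * e t)) = - 2 * \<sigma> * q\<^sup>2 * (e t)\<^sup>2"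
    using \<open>0 < \<gamma>\<close> by (simp add: power2_eq_square)
  have fA: "f t * A = - \<sigma> * (A + 2 * lam * y t - 2 * (1 - lam) * momentum t - q * e t) * A"
    by (simp only: f')
  have lin: "c + f t * (2 * momentum t + level_drop t) + q * k\<^sup>2 / 2 * (2 * \<xi> t * w t) + q / 2 * (2 * s t * (- f t + k * w t))
      = c + f t * A + q * k * (s t)\<^sup>2 - q * k ^ 3 * (\<xi> t)\<^sup>2" for c
    unfolding A_def w' by (simp add: power2_eq_square power3_eq_cube algebra_simps)
  have sq: "((\<lambda>t. c * (u t)\<^sup>2) has_real_derivative c * (2 * u t * u')) (at t)"
    if "(u has_real_derivative u') (at t)" for u u' c
    by (rule derivative_eq_intros that refl)+ simp
  have "((\<lambda>t. energy t + q * k\<^sup>2 / 2 * (\<xi> t)\<^sup>2 + q / 2 * (s t)\<^sup>2 + \<sigma> * q\<^sup>2 / \<gamma> * (e t)\<^sup>2 + lam / 2 * (y t)\<^sup>2)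
    has_real_derivative
    - \<mu> * integral {0..L} (\<lambda>x. h t x * (vx t x)\<^sup>2) - g * \<mu> * integral {0..L} (\<lambda>x. (hx t x)\<^sup>2)
      + f t * (2 * momentum t + level_drop t) + q * k\<^sup>2 / 2 * (2 * \<xi> t * w t) + q / 2 * (2 * s t * (- f t + k * w t))
      + \<sigma> * q\<^sup>2 / \<gamma> * (2 * e t * (- \<gamma> * e t)) + lam / 2 * (2 * y t * (- \<beta> * (y t + momentum t)))) (at t)"
    by (intro DERIV_add energy_derivative[OF t] sq \<xi> s' e' y')
  from this[unfolded lin ge fA] show ?thesis
    unfolding A_def by (rule DERIV_cong) (simp add: algebra_simps)
qed

context profile
begin

lemma nonneg: "0 \<le> U2" "0 \<le> V2" "0 \<le> H2" "0 \<le> K" "0 \<le> W2"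
proof -
  show "0 \<le> U2" using U2_cont h_pos
    by (intro integral_nonneg integrable_continuous_real) (auto simp: less_imp_le)
  show "0 \<le> V2" using cont h_pos
    by (intro integral_nonneg integrable_continuous_real continuous_intros) (auto simp: less_imp_le)
  show "0 \<le> H2" "0 \<le> K" "0 \<le> W2" using cont
    by (intro integral_nonneg integrable_continuous_real continuous_intros; simp)+
qed

lemma bounds_of_energy:
  assumes "0 \<le> a" "a \<le> hs" "hs \<le> b" "x \<in> {0..L}"
    and "c_const g \<mu> * integral {0..L} (energy_density g \<mu> hs h hx v) \<le> min (level hs a) (level hs b)"
  shows "a \<le> h x \<and> h x \<le> b"
proof -
  have "level hs (h x) \<le> level hs a" "level hs (h x) \<le> level hs b"
    using level_le[OF assms(4)] assms(5) by auto
  moreover have "0 < h x" using assms(4) by (rule h_pos)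
  ultimately show ?thesis
    using level_strict_antimono[of "h x" a hs] level_strict_mono[of hs b "h x"] assms by fastforce
qed

end

lemma sum_abs_sq_bounds:
  fixes S e y lam :: real
  assumes "0 \<le> S" "0 \<le> lam"
  defines "N \<equiv> sqrt S + \<bar>e\<bar> + sqrt lam * \<bar>y\<bar>"
  shows "S + e\<^sup>2 + lam * y\<^sup>2 \<le> N\<^sup>2" "N\<^sup>2 \<le> 3 * (S + e\<^sup>2 + lam * y\<^sup>2)"
proof -
  define a b c where "a = sqrt S" and "b = \<bar>e\<bar>" and "c = sqrt lam * \<bar>y\<bar>"
  have sq: "S = a\<^sup>2" "e\<^sup>2 = b\<^sup>2" "lam * y\<^sup>2 = c\<^sup>2"
    using assms by (simp_all add: a_def b_def c_def power_mult_distrib)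
  have nn: "0 \<le> a" "0 \<le> b" "0 \<le> c" using assms by (auto simp: a_def b_def c_def)
  have N: "N = a + b + c" by (simp add: N_def a_def b_def c_def)
  have "0 \<le> a * b" "0 \<le> a * c" "0 \<le> b * c" using nn by simp_all
  then show "S + e\<^sup>2 + lam * y\<^sup>2 \<le> N\<^sup>2"
    unfolding sq N by (simp add: power2_eq_square algebra_simps)
  have "0 \<le> (a - b)\<^sup>2" "0 \<le> (a - c)\<^sup>2" "0 \<le> (b - c)\<^sup>2" by simp_all
  then show "N\<^sup>2 \<le> 3 * (S + e\<^sup>2 + lam * y\<^sup>2)"
    unfolding sq N by (simp add: power2_eq_square algebra_simps)
qed

theorem theorem2:
  fixes L g \<mu> m Hmax hs r \<sigma> q k \<gamma> \<beta> lam :: real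
  assumes "L > 0" and "g > 0" and "\<mu> > 0" and "m > 0" and "Hmax > 0"
    and "hs = m / L" and "hs < Hmax"
    and "0 \<le> r" and "r < R_const g \<mu> hs Hmax"
    and "\<sigma> > 0" and "q > 0" and "k > 0" and "\<gamma> > 0" and "\<beta> > 0"
    and "0 \<le> lam" and "lam \<le> 1"
    and "2 * g / (\<mu> * L) > \<sigma>" and "\<sigma> > 8 * k / q"
    and "2 * pi\<^sup>2 * \<mu> * G_inv hs (- (c_const g \<mu> * r)) /
           (m * L\<^sup>2 * G_inv hs (c_const g \<mu> * r)) > \<beta> + 4 * \<sigma>"
    and "\<beta> + 4 * \<sigma> > 8 * \<sigma>"
  shows "\<exists>M \<phi>. M > 0 \<and> \<phi> > 0 \<and>
    (\<forall>f \<xi> w h v \<zeta> z.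
       classical_solution L g \<mu> m \<sigma> q k \<gamma> \<beta> lam f \<xi> w h v \<zeta> z \<and>
       Psi_fun L g \<mu> hs \<sigma> q k \<gamma> lam (\<xi> 0) (w 0) (h 0) (v 0) (\<zeta> 0) (z 0) \<le> r \<longrightarrow>
       (\<forall>t\<ge>0.
          (\<xi> t, w t, h t, v t) \<in> X_set L g \<mu> m hs Hmax q k \<and>
          error_size L \<mu> hs \<gamma> lam (\<xi> t) (w t) (h t) (v t) (\<zeta> t) (z t) \<le>
          M * exp (- \<phi> * t) *
            error_size L \<mu> hs \<gamma> lam (\<xi> 0) (w 0) (h 0) (v 0) (\<zeta> 0) (z 0)))"
proof -
  have pos: "0 < L" "0 < g" "0 < \<mu>" "0 < m" "0 < \<sigma>" "0 < q" "0 < k" "0 < \<gamma>" and lam: "0 \<le> lam" "lam \<le> 1"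
    using assms by auto
  have hs: "0 < hs" "hs = m / L" using assms by simp_all
  define c where "c = c_const g \<mu>"
  have c: "0 < c" using pos by (simp add: c_def c_const_def)
  define a0 b0 where "a0 = G_inv hs (- (c * r))" and "b0 = G_inv hs (c * r)"
  \<comment> \<open>The second summand of \<open>R_const\<close> is at most \<open>0\<close>, so
    \<open>c R\<close> does not exceed the level of the dry state.\<close>
  have "c * r < 4 / 3 * hs * sqrt hs"
  proof -
    have "sqrt Hmax * min (Hmax - 3 * hs) 0 \<le> 0"
      using \<open>Hmax > 0\<close> by (intro mult_nonneg_nonpos) auto
    then have "2 * hs * sqrt hs + sqrt Hmax * min (Hmax - 3 * hs) 0 \<le> 2 * hs * sqrt hs" by simp
    then have "R_const g \<mu> hs Hmax \<le> 2 * \<mu> * sqrt g / 3 * (2 * hs * sqrt hs)"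
      unfolding R_const_def using pos by (intro mult_left_mono) auto
    then have "r < 2 * \<mu> * sqrt g / 3 * (2 * hs * sqrt hs)" using \<open>r < R_const g \<mu> hs Hmax\<close> by linarith
    then have "c * r < c * (2 * \<mu> * sqrt g / 3 * (2 * hs * sqrt hs))" using c by (intro mult_strict_left_mono)
    also have "\<dots> = 4 / 3 * hs * sqrt hs" using pos by (simp add: c_def c_const_def)
    finally show ?thesis .
  qed
  then obtain a0: "0 < a0" "a0 \<le> hs" "level hs a0 = c * r" and b0: "hs \<le> b0" "level hs b0 = c * r"
    using level_inverses[of hs "c * r"] hs c \<open>0 \<le> r\<close> unfolding a0_def b0_def by auto
  define X where "X = 2 * pi\<^sup>2 * \<mu> * a0 / (m * L\<^sup>2 * b0)"
  have "\<beta> + 4 * \<sigma> < X" using assms by (simp add: X_def a0_def b0_def c_def)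
  \<comment> \<open>Moving both levels outwards by the factor \<open>\<tau>\<close> multiplies their
    ratio by \<open>\<tau>^2\<close>. The mean of \<open>1\<close> and the quotient
    \<open>(\<beta> + 4 \<sigma>) / X\<close> has a square strictly above that quotient, so the
    strict condition survives.\<close>
  define \<tau> where "\<tau> = (1 + (\<beta> + 4 * \<sigma>) / X) / 2"
  have "0 < X" using \<open>\<beta> + 4 * \<sigma> < X\<close> pos \<open>\<beta> > 0\<close> by linarith
  then have y: "0 < (\<beta> + 4 * \<sigma>) / X" "(\<beta> + 4 * \<sigma>) / X < 1"
    using \<open>\<beta> + 4 * \<sigma> < X\<close> pos \<open>\<beta> > 0\<close> by simp_all
  have \<tau>: "0 < \<tau>" "\<tau> < 1" using y by (simp_all add: \<tau>_def)
  have \<tau>X: "\<beta> + 4 * \<sigma> < \<tau>\<^sup>2 * X"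
  proof -
    have "((1 + u) / 2)\<^sup>2 - u = ((1 - u) / 2)\<^sup>2" for u :: real
      by (simp add: power2_eq_square field_simps)
    then have "\<tau>\<^sup>2 - (\<beta> + 4 * \<sigma>) / X = ((1 - (\<beta> + 4 * \<sigma>) / X) / 2)\<^sup>2"
      unfolding \<tau>_def .
    also have "\<dots> > 0"
      using y by (intro zero_less_power divide_pos_pos) (simp_all only: diff_gt_0_iff_gt zero_less_numeral)
    finally have "(\<beta> + 4 * \<sigma>) / X < \<tau>\<^sup>2" by simp
    then show ?thesis using \<open>0 < X\<close> by (simp add: divide_less_eq)
  qed
  define a b where "a = \<tau> * a0" and "b = b0 / \<tau>"
  have a: "0 < a" "a < a0" using \<tau> a0 by (simp_all add: a_def)
  have "0 < b0" using b0(1) hs(1) by linarith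
  then have b: "b0 < b" using \<tau> mult_strict_left_mono[of \<tau> 1 b0] by (simp add: b_def less_divide_eq)
  have b_pos: "0 < b" using b b0 hs by linarith
  have ratio: "\<beta> / 2 + 2 * \<sigma> < pi\<^sup>2 * \<mu> * a / (m * L\<^sup>2 * b)"
  proof -
    have eq: "pi\<^sup>2 * \<mu> * a / (m * L\<^sup>2 * b) = \<tau>\<^sup>2 * X / 2"
      by (simp add: X_def a_def b_def power2_eq_square mult_ac)
    show ?thesis unfolding eq using \<tau>X by simp
  qed
  \<comment> \<open>The largest value of the functional for which the level estimate still keeps
    \<open>h\<close> between \<open>a\<close> and \<open>b\<close>.\<close>
  define r' where "r' = min (level hs a) (level hs b) / c"
  have "c * r < level hs a" using level_strict_antimono[of a a0 hs] a a0 by simp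
  moreover have "c * r < level hs b" using level_strict_mono[of hs b0 b] b b0 hs by simp
  ultimately have "r < r'" using c by (simp add: r'_def less_divide_eq mult.commute)
  have "\<sigma> / 2 < g / (\<mu> * L)" "k / q \<le> \<sigma> / 8" "4 * \<sigma> \<le> \<beta>" using assms by (auto simp: field_simps)
  from Lyapunov_dissipation[OF pos(1-4) a(1) b_pos pos(5-8) lam this(3,2) ratio this(1)]
  obtain \<kappa> where \<kappa>: "0 < \<kappa>" and dissipation: "\<And>N K P D U2 V2 H2 \<xi> s e y.
      0 \<le> N \<and> 0 \<le> K \<and> P\<^sup>2 \<le> m * V2 \<and> pi\<^sup>2 * a * V2 \<le> L\<^sup>2 * b * N \<and>
      D\<^sup>2 \<le> \<mu>\<^sup>2 * L * K \<and> H2 \<le> L\<^sup>2 * K \<and> U2 \<le> 2 * V2 + 2 * \<mu>\<^sup>2 / a * K \<Longrightarrow>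
    - \<mu> * N - g * \<mu> * K + q * k * s\<^sup>2 - q * k ^ 3 * \<xi>\<^sup>2
      - \<sigma> * (2 * P + D - q * s + 2 * lam * y - 2 * (1 - lam) * P - q * e) * (2 * P + D - q * s)
      - 2 * \<sigma> * q\<^sup>2 * e\<^sup>2 - \<beta> * lam * y * (y + P)
    \<le> - \<kappa> * (U2 / 2 + V2 / 2 + g * H2 + q * k\<^sup>2 / 2 * \<xi>\<^sup>2 + q / 2 * s\<^sup>2 + \<sigma> * q\<^sup>2 / \<gamma> * e\<^sup>2 + lam / 2 * y\<^sup>2)"
    by blast
  obtain C D where CD: "0 < C" "0 < D" and equiv: "\<And>U2 V2 H2 K W2 \<xi> w e y.
      0 \<le> U2 \<and> 0 \<le> V2 \<and> 0 \<le> H2 \<and> 0 \<le> K \<and> 0 \<le> W2 \<and>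
      U2 \<le> 2 * V2 + 2 * \<mu>\<^sup>2 / a * K \<and> V2 \<le> b * W2 \<and> a * W2 \<le> V2 \<and> \<mu>\<^sup>2 * K \<le> 2 * b * (U2 + V2) \<Longrightarrow>
      (let \<Psi> = U2 / 2 + V2 / 2 + g * H2 + q * k\<^sup>2 / 2 * \<xi>\<^sup>2 + q / 2 * (w + k * \<xi>)\<^sup>2 +
          \<sigma> * q\<^sup>2 / \<gamma> * e\<^sup>2 + lam / 2 * y\<^sup>2;
        T = \<xi>\<^sup>2 + w\<^sup>2 + H2 + K + W2 + e\<^sup>2 + lam * y\<^sup>2
       in \<Psi> \<le> C * T \<and> T \<le> D * \<Psi>)"
    using Lyapunov_norm_equivalence[OF pos(2,3) a(1) b_pos pos(5-8) lam(1)] by blast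
  \<comment> \<open>The factor \<open>3\<close> compares the square of a sum of three terms with the
    sum of their squares; the square root also halves the decay rate.\<close>
  define M where "M = sqrt (3 * D * C)"
  show ?thesis
  proof (rule exI[of _ M], rule exI[of _ "\<kappa> / 2"], intro conjI allI impI)
    show "0 < M" "0 < \<kappa> / 2" using CD \<kappa> by (simp_all add: M_def)
  next
    fix f \<xi> w h v \<zeta> z and t :: real
    assume A: "classical_solution L g \<mu> m \<sigma> q k \<gamma> \<beta> lam f \<xi> w h v \<zeta> z \<and>
      Psi_fun L g \<mu> hs \<sigma> q k \<gamma> lam (\<xi> 0) (w 0) (h 0) (v 0) (\<zeta> 0) (z 0) \<le> r" and t: "0 \<le> t"
    then have reg: "classical_regularity L f \<xi> w h v \<zeta> z" and model: "tank_model L g \<mu> m f \<xi> w h v"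
      and obs: "observer \<gamma> f \<xi> \<zeta>" and filt: "momentum_filter L g \<mu> m \<beta> f h z"
      and law: "feedback_law L \<mu> \<sigma> q k \<gamma> lam f \<xi> h \<zeta> z"
      and init: "Psi_fun L g \<mu> hs \<sigma> q k \<gamma> lam (\<xi> 0) (w 0) (h 0) (v 0) (\<zeta> 0) (z 0) \<le> r"
      by (auto simp: classical_solution_def)
    define ht hx hxt hxx vt vx vxx where "ht = Dt {0..} h" and "hx = Dx {0..L} h"
      and "hxt = Dt {0<..} (Dx {0<..<L} h)" and "hxx = Dx {0<..<L} (Dx {0<..<L} h)"
      and "vt = Dt {0<..} v" and "vx = Dx {0..L} v"
      and "vxx = (\<lambda>t x. vector_derivative (\<lambda>y. vector_derivative (v t) (at y within {0<..<L})) (at x within {0<..<L}))"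
    interpret tank_flow L g \<mu> m hs f h ht hx hxt hxx v vt vx vxx
      unfolding ht_def hx_def hxt_def hxx_def vt_def vx_def vxx_def
      by (rule tank_flow_classical_solution[OF pos(1-3) hs(2) reg model])
    define e where "e t = \<zeta> t - w t + \<gamma> * \<xi> t" for t
    define y where "y t = z t - momentum t - level_drop t" for t
    define s where "s t = w t + k * \<xi> t" for t
    define \<Psi> where "\<Psi> t = energy t + q * k\<^sup>2 / 2 * (\<xi> t)\<^sup>2 + q / 2 * (s t)\<^sup>2 + \<sigma> * q\<^sup>2 / \<gamma> * (e t)\<^sup>2 +
      lam / 2 * (y t)\<^sup>2" for t
    have V_eq: "V_fun L g \<mu> hs q k (\<xi> t) (w t) (h t) (v t) = energy t + q * k\<^sup>2 / 2 * (\<xi> t)\<^sup>2 + q / 2 * (s t)\<^sup>2"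
      if "0 \<le> t" for t
      using profile.V_fun_eq[OF profile[OF that]] by (simp add: energy_def s_def)
    have err_eq: "filter_err L \<mu> (h t) (v t) (z t) = y t" if "0 \<le> t" for t
      using profile.filter_err_eq[OF profile[OF that]] by (simp add: y_def momentum_def level_drop_def)
    have Psi_eq: "Psi_fun L g \<mu> hs \<sigma> q k \<gamma> lam (\<xi> t) (w t) (h t) (v t) (\<zeta> t) (z t) = \<Psi> t" if "0 \<le> t" for t
      unfolding Psi_fun_def V_eq[OF that] err_eq[OF that] by (simp add: \<Psi>_def e_def)
    have energy_eq: "energy t = integral {0..L} (\<lambda>x. (h t x * v t x + \<mu> * hx t x)\<^sup>2 / h t x) / 2 +
        integral {0..L} (\<lambda>x. h t x * (v t x)\<^sup>2) / 2 + g * integral {0..L} (\<lambda>x. (h t x - hs)\<^sup>2)" if "0 \<le> t" for t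
      unfolding energy_def using profile.integral_energy_density[OF profile[OF that]] .
    have energy_nonneg: "0 \<le> energy t" if "0 \<le> t" for t
      unfolding energy_eq[OF that] using profile.nonneg[OF profile[OF that]] pos by simp
    have rest_nonneg: "0 \<le> q * k\<^sup>2 / 2 * (\<xi> t)\<^sup>2" "0 \<le> q / 2 * (s t)\<^sup>2" "0 \<le> \<sigma> * q\<^sup>2 / \<gamma> * (e t)\<^sup>2"
      "0 \<le> lam / 2 * (y t)\<^sup>2" for t
      using pos lam by simp_all
    have \<Psi>_nonneg: "0 \<le> \<Psi> t" if "0 \<le> t" for t
      using energy_nonneg[OF that] rest_nonneg[of t] by (simp add: \<Psi>_def)
    have bounds: "a \<le> h t x \<and> h t x \<le> b" if "0 \<le> t" "\<Psi> t \<le> r'" "x \<in> {0..L}" for t x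
    proof (rule profile.bounds_of_energy[OF profile[OF that(1)]])
      have "energy t \<le> r'" using that(2) rest_nonneg[of t] by (simp add: \<Psi>_def)
      then have "c * energy t \<le> min (level hs a) (level hs b)"
        using c by (simp add: r'_def le_divide_eq mult.commute)
      then show "c_const g \<mu> * integral {0..L} (energy_density g \<mu> hs (h t) (hx t) (v t)) \<le> min (level hs a) (level hs b)"
        by (simp add: c_def energy_def)
    qed (use a a0 b b0 that in auto)
    have cont: "continuous_on {0..} \<Psi>"
    proof -
      have "\<xi> differentiable_on {0..}" and c: "continuous_on {0..} w" "continuous_on {0..} \<zeta>" "continuous_on {0..} z"
        using reg by (auto simp: classical_regularity_def)
      then have "continuous_on {0..} \<xi>" by (intro differentiable_imp_continuous_on)
      with c show ?thesis
        unfolding \<Psi>_def[abs_def] s_def e_def y_def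
        using energy_cont momentum_cont level_drop_cont by (intro continuous_intros)
    qed
    have decay: "\<exists>d. (\<Psi> has_real_derivative d) (at t) \<and> d \<le> - \<kappa> * \<Psi> t" if t: "0 < t" and le: "\<Psi> t \<le> r'" for t
    proof -
      interpret P: profile L g \<mu> m hs "h t" "hx t" "v t" using t by (intro profile) simp
      have bd: "a \<le> h t x \<and> h t x \<le> b" if "x \<in> {0..L}" for x using bounds[of t x] t le that by simp
      define N where "N = integral {0..L} (\<lambda>x. h t x * (vx t x)\<^sup>2)"
      have vxc: "continuous_on {0..L} (vx t)" using t by (intro continuous_on_slice[OF vx_cont]) auto
      have "0 \<le> N" unfolding N_def using vxc P.h_cont P.h_pos
        by (intro integral_nonneg integrable_continuous_real continuous_intros) (auto simp: less_imp_le)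
      moreover have "(level_drop t)\<^sup>2 \<le> \<mu>\<^sup>2 * L * P.K"
      proof -
        have "\<mu>\<^sup>2 * (h t L - h t 0)\<^sup>2 \<le> \<mu>\<^sup>2 * (L * P.K)"
          using P.height_diff_sq_le[of L 0] pos by (intro mult_left_mono) auto
        then show ?thesis by (simp add: level_drop_def power_mult_distrib mult.assoc)
      qed
      moreover have "pi\<^sup>2 * a * P.V2 \<le> L\<^sup>2 * b * N"
        unfolding N_def using t v_0[of t] v_L[of t] by (intro P.dissipation_ge a(1) bd v_x vxc) auto
      moreover have "(momentum t)\<^sup>2 \<le> m * P.V2" unfolding momentum_def by (rule P.momentum_sq_le)
      moreover have "P.U2 \<le> 2 * P.V2 + 2 * \<mu>\<^sup>2 / a * P.K" by (rule P.U2_le[OF a(1) bd])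
      ultimately have "- \<mu> * N - g * \<mu> * P.K + q * k * (s t)\<^sup>2 - q * k ^ 3 * (\<xi> t)\<^sup>2
        - \<sigma> * (2 * momentum t + level_drop t - q * s t + 2 * lam * y t - 2 * (1 - lam) * momentum t - q * e t)
          * (2 * momentum t + level_drop t - q * s t)
        - 2 * \<sigma> * q\<^sup>2 * (e t)\<^sup>2 - \<beta> * lam * y t * (y t + momentum t)
        \<le> - \<kappa> * (P.U2 / 2 + P.V2 / 2 + g * P.H2 + q * k\<^sup>2 / 2 * (\<xi> t)\<^sup>2 + q / 2 * (s t)\<^sup>2 +
            \<sigma> * q\<^sup>2 / \<gamma> * (e t)\<^sup>2 + lam / 2 * (y t)\<^sup>2)"
        using P.nonneg P.H2_le by (intro dissipation) auto
      also have "\<dots> = - \<kappa> * \<Psi> t" using energy_eq[of t] t by (simp add: \<Psi>_def)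
      finally have "- \<mu> * N - g * \<mu> * P.K + q * k * (s t)\<^sup>2 - q * k ^ 3 * (\<xi> t)\<^sup>2
        - \<sigma> * (2 * momentum t + level_drop t - q * s t + 2 * lam * y t - 2 * (1 - lam) * momentum t - q * e t)
          * (2 * momentum t + level_drop t - q * s t)
        - 2 * \<sigma> * q\<^sup>2 * (e t)\<^sup>2 - \<beta> * lam * y t * (y t + momentum t) \<le> - \<kappa> * \<Psi> t" .
      moreover have "(\<Psi> has_real_derivative - \<mu> * N - g * \<mu> * P.K + q * k * (s t)\<^sup>2 - q * k ^ 3 * (\<xi> t)\<^sup>2
        - \<sigma> * (2 * momentum t + level_drop t - q * s t + 2 * lam * y t - 2 * (1 - lam) * momentum t - q * e t)
          * (2 * momentum t + level_drop t - q * s t)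
        - 2 * \<sigma> * q\<^sup>2 * (e t)\<^sup>2 - \<beta> * lam * y t * (y t + momentum t)) (at t)"
        unfolding \<Psi>_def[abs_def] N_def s_def e_def y_def
      proof (rule Lyapunov_derivative[OF t pos(8)])
        show "(\<xi> has_real_derivative w t) (at t)" "(w has_real_derivative - f t) (at t)"
          using model t by (auto simp: tank_model_def)
        show "(\<zeta> has_real_derivative (- \<gamma> * \<zeta> t - \<gamma>\<^sup>2 * \<xi> t - f t)) (at t)"
          using obs t by (auto simp: observer_def)
        show "(z has_real_derivative
          (m * f t - g / 2 * ((h t L)\<^sup>2 - (h t 0)\<^sup>2) - \<beta> * (z t - level_drop t))) (at t)"
          using filt t by (auto simp: momentum_filter_def level_drop_def)
        show "f t = - \<sigma> * (2 * lam * z t + (1 - 2 * lam) * level_drop t - q * (\<zeta> t + (\<gamma> + k) * \<xi> t))"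
          using law t by (simp add: feedback_law_def level_drop_def mult.assoc)
      qed
      ultimately show ?thesis by blast
    qed
    have init': "\<Psi> 0 \<le> r" using init Psi_eq[of 0] by simp
    have decay': "\<Psi> t \<le> r" "\<Psi> t \<le> \<Psi> 0 * exp (- \<kappa> * t)" if "0 \<le> t" for t
      using that by (intro decay_from_sublevel[OF cont \<open>r < r'\<close> init' \<kappa>] \<Psi>_nonneg decay; simp)+
    define N where "N t = error_size L \<mu> hs \<gamma> lam (\<xi> t) (w t) (h t) (v t) (\<zeta> t) (z t)" for t
    have N: "\<Psi> t \<le> C * (N t)\<^sup>2 \<and> (N t)\<^sup>2 \<le> 3 * D * \<Psi> t \<and> 0 \<le> N t" if t: "0 \<le> t" for t
    proof -
      interpret P: profile L g \<mu> m hs "h t" "hx t" "v t" using t by (rule profile)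
      \<comment> \<open>Invariance makes the level bounds, and with them the norm equivalence, hold
        at every time.\<close>
      have bd: "a \<le> h t x \<and> h t x \<le> b" if "x \<in> {0..L}" for x
        using bounds[of t x] decay'(1)[OF t] \<open>r < r'\<close> t that by simp
      define S where "S = (\<xi> t)\<^sup>2 + (w t)\<^sup>2 + P.H2 + P.K + P.W2"
      have S: "0 \<le> S" using P.nonneg by (simp add: S_def)
      have N_eq: "N t = sqrt S + \<bar>e t\<bar> + sqrt lam * \<bar>y t\<bar>"
        unfolding N_def error_size_def P.norm_X_eq err_eq[OF t] by (simp add: S_def e_def)
      define T where "T = S + (e t)\<^sup>2 + lam * (y t)\<^sup>2"
      have T: "T \<le> (N t)\<^sup>2" "(N t)\<^sup>2 \<le> 3 * T"
        unfolding N_eq T_def by (rule sum_abs_sq_bounds[OF S lam(1)])+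
      have "\<Psi> t \<le> C * T \<and> T \<le> D * \<Psi> t"
      proof -
        have "P.U2 \<le> 2 * P.V2 + 2 * \<mu>\<^sup>2 / a * P.K" "a * P.W2 \<le> P.V2" "P.V2 \<le> b * P.W2"
          "\<mu>\<^sup>2 * P.K \<le> 2 * b * (P.U2 + P.V2)"
          by (rule P.U2_le[OF a(1)] P.V2_bounds[OF a(1)] P.K_le[OF a(1)]; erule bd)+
        then show ?thesis
          using equiv[of P.U2 P.V2 P.H2 P.K P.W2 "\<xi> t" "w t" "e t" "y t"] P.nonneg
          unfolding Let_def T_def S_def \<Psi>_def s_def energy_eq[OF t] by blast
      qed
      moreover have "C * T \<le> C * (N t)\<^sup>2" using T CD by (intro mult_left_mono) auto
      moreover have "0 \<le> N t" unfolding N_eq using S lam by simp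
      ultimately show ?thesis using T by auto
    qed
    have "(N t)\<^sup>2 \<le> 3 * D * \<Psi> t" using N[OF t] by simp
    also have "\<dots> \<le> 3 * D * (\<Psi> 0 * exp (- \<kappa> * t))"
      using decay'(2)[OF t] CD by (intro mult_left_mono) auto
    also have "\<dots> \<le> 3 * D * (C * (N 0)\<^sup>2 * exp (- \<kappa> * t))"
      using N[of 0] CD by (intro mult_left_mono mult_right_mono) auto
    also have "\<dots> = (M * exp (- (\<kappa> / 2) * t) * N 0)\<^sup>2"
      using CD by (simp add: M_def power_mult_distrib exp_double[symmetric])
    finally have "N t \<le> M * exp (- (\<kappa> / 2) * t) * N 0"
      by (rule power2_le_imp_le) (use N[of 0] CD in \<open>simp add: M_def\<close>)
    then show "error_size L \<mu> hs \<gamma> lam (\<xi> t) (w t) (h t) (v t) (\<zeta> t) (z t) \<le>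
          M * exp (- (\<kappa> / 2) * t) * error_size L \<mu> hs \<gamma> lam (\<xi> 0) (w 0) (h 0) (v 0) (\<zeta> 0) (z 0)"
      by (simp add: N_def)
    have "(\<xi> t, w t, h t, v t) \<in> state_space L m"
      using profile.in_state_space[OF profile[OF t]] v_0[OF t] v_L[OF t] by blast
    moreover have "V_fun L g \<mu> hs q k (\<xi> t) (w t) (h t) (v t) < R_const g \<mu> hs Hmax"
      using decay'(1)[OF t] rest_nonneg[of t] \<open>r < R_const g \<mu> hs Hmax\<close>
      unfolding V_eq[OF t] \<Psi>_def by linarith
    ultimately show "(\<xi> t, w t, h t, v t) \<in> X_set L g \<mu> m hs Hmax q k"
      by (simp add: X_set_def)
  qed
qed

end
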